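(* For the functional $\mathcal F:E^m\to\mathbb R$ defined in the context, there exists $(\mathbf h^*,\mathbf g^* )\in E^m$ such that $$\mathcal F(\mathbf h^*,\mathbf g^* )=\min_{(\mathbf h,\mathbf g)\in E^m}\mathcal F(\mathbf h,\mathbf g).$$
   Context: Fix $d,m,\ell\in\mathbb N$ (all $\ge1$), $T>0$, $\sigma>0$, constants $M,L>0$, a filtered probability space $(\Omega,\mathcal F,(\mathcal F_t),\mathbb P)$ and a $d$-dimensional $(\mathcal F_t)$-Brownian motion $W$. $\mathcal W_p(\mathbb R^d)$ is the space of Borel probability measures on $\mathbb R^d$ with finite $p$-th moment, with the $p$-Wasserstein distance. $\mathrm{Law}(X)=X_\sharp\mathbb P$. For a Lipschitz $H$ and $\mu\in\mathcal W_1(\mathbb R^d)$, $H\ast\mu(x)=\int_{\mathbb R^d}H(x-y)\,d\mu(y)$. $H_1,H_2,K_1,K_2:\mathbb R^d\to\mathbb R^d$ are globally Lipschitz. Fix $\mu_0\in\mathcal W_p(\mathbb R^d)$ for some $p>1$, an $\mathcal F_0$-measurable $\overline X_0$ with $\mathrm{Law}(\overline X_0)=\mu_0$, and $\mathbf Y_0=(\overline Y_0^1,\dots,\overline Y_0^m)\in(\mathbb R^d)^m$. $\mathcal U\subset\mathbb R^{d\times\ell}$ is a compact set. $L^1([0,T];\mathcal U)$ is the set of integrable functions with values in $\mathcal U$. $\mathcal G$ is the compact subset of $C^0(\mathcal W_1(\mathbb R^d);\mathbb R^\ell)$ made up of the functions that are bounded by $M$ and $L$-Lipschitz. $E=L^1([0,T];\mathcal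 U)\times\mathcal G$, and elements of $E^m$ are written $(\mathbf h,\mathbf g)$ with $\mathbf h=(h^1,\dots,h^m)$, $\mathbf g=(g^1,\dots,g^m)$. $\mathcal L:[0,T]\times(\mathbb R^d)^m\times\mathcal W_1(\mathbb R^d)\to\mathbb R$ is continuous; $\Psi:(\mathbb R^{d\times\ell})^m\times(\mathbb R^\ell)^m\to\mathbb R$ is continuous and convex in the first variable. For $(\mathbf h,\mathbf g)\in E^m$, let $\overline X$ (a $C^0([0,T];\mathbb R^d)$-valued random variable) and $\overline{\mathbf Y}=(\overline Y^1,\dots,\overline Y^m)$ (deterministic) be the unique pathwise solution of $$\begin{cases} d\overline X(t)=\Big(H_1\ast\overline\mu_t(\overline X(t))+\frac1m\sum_{j=1}^mK_1(\overline Y^j(t)-\overline X(t))\Big)dt+\sqrt{2\sigma}\,dW(t)\\ \frac{d}{dt}\overline Y^i(t)=K_2\ast\overline\mu_t(\overline Y^i(t))+\frac1m\sum_{j=1}^mH_2(\overline Y^j(t)-\overline Y^i(t))+h^i(t)g^i(\overline\mu_t),\quad i=1,\dots,m\\ \overline X(0)=\overline X_0,\ \overline Y^i(0)=\overline Y^i_0,\qquad \overline\mu_t=\mathrm{Law}(\overline X(t)),\end{cases}$$ (SDE in integral form almost surely for all $t$; ODEs in the Carathéodory sense; $h^i(t)g^i(\cdot)$ is the matrix-vector product), and set $$\mathcal F(\mathbf h,\mathbf g)=\int_0^T\mathcal L(t,\overline{\mathbf Y}(t),\overline\mu_t)\,dt+\int_0^T\Psi(\mathbf h(t),\mathbf g(\overline\mu_t))\,dt,$$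 where $\mathbf g(\mu)=(g^1(\mu),\dots,g^m(\mu))$.
   Formalization: The compact set 𝒰 is additionally assumed convex and nonempty; for nonconvex 𝒰 the claim can fail, e.g. 𝒰={-1,1}, all kernels 0, Y_0=0, running cost y², Ψ(a,b)=(b-M)², where the infimum 0 is not attained. *)

theory Defs
  imports "HOL-Probability.Probability"
begin

section \<open>Wasserstein spaces\<close>

definition wasserstein_space :: "real \<Rightarrow> 'a::euclidean_space measure set" where
  "wasserstein_space p =
     {\<mu>. prob_space \<mu> \<and> sets \<mu> = sets borel \<and> integrable \<mu> (\<lambda>x. norm x powr p)}"

definition couplings :: "'a::euclidean_space measure \<Rightarrow> 'a measure \<Rightarrow> ('a \<times> 'a) measure set" where
  "couplings \<mu> \<nu> =
     {\<pi>. prob_space \<pi> \<and> sets \<pi> = sets borel \<and> distr \<pi> borel fst = \<mu> \<and> distr \<pi> borel snd = \<nu>}"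

definition wasserstein_dist :: "real \<Rightarrow> 'a::euclidean_space measure \<Rightarrow> 'a measure \<Rightarrow> real" where
  "wasserstein_dist p \<mu> \<nu> =
     (INF \<pi>\<in>couplings \<mu> \<nu>. LINT z|\<pi>. dist (fst z) (snd z) powr p) powr (1 / p)"

text \<open>
  The metric topology of the Wasserstein distance. It is spelled out through balls because
  the topology of the locale Metric_space can only be unfolded once the triangle inequality
  (the gluing lemma for couplings) has been proved.
\<close>
definition wasserstein_topology :: "real \<Rightarrow> 'a::euclidean_space measure topology" where
  "wasserstein_topology p =
     topology (\<lambda>S. S \<subseteq> wasserstein_space p \<and>
       (\<forall>\<mu>\<in>S. \<exists>r>0. \<forall>\<nu>\<in>wasserstein_space p. wasserstein_dist p \<mu> \<nu> < r \<longrightarrow> \<nu> \<in> S))"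

definition law :: "'w measure \<Rightarrow> ('w \<Rightarrow> 'a::euclidean_space) \<Rightarrow> 'a measure" where
  "law P X = distr P borel X"

definition kernel_conv ::
  "('a::euclidean_space \<Rightarrow> 'a) \<Rightarrow> 'a measure \<Rightarrow> 'a \<Rightarrow> 'a" where
  "kernel_conv H \<mu> x = (LINT y|\<mu>. H (x - y))"

definition globally_lipschitz :: "('a::metric_space \<Rightarrow> 'b::metric_space) \<Rightarrow> bool" where
  "globally_lipschitz f \<longleftrightarrow> (\<exists>C. C-lipschitz_on UNIV f)"

section \<open>Filtrations and Brownian motion\<close>

text \<open>
  The index type of the library's filtrations is all of the reals; only the times in
  \<open>[0, T]\<close> are ever used, and a filtration on \<open>[0, T]\<close> extends constantly to the left and right.
\<close>
definition filtered_prob_space :: "'w measure \<Rightarrow> (real \<Rightarrow> 'w measure) \<Rightarrow> bool" where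
  "filtered_prob_space P \<F> \<longleftrightarrow>
     prob_space P \<and> filtration (space P) \<F> \<and> (\<forall>t. subalgebra P (\<F> t))"

text \<open>
  A standard Brownian motion on \<open>[0, T]\<close> relative to a filtration, which is not assumed to be
  complete. As usual in that setting all paths are continuous.
\<close>
definition brownian_motion ::
  "'w measure \<Rightarrow> (real \<Rightarrow> 'w measure) \<Rightarrow> real \<Rightarrow> (real \<Rightarrow> 'w \<Rightarrow> real^'d) \<Rightarrow> bool" where
  "brownian_motion P \<F> T W \<longleftrightarrow>
     (\<forall>t\<in>{0..T}. W t \<in> borel_measurable (\<F> t)) \<and>
     (AE \<omega> in P. W 0 \<omega> = 0) \<and>
     (\<forall>\<omega>\<in>space P. continuous_on {0..T} (\<lambda>t. W t \<omega>)) \<and>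
     (\<forall>s t. 0 \<le> s \<and> s < t \<and> t \<le> T \<longrightarrow>
        prob_space.indep_set P (sets (\<F> s))
          (sets (vimage_algebra (space P) (\<lambda>\<omega>. W t \<omega> - W s \<omega>) borel)) \<and>
        distributed P lborel (\<lambda>\<omega>. W t \<omega> - W s \<omega>)
          (\<lambda>x. ennreal (\<Prod>i\<in>UNIV. normal_density 0 (sqrt (t - s)) (x $ i))))"

section \<open>Controls\<close>

text \<open>Elements of \<open>L\<^sup>1([0,T]; U)\<close> are represented by functions, so values matter a.e. only.\<close>
definition L1_controls :: "real \<Rightarrow> (real^'l^'d) set \<Rightarrow> (real \<Rightarrow> real^'l^'d) set" where
  "L1_controls T U =
     {h. set_integrable lborel {0..T} h \<and> (AE t in lborel. t \<in> {0..T} \<longrightarrow> h t \<in> U)}"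

text \<open>
  Elements of \<open>C\<^sup>0(\<W>\<^sub>1; \<real>\<^sup>l)\<close> are represented by functions on all measures,
  whose values outside the Wasserstein space are irrelevant.
\<close>
definition feedback_maps :: "real \<Rightarrow> real \<Rightarrow> ((real^'d) measure \<Rightarrow> real^'l) set" where
  "feedback_maps Mb Lb =
     {g. (\<forall>\<mu>\<in>wasserstein_space 1. norm (g \<mu>) \<le> Mb) \<and>
         (\<forall>\<mu>\<in>wasserstein_space 1. \<forall>\<nu>\<in>wasserstein_space 1.
            dist (g \<mu>) (g \<nu>) \<le> Lb * wasserstein_dist 1 \<mu> \<nu>)}"

definition admissible ::
  "real \<Rightarrow> (real^'l^'d) set \<Rightarrow> real \<Rightarrow> real \<Rightarrow>
   (('m \<Rightarrow> real \<Rightarrow> real^'l^'d) \<times> ('m \<Rightarrow> (real^'d) measure \<Rightarrow> real^'l)) set" where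
  "admissible T U Mb Lb =
     {(h, g). \<forall>i. h i \<in> L1_controls T U \<and> g i \<in> feedback_maps Mb Lb}"

section \<open>The controlled McKean-Vlasov system and the cost\<close>

definition follower_drift ::
  "(real^'d \<Rightarrow> real^'d) \<Rightarrow> (real^'d \<Rightarrow> real^'d) \<Rightarrow>
   (real^'d) measure \<Rightarrow> (real^'d)^'m \<Rightarrow> real^'d \<Rightarrow> real^'d" where
  "follower_drift H1 K1 \<mu> y x =
     kernel_conv H1 \<mu> x + (1 / real CARD('m)) *\<^sub>R (\<Sum>j\<in>UNIV. K1 (y $ j - x))"

definition leader_drift ::
  "(real^'d \<Rightarrow> real^'d) \<Rightarrow> (real^'d \<Rightarrow> real^'d) \<Rightarrow>
   (real^'d) measure \<Rightarrow> (real^'d)^'m \<Rightarrow> 'm \<Rightarrow> real^'d" where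
  "leader_drift H2 K2 \<mu> y i =
     kernel_conv K2 \<mu> (y $ i) + (1 / real CARD('m)) *\<^sub>R (\<Sum>j\<in>UNIV. H2 (y $ j - y $ i))"

text \<open>
  Integrability is part of the notion of solution since the integral of a non-integrable
  function is 0 here. The initial conditions are the integral equations at \<open>t = 0\<close>, and
  the Caratheodory sense of the ODEs is their integral form.
\<close>
definition mv_solution ::
  "'w measure \<Rightarrow> (real \<Rightarrow> 'w measure) \<Rightarrow> (real \<Rightarrow> 'w \<Rightarrow> real^'d) \<Rightarrow> real \<Rightarrow> real \<Rightarrow>
   (real^'d \<Rightarrow> real^'d) \<Rightarrow> (real^'d \<Rightarrow> real^'d) \<Rightarrow> (real^'d \<Rightarrow> real^'d) \<Rightarrow> (real^'d \<Rightarrow> real^'d) \<Rightarrow>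
   ('w \<Rightarrow> real^'d) \<Rightarrow> (real^'d)^'m \<Rightarrow>
   ('m \<Rightarrow> real \<Rightarrow> real^'l^'d) \<Rightarrow> ('m \<Rightarrow> (real^'d) measure \<Rightarrow> real^'l) \<Rightarrow>
   (real \<Rightarrow> 'w \<Rightarrow> real^'d) \<Rightarrow> (real \<Rightarrow> (real^'d)^'m) \<Rightarrow> bool" where
  "mv_solution P \<F> W T \<sigma> H1 H2 K1 K2 X0 Y0 h g X Y \<longleftrightarrow>
     (\<forall>t\<in>{0..T}. X t \<in> borel_measurable (\<F> t)) \<and>
     (\<forall>\<omega>\<in>space P. continuous_on {0..T} (\<lambda>t. X t \<omega>)) \<and>
     (\<forall>t\<in>{0..T}. law P (X t) \<in> wasserstein_space 1) \<and>
     (AE \<omega> in P. \<forall>t\<in>{0..T}.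
        set_integrable lborel {0..t} (\<lambda>s. follower_drift H1 K1 (law P (X s)) (Y s) (X s \<omega>)) \<and>
        X t \<omega> = X0 \<omega> +
          (LINT s:{0..t}|lborel. follower_drift H1 K1 (law P (X s)) (Y s) (X s \<omega>)) +
          sqrt (2 * \<sigma>) *\<^sub>R (W t \<omega> - W 0 \<omega>)) \<and>
     (\<forall>i. \<forall>t\<in>{0..T}.
        set_integrable lborel {0..t}
          (\<lambda>s. leader_drift H2 K2 (law P (X s)) (Y s) i + h i s *v g i (law P (X s))) \<and>
        Y t $ i = Y0 $ i +
          (LINT s:{0..t}|lborel.
             leader_drift H2 K2 (law P (X s)) (Y s) i + h i s *v g i (law P (X s))))"

definition trajectory_cost ::
  "real \<Rightarrow> (real \<Rightarrow> (real^'d)^'m \<Rightarrow> (real^'d) measure \<Rightarrow> real) \<Rightarrow>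
   ((real^'l^'d)^'m \<Rightarrow> (real^'l)^'m \<Rightarrow> real) \<Rightarrow>
   ('m \<Rightarrow> real \<Rightarrow> real^'l^'d) \<Rightarrow> ('m \<Rightarrow> (real^'d) measure \<Rightarrow> real^'l) \<Rightarrow>
   (real \<Rightarrow> (real^'d) measure) \<Rightarrow> (real \<Rightarrow> (real^'d)^'m) \<Rightarrow> real" where
  "trajectory_cost T \<L> \<Psi> h g \<mu> Y =
     (LINT t:{0..T}|lborel. \<L> t (Y t) (\<mu> t)) +
     (LINT t:{0..T}|lborel. \<Psi> (\<chi> i. h i t) (\<chi> i. g i (\<mu> t)))"

text \<open>
  The solution is unique up to indistinguishability (on \<open>[0, T]\<close>), so the value does not
  depend on the one that is selected.
\<close>
definition cost_functional ::
  "'w measure \<Rightarrow> (real \<Rightarrow> 'w measure) \<Rightarrow> (real \<Rightarrow> 'w \<Rightarrow> real^'d) \<Rightarrow> real \<Rightarrow> real \<Rightarrow>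
   (real^'d \<Rightarrow> real^'d) \<Rightarrow> (real^'d \<Rightarrow> real^'d) \<Rightarrow> (real^'d \<Rightarrow> real^'d) \<Rightarrow> (real^'d \<Rightarrow> real^'d) \<Rightarrow>
   ('w \<Rightarrow> real^'d) \<Rightarrow> (real^'d)^'m \<Rightarrow>
   (real \<Rightarrow> (real^'d)^'m \<Rightarrow> (real^'d) measure \<Rightarrow> real) \<Rightarrow>
   ((real^'l^'d)^'m \<Rightarrow> (real^'l)^'m \<Rightarrow> real) \<Rightarrow>
   ('m \<Rightarrow> real \<Rightarrow> real^'l^'d) \<Rightarrow> ('m \<Rightarrow> (real^'d) measure \<Rightarrow> real^'l) \<Rightarrow> real" where
  "cost_functional P \<F> W T \<sigma> H1 H2 K1 K2 X0 Y0 \<L> \<Psi> h g =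
     (let (X, Y) = (SOME (X, Y). mv_solution P \<F> W T \<sigma> H1 H2 K1 K2 X0 Y0 h g X Y)
      in trajectory_cost T \<L> \<Psi> h g (\<lambda>t. law P (X t)) Y)"

text \<open>
  On the set of control values in the theorem: for a compact set of control values that is not
  convex, a minimizer need not exist. Take \<open>d = m = l = 1\<close>, all kernels 0, \<open>Y0 = 0\<close>,
  \<open>U = {-1, 1}\<close>, running cost \<open>y\<^sup>2\<close> and control cost \<open>\<Psi> a b = (b - Mb)\<^sup>2\<close>. With the
  constant feedback \<open>Mb\<close>, controls that oscillate ever faster drive the total cost to 0; but
  cost 0 forces \<open>Y = 0\<close> and feedback \<open>Mb\<close> for a.e. time, hence \<open>h = 0\<close> a.e. Convexity is what
  makes the set of controls weakly closed. It is also nonempty, or there would be no controls.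
\<close>

end

(*
  The noise is additive, so a path of the follower solves an ODE whose drift sees the law only
  through the field b(t, x) = H1 * mu_t (x) + mean of K1 (Y_j(t) - x). Picard iteration, carried out
  pathwise with the means as parameters, gives adapted solutions with bounds that do not depend on
  the controls; all laws live on one probability space, so W_1 is always estimated by an L^1 distance.

  Along a minimizing sequence the fields b_n are Lipschitz in x and equicontinuous in t. By Arzela-Ascoli
  they converge, hence so do the paths, and by domination the laws converge in W_1; no tightness
  argument is needed. The feedback maps converge along the limit flow of laws, and Tychonoff extends the
  limit to the whole Wasserstein space. Weak compactness of the controls is replaced by convex
  combinations of the tails that converge almost everywhere: this is enough because the control
  enters the ODEs linearly and the cost convexly.
*)
theory Submission
  imports Defs "HOL-Complex_Analysis.Great_Picard"
begin

text \<open>The drift of the abstract equation depends on a random variable rather than on its law.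
  Hence one theory serves three equations: the joint system of follower and leaders, the follower
  for given leaders, and the limit equation with a frozen field. In the joint system the leaders are
  at first random; comparing two paths makes them deterministic. The obstacle in the limit is the
  product of a control that converges only weakly and a feedback that varies along the sequence. So
  the feedback is first replaced by its limit along the limit flow, at a vanishing cost, and only
  then are convex combinations of the controls taken; no state equation is solved for these
  combinations. The leaders' equation and the bound on the control cost then both come from one
  lower semicontinuity statement for convex integrands, the equation by way of linear integrands
  with both signs.\<close>

section \<open>Tools: Caratheodory functions, Gronwall, Arzela-Ascoli\<close>

text \<open>A measurable c is a pointwise limit of simple functions. For these the composition is a
  countable case distinction over y, and continuity in y carries measurability to the limit. This
  yields joint measurability for drifts that are known to be measurable only at fixed
  states.\<close>

lemma borel_measurable_Caratheodory:
  fixes f :: "'a \<Rightarrow> 'b::{metric_space, second_countable_topology} \<Rightarrow> 'c::metric_space"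
  assumes c: "c \<in> borel_measurable M"
    and f: "\<And>y. (\<lambda>x. f x y) \<in> borel_measurable M"
    and cont: "\<And>x. x \<in> space M \<Longrightarrow> continuous_on UNIV (f x)"
  shows "(\<lambda>x. f x (c x)) \<in> borel_measurable M"
proof -
  obtain s where s: "\<And>i. simple_function M (s i)"
    and lim: "\<And>x. x \<in> space M \<Longrightarrow> (\<lambda>i. s i x) \<longlonglongrightarrow> c x"
    using borel_measurable_implies_sequence_metric[OF c] by blast
  have "(\<lambda>x. f x (s i x)) \<in> borel_measurable M" for i
  proof (rule measurable_compose_countable'[where f = "\<lambda>y x. f x y" and g = "s i" and I = "s i ` space M"])
    show "countable (s i ` space M)"
      using simple_functionD(1)[OF s] by (rule countable_finite)
    have "s i -` {y} \<inter> space M \<in> sets M" for y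
      using simple_functionD(2)[OF s] .
    then show "s i \<in> measurable M (count_space (s i ` space M))"
      using \<open>countable (s i ` space M)\<close> by (subst measurable_count_space_eq_countable) auto
  qed (use f in auto)
  then show ?thesis
  proof (rule borel_measurable_LIMSEQ_metric)
    fix x assume x: "x \<in> space M"
    have "isCont (f x) (c x)"
      using cont[OF x] by (simp add: continuous_on_eq_continuous_at)
    then show "(\<lambda>i. f x (s i x)) \<longlonglongrightarrow> f x (c x)"
      using lim[OF x] by (rule isCont_tendsto_compose)
  qed
qed

text \<open>The right-hand side w of the inequality has derivative C * u, which is at most C * w, so
  exp (- C * t) * w t is decreasing.\<close>

lemma Gronwall_integral:
  fixes u :: "real \<Rightarrow> real"
  assumes cont: "continuous_on {0..T} u" and C: "0 \<le> C"
    and le: "\<And>t. t \<in> {0..T} \<Longrightarrow> u t \<le> A + C * integral {0..t} u"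
    and t: "t \<in> {0..T}"
  shows "u t \<le> A * exp (C * t)"
proof -
  define w where "w t = A + C * integral {0..t} u" for t
  define q where "q t = exp (- C * t) * w t" for t
  have dw: "(w has_real_derivative C * u x) (at x within {0..T})" if "x \<in> {0..T}" for x
    using integral_has_real_derivative[OF cont that] unfolding w_def
    by (auto intro!: derivative_eq_intros)
  have cw: "continuous_on {0..T} w"
    using dw by (meson DERIV_continuous continuous_on_eq_continuous_within)
  have "q t \<le> q 0"
  proof (rule DERIV_nonpos_imp_decreasing_open[of 0 t q])
    fix x assume x: "0 < x" "x < t"
    have "(w has_real_derivative C * u x) (at x)"
      using dw[of x] x t at_within_Icc_at[of 0 x T] by auto
    then have "(q has_real_derivative exp (- C * x) * (C * u x - C * w x)) (at x)"
      unfolding q_def by (auto intro!: derivative_eq_intros simp: algebra_simps)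
    moreover have "exp (- C * x) * (C * u x - C * w x) \<le> 0"
      using le[of x] x t C by (auto simp: w_def mult_le_0_iff mult_left_mono)
    ultimately show "\<exists>y. (q has_real_derivative y) (at x) \<and> y \<le> 0" by blast
  next
    show "continuous_on {0..t} q"
      unfolding q_def by (intro continuous_intros continuous_on_subset[OF cw]) (use t in auto)
  qed (use t in auto)
  then have "exp (- C * t) * w t \<le> A"
    by (simp add: q_def w_def)
  then have "w t \<le> A * exp (C * t)"
    by (simp add: exp_minus field_simps)
  then show ?thesis
    using le[OF t] by (simp add: w_def)
qed

text \<open>Arzela-Ascoli with pointwise convergence, so S need not be compact. A diagonal sequence
  converges on a countable dense set; equicontinuity makes it Cauchy at the other points.\<close>

lemma equicontinuous_convergent_subsequence:
  fixes f :: "nat \<Rightarrow> 'a::{metric_space, second_countable_topology} \<Rightarrow> 'b::euclidean_space"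
  assumes bound: "\<And>n x. x \<in> S \<Longrightarrow> norm (f n x) \<le> M x"
    and equi: "\<And>x e. \<lbrakk>x \<in> S; 0 < e\<rbrakk> \<Longrightarrow> \<exists>d>0. \<forall>n y. y \<in> S \<and> dist x y < d \<longrightarrow> dist (f n x) (f n y) < e"
  obtains r g where "strict_mono (r :: nat \<Rightarrow> nat)" "\<And>x. x \<in> S \<Longrightarrow> (\<lambda>n. f (r n) x) \<longlonglongrightarrow> g x"
proof -
  obtain D where D: "countable D" "D \<subseteq> S" "S \<subseteq> closure D"
    using separable by blast
  \<comment> \<open>The diagonal extraction takes one bound for all points. The values are therefore
    divided by 1 + \<bar>M x\<bar> and multiplied back after the extraction.\<close>
  have pos: "0 < 1 + \<bar>M x\<bar>" for x by simp
  have "norm (f n x /\<^sub>R (1 + \<bar>M x\<bar>)) \<le> 1" if "x \<in> D" for n x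
    using bound[of x n] that D(2) by (auto simp: field_simps)
  then obtain r where r: "strict_mono (r :: nat \<Rightarrow> nat)"
    and lim: "\<And>x. x \<in> D \<Longrightarrow> \<exists>l. (\<lambda>n. f (r n) x /\<^sub>R (1 + \<bar>M x\<bar>)) \<longlonglongrightarrow> l"
    using function_convergent_subsequence[OF D(1), of "\<lambda>n x. f n x /\<^sub>R (1 + \<bar>M x\<bar>)" 1] by blast
  have conv: "convergent (\<lambda>n. f (r n) x)" if x: "x \<in> S" for x
  proof -
    have "Cauchy (\<lambda>n. f (r n) x)"
    proof (rule metric_CauchyI)
      fix e :: real assume e: "0 < e"
      obtain d where d: "d > 0" "\<And>n y. y \<in> S \<Longrightarrow> dist x y < d \<Longrightarrow> dist (f n x) (f n y) < e/3"
        using equi[OF x, of "e/3"] e by auto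
      obtain y where y: "y \<in> D" "dist y x < d"
        using D(3) x d(1) by (meson closure_approachable subsetD)
      obtain l where "(\<lambda>n. f (r n) y /\<^sub>R (1 + \<bar>M y\<bar>)) \<longlonglongrightarrow> l"
        using lim[OF y(1)] by blast
      then have "(\<lambda>n. (1 + \<bar>M y\<bar>) *\<^sub>R (f (r n) y /\<^sub>R (1 + \<bar>M y\<bar>))) \<longlonglongrightarrow> (1 + \<bar>M y\<bar>) *\<^sub>R l"
        by (intro tendsto_intros)
      then have "(\<lambda>n. f (r n) y) \<longlonglongrightarrow> (1 + \<bar>M y\<bar>) *\<^sub>R l"
        using pos[of y] by (simp add: less_imp_neq[symmetric])
      then have "Cauchy (\<lambda>n. f (r n) y)"
        by (rule LIMSEQ_imp_Cauchy)
      then obtain N where N: "\<And>m n. m \<ge> N \<Longrightarrow> n \<ge> N \<Longrightarrow> dist (f (r m) y) (f (r n) y) < e/3"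
        using e by (metis metric_CauchyD zero_less_divide_iff zero_less_numeral)
      have "dist (f (r m) x) (f (r n) x) < e" if "m \<ge> N" "n \<ge> N" for m n
      proof -
        have "dist (f (r m) x) (f (r n) x) \<le> dist (f (r m) x) (f (r m) y) + dist (f (r m) y) (f (r n) y) + dist (f (r n) x) (f (r n) y)"
          by (metis add.assoc add.commute add_left_mono dist_commute dist_triangle dist_triangle_le)
        moreover have "y \<in> S" "dist x y < d"
          using y D(2) by (auto simp: dist_commute)
        ultimately show ?thesis
          using d(2)[of y "r m"] d(2)[of y "r n"] N[OF that] by linarith
      qed
      then show "\<exists>N. \<forall>m\<ge>N. \<forall>n\<ge>N. dist (f (r m) x) (f (r n) x) < e" by blast
    qed
    then show ?thesis by (simp add: Cauchy_convergent_iff)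
  qed
  show thesis
  proof (rule that[OF r])
    show "(\<lambda>n. f (r n) x) \<longlonglongrightarrow> lim (\<lambda>n. f (r n) x)" if "x \<in> S" for x
      using conv[OF that] by (simp add: convergent_LIMSEQ_iff)
  qed
qed

section \<open>Almost everywhere convergent convex combinations\<close>

text \<open>Dyadic convex combinations are enough: the parallelogram law and convexity only ever
  meet midpoints, and rule induction replaces finite families of weights.\<close>

inductive_set midpoint_hull :: "('a \<Rightarrow> 'b::real_vector) set \<Rightarrow> ('a \<Rightarrow> 'b) set" for A where
  base: "f \<in> A \<Longrightarrow> f \<in> midpoint_hull A"
| midpoint: "f \<in> midpoint_hull A \<Longrightarrow> g \<in> midpoint_hull A \<Longrightarrow>
    (\<lambda>x. (1/2) *\<^sub>R (f x + g x)) \<in> midpoint_hull A"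

lemma midpoint_hull_mono:
  assumes "A \<subseteq> B" shows "midpoint_hull A \<subseteq> midpoint_hull B"
proof
  fix f assume "f \<in> midpoint_hull A"
  then show "f \<in> midpoint_hull B"
    using assms by induction (auto intro: midpoint_hull.intros)
qed

lemma convex_midpoint:
  assumes "convex K" "x \<in> K" "y \<in> K" shows "(1/2) *\<^sub>R (x + y) \<in> K"
  using convexD[OF assms, of "1/2" "1/2"] by (simp add: scaleR_add_right)

lemma midpoint_hull_mem:
  assumes "convex K" "\<And>f x. f \<in> A \<Longrightarrow> x \<in> S \<Longrightarrow> f x \<in> K" "f \<in> midpoint_hull A" "x \<in> S"
  shows "f x \<in> K"
  using assms(3,4) by induction (auto intro: assms convex_midpoint)

lemma midpoint_hull_measurable:
  fixes A :: "('a \<Rightarrow> 'b::euclidean_space) set"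
  assumes "\<And>f. f \<in> A \<Longrightarrow> f \<in> borel_measurable M" "f \<in> midpoint_hull A"
  shows "f \<in> borel_measurable M"
  using assms(2)
proof induction
  case (base f) then show ?case by (rule assms)
next
  case (midpoint f g)
  note [measurable] = midpoint.IH
  show ?case by measurable
qed

lemma LIMSEQ_from_below:
  fixes a :: "nat \<Rightarrow> real"
  assumes "incseq a" "\<And>n. a n \<le> B" "e > 0"
  obtains N where "\<And>n m. N \<le> n \<Longrightarrow> n \<le> m \<Longrightarrow> a m - a n < e"
proof -
  obtain l where l: "a \<longlonglongrightarrow> l" "\<And>i. a i \<le> l"
    using incseq_convergent[OF assms(1), of B] assms(2) by blast
  then obtain N where "\<And>n. n \<ge> N \<Longrightarrow> dist (a n) l < e"
    using assms(3) unfolding lim_sequentially by blast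
  then show thesis
    using l(2) by (intro that[of N]) (smt (verit) dist_real_def)
qed

text \<open>
  The Komlos-type substitute for weak compactness: near-minimizers of the \<open>L\<^sup>2\<close>-norm in the
  hulls of the tails form a Cauchy sequence by the parallelogram law.
\<close>
lemma midpoint_hull_AE_convergent:
  fixes h :: "nat \<Rightarrow> 'a \<Rightarrow> 'b::euclidean_space"
  assumes "finite_measure M" and meas: "\<And>n. h n \<in> borel_measurable M"
    and K: "compact K" "convex K" "\<And>n x. x \<in> space M \<Longrightarrow> h n x \<in> K"
  obtains k hs where "\<And>n. k n \<in> midpoint_hull (h ` {n..})" "hs \<in> borel_measurable M"
    "AE x in M. (\<lambda>n. k n x) \<longlonglongrightarrow> hs x"
proof -
  interpret finite_measure M by fact
  define H where "H n = midpoint_hull (h ` {n..})" for n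
  define q where "q f = (LINT x|M. (norm (f x))\<^sup>2)" for f :: "'a \<Rightarrow> 'b"
  define a where "a n = (INF f\<in>H n. q f)" for n
  obtain B where B: "\<And>y. y \<in> K \<Longrightarrow> norm y \<le> B"
    using compact_imp_bounded[OF K(1)] by (auto simp: bounded_iff)
  have Hmeas: "f \<in> borel_measurable M" if "f \<in> H n" for f n
    using that meas midpoint_hull_measurable[of "h ` {n..}" M f] unfolding H_def by blast
  have Hle: "norm (f x) \<le> B" if "f \<in> H n" "x \<in> space M" for f n x
    using midpoint_hull_mem[of K "h ` {n..}" "space M" f x] that K B unfolding H_def by blast
  have Hmono: "H m \<subseteq> H n" if "n \<le> m" for m n
    unfolding H_def using that by (intro midpoint_hull_mono) auto
  have hH: "h n \<in> H n" for n
    unfolding H_def by (auto intro: midpoint_hull.base)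
  have int: "integrable M (\<lambda>x. (norm (f x))\<^sup>2)" if "f \<in> H n" for f n
  proof (rule integrable_const_bound[where B = "B\<^sup>2"])
    show "AE x in M. norm ((norm (f x))\<^sup>2) \<le> B\<^sup>2"
      using Hle[OF that] by (auto intro!: AE_I2 power_mono)
  qed (use Hmeas[OF that] in measurable)
  have int1: "integrable M f" if "f \<in> H n" for f n
    by (rule integrable_const_bound[where B = B]) (use Hmeas[OF that] Hle[OF that] in auto)
  have q0: "0 \<le> q f" for f unfolding q_def by simp
  have bdd: "bdd_below (q ` H n)" for n
    using q0 by (intro bdd_belowI[of _ 0]) auto
  have a_le: "a n \<le> q f" if "f \<in> H n" for f n
    unfolding a_def using bdd that by (rule cINF_lower)
  have a_inc: "incseq a"
    unfolding a_def incseq_def using Hmono bdd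
    by (intro allI impI cINF_superset_mono) (use hH in blast | simp)+
  have a_ub: "a n \<le> B\<^sup>2 * measure M (space M)" for n
  proof -
    have "q (h n) \<le> (LINT x|M. B\<^sup>2)"
      unfolding q_def using int[OF hH[of n]] Hle[OF hH[of n]]
      by (intro integral_mono) (auto intro!: power_mono)
    then show ?thesis using a_le[OF hH[of n]] by (simp add: mult.commute)
  qed
  have "\<exists>f\<in>H n. q f < a n + 1 / real (Suc n)" for n
    using cINF_less_iff[of "H n" q "a n + 1 / real (Suc n)"] bdd hH[of n]
    unfolding a_def by auto
  then obtain k where kH: "\<And>n. k n \<in> H n" and kq: "\<And>n. q (k n) < a n + 1 / real (Suc n)"
    by metis
  \<comment> \<open>Parallelogram law: the midpoint of k m and k n lies in H n, so its q is at least
    a n, while k m and k n exceed a m and a n by at most 1 / (n + 1) each.\<close>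
  have par: "q (\<lambda>x. k m x - k n x) \<le> 2 * (a m - a n) + 4 / real (Suc n)" if "n \<le> m" for m n
  proof -
    let ?f = "\<lambda>x. (1/2) *\<^sub>R (k m x + k n x)"
    have km: "k m \<in> H n" using kH[of m] Hmono[OF that] by blast
    then have f: "?f \<in> H n"
      using kH[of n] unfolding H_def by (intro midpoint_hull.midpoint)
    have "q (\<lambda>x. k m x - k n x) = (LINT x|M. 2 * (norm (k m x))\<^sup>2 + 2 * (norm (k n x))\<^sup>2 - 4 * (norm (?f x))\<^sup>2)"
      unfolding q_def
      by (intro Bochner_Integration.integral_cong)
         (simp_all add: power2_norm_eq_inner inner_simps inner_commute algebra_simps)
    also have "\<dots> = 2 * q (k m) + 2 * q (k n) - 4 * q ?f"
      unfolding q_def using int[OF km] int[OF kH[of n]] int[OF f] by simp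
    also have "\<dots> \<le> 2 * (a m - a n) + 4 / real (Suc n)"
    proof -
      have "1 / real (Suc m) \<le> 1 / real (Suc n)"
        using that by (simp add: frac_le)
      moreover have "2 * x + 2 * y - 4 * z \<le> 2 * (s - t) + 4 * v"
        if "u \<le> v" "x < s + u" "y < t + v" "t \<le> z" for x y z s t u v :: real
        using that by argo
      ultimately have "2 * q (k m) + 2 * q (k n) - 4 * q ?f \<le> 2 * (a m - a n) + 4 * (1 / real (Suc n))"
        using kq[of m] kq[of n] a_le[OF f] by blast
      then show ?thesis by simp
    qed
    finally show ?thesis .
  qed
  \<comment> \<open>The summand 1 keeps V positive on a null space.\<close>
  define V where "V = measure M (space M) + 1"
  have V: "V > 0" unfolding V_def by (simp add: add_nonneg_pos)
  have cauchy: "\<exists>N. \<forall>i\<ge>N. \<forall>j\<ge>N. (LINT x|M. norm (k i x - k j x)) < e" if e: "e > 0" for e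
  proof -
    \<comment> \<open>The inequality r \<le> c / 2 + r^2 / (2 c) turns the bound on q into an L^1
      bound; with this c each of the two terms contributes at most e / 2.\<close>
    define c where "c = e / V"
    have c: "c > 0" unfolding c_def using e V by simp
    obtain N1 where N1: "\<And>n m. N1 \<le> n \<Longrightarrow> n \<le> m \<Longrightarrow> a m - a n < c * e / 4"
      using LIMSEQ_from_below[OF a_inc a_ub, of "c * e / 4"] c e by auto
    obtain N2 :: nat where N2: "8 / (c * e) < real N2"
      using reals_Archimedean2 by blast
    have *: "(LINT x|M. norm (k m x - k n x)) < e" if "n \<le> m" "N1 \<le> n" "N2 \<le> n" for m n
    proof -
      have km: "k m \<in> H n" using kH[of m] Hmono[OF that(1)] by blast
      have "8 / (c * e) < real (Suc n)" using N2 that by linarith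
      then have "4 / real (Suc n) < c * e / 2"
        using c e by (simp add: field_simps)
      then have qd: "q (\<lambda>x. k m x - k n x) < c * e"
        using par[OF that(1)] N1[OF that(2,1)] by argo
      have i2: "integrable M (\<lambda>x. (norm (k m x - k n x))\<^sup>2)"
      proof (rule integrable_const_bound[where B = "(2 * B)\<^sup>2"])
        show "AE x in M. norm ((norm (k m x - k n x))\<^sup>2) \<le> (2 * B)\<^sup>2"
        proof (rule AE_I2)
          fix x assume x: "x \<in> space M"
          have "norm (k m x - k n x) \<le> 2 * B"
            using Hle[OF km x] Hle[OF kH[of n] x] norm_triangle_ineq4[of "k m x" "k n x"] by linarith
          then have "(norm (k m x - k n x))\<^sup>2 \<le> (2 * B)\<^sup>2"
            by (rule power_mono) simp
          then show "norm ((norm (k m x - k n x))\<^sup>2) \<le> (2 * B)\<^sup>2" by simp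
        qed
      qed (use Hmeas[OF km] Hmeas[OF kH[of n]] in measurable)
      have "(LINT x|M. norm (k m x - k n x)) \<le> (LINT x|M. c / 2 + (norm (k m x - k n x))\<^sup>2 / (2 * c))"
      proof (rule integral_mono)
        show "integrable M (\<lambda>x. norm (k m x - k n x))"
          using int1[OF km] int1[OF kH[of n]] by auto
        show "integrable M (\<lambda>x. c / 2 + (norm (k m x - k n x))\<^sup>2 / (2 * c))"
          using i2 by auto
        fix x
        have "0 \<le> (norm (k m x - k n x) - c)\<^sup>2" by simp
        then show "norm (k m x - k n x) \<le> c / 2 + (norm (k m x - k n x))\<^sup>2 / (2 * c)"
          using c by (simp add: field_simps power2_eq_square)
      qed
      also have "\<dots> = c / 2 * (V - 1) + q (\<lambda>x. k m x - k n x) / (2 * c)"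
        unfolding q_def V_def using i2 by (simp add: mult.commute)
      also have "\<dots> < c / 2 * V + c * e / (2 * c)"
        using qd c by (intro add_strict_mono divide_strict_right_mono) auto
      also have "\<dots> = e"
        using c V by (simp add: c_def field_simps)
      finally show ?thesis .
    qed
    have "(LINT x|M. norm (k i x - k j x)) < e" if "i \<ge> max N1 N2" "j \<ge> max N1 N2" for i j
      using *[of i j] *[of j i] that by (cases "i \<le> j") (auto simp: norm_minus_commute)
    then show ?thesis by blast
  qed
  obtain r where r: "strict_mono r" "AE x in M. Cauchy (\<lambda>i. k (r i) x)"
    using cauchy_L1_AE_cauchy_subseq[of M k] int1[OF kH] cauchy by blast
  show thesis
  proof (rule that[of "\<lambda>n. k (r n)" "\<lambda>x. lim (\<lambda>n. k (r n) x)"])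
    show "k (r n) \<in> midpoint_hull (h ` {n..})" for n
      using kH[of "r n"] Hmono[of n "r n"] seq_suble[OF r(1), of n] unfolding H_def by blast
    show "(\<lambda>x. lim (\<lambda>n. k (r n) x)) \<in> borel_measurable M"
      by (intro borel_measurable_lim_metric Hmeas[OF kH])
    show "AE x in M. (\<lambda>n. k (r n) x) \<longlonglongrightarrow> lim (\<lambda>n. k (r n) x)"
      using r(2) by eventually_elim (simp add: Cauchy_convergent_iff convergent_LIMSEQ_iff)
  qed
qed

section \<open>An abstract McKean-Vlasov equation with additive noise\<close>

text \<open>Continuity of t \<mapsto> V t as a map into L^1(P). Along such a process every
  functional of the law that is Lipschitz in W_1 is continuous in time.\<close>

definition L1_continuous :: "'w measure \<Rightarrow> real \<Rightarrow> (real \<Rightarrow> 'w \<Rightarrow> 'v::euclidean_space) \<Rightarrow> bool" where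
  "L1_continuous P T V \<longleftrightarrow> (\<forall>t\<in>{0..T}. integrable P (V t)) \<and>
     (\<forall>t\<in>{0..T}. ((\<lambda>s. LINT \<omega>|P. norm (V s \<omega> - V t \<omega>)) \<longlongrightarrow> 0) (at t within {0..T}))"

text \<open>Clipping the time to {0..t} makes each path continuous on the whole line, so the process
  is a Caratheodory function of path and time. With \<open>Fl t\<close> for M this is progressive
  measurability.\<close>

lemma continuous_process_jointly_measurable:
  fixes V :: "real \<Rightarrow> 'w \<Rightarrow> 'v::euclidean_space"
  assumes "0 \<le> t" and V: "\<And>s. s \<in> {0..t} \<Longrightarrow> V s \<in> borel_measurable M"
    and cont: "\<And>\<omega>. \<omega> \<in> space M \<Longrightarrow> continuous_on {0..t} (\<lambda>s. V s \<omega>)"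
  shows "(\<lambda>(\<omega>, s). V (max 0 (min t s)) \<omega>) \<in> borel_measurable (M \<Otimes>\<^sub>M lborel)"
proof -
  have clip: "max 0 (min t r) \<in> {0..t}" for r using assms(1) by auto
  have "(\<lambda>x. (\<lambda>x r. V (max 0 (min t r)) (fst x)) x (snd x)) \<in> borel_measurable (M \<Otimes>\<^sub>M lborel)"
  proof (rule borel_measurable_Caratheodory[where c = snd])
    show "snd \<in> M \<Otimes>\<^sub>M lborel \<rightarrow>\<^sub>M (borel :: real measure)"
      using measurable_snd[of M "lborel :: real measure"] by simp
    show "(\<lambda>x. V (max 0 (min t y)) (fst x)) \<in> borel_measurable (M \<Otimes>\<^sub>M lborel)" for y
      using measurable_compose[OF measurable_fst V[OF clip]] .
    show "continuous_on UNIV (\<lambda>r. V (max 0 (min t r)) (fst x))"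
      if "x \<in> space (M \<Otimes>\<^sub>M lborel)" for x :: "'w \<times> real"
      using that by (intro continuous_on_compose2[OF cont[of "fst x"]] continuous_intros)
        (auto simp: space_pair_measure assms(1))
  qed
  then show ?thesis by (simp add: case_prod_beta)
qed

text \<open>The induction step behind the factorial decay of the Picard increments.\<close>

lemma set_integral_power_fact:
  fixes c :: real
  assumes "0 \<le> t"
  shows "set_integrable lborel {0..t} (\<lambda>s. c * ((c * s) ^ n / fact n))"
    and "(LINT s:{0..t}|lborel. c * ((c * s) ^ n / fact n)) = (c * t) ^ Suc n / fact (Suc n)"
proof -
  show int: "set_integrable lborel {0..t} (\<lambda>s. c * ((c * s) ^ n / fact n))"
    unfolding set_integrable_def
    by (intro borel_integrable_compact continuous_intros) auto
  have "((\<lambda>s. c * ((c * s) ^ n / fact n)) has_integral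
      (c * t) ^ Suc n / fact (Suc n) - (c * 0) ^ Suc n / fact (Suc n)) {0..t}"
  proof (rule fundamental_theorem_of_calculus[OF assms])
    fix x :: real
    have "((\<lambda>x. (c * x) ^ Suc n / fact (Suc n)) has_real_derivative
        (of_nat (Suc n) * (c * x) ^ n * c) / fact (Suc n)) (at x within {0..t})"
      by (auto intro!: derivative_eq_intros simp del: power_Suc)
    also have "(of_nat (Suc n) * (c * x) ^ n * c) / fact (Suc n) = c * ((c * x) ^ n / fact n)"
      by (simp only: fact_Suc of_nat_mult mult.assoc) (simp del: of_nat_Suc)
    finally show "((\<lambda>x. (c * x) ^ Suc n / fact (Suc n)) has_vector_derivative
        c * ((c * x) ^ n / fact n)) (at x within {0..t})"
      by (simp add: has_real_derivative_iff_has_vector_derivative)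
  qed
  then have "integral {0..t} (\<lambda>s. c * ((c * s) ^ n / fact n)) =
      (c * t) ^ Suc n / fact (Suc n) - (c * 0) ^ Suc n / fact (Suc n)"
    by (rule integral_unique)
  also have "\<dots> = (c * t) ^ Suc n / fact (Suc n)" by simp
  finally show "(LINT s:{0..t}|lborel. c * ((c * s) ^ n / fact n)) = (c * t) ^ Suc n / fact (Suc n)"
    unfolding set_borel_integral_eq_integral(2)[OF int] .
qed

lemma set_integral_norm_le:
  fixes f :: "'a \<Rightarrow> 'b::euclidean_space"
  assumes "set_integrable M A f" "set_integrable M A g" "\<And>x. x \<in> A \<Longrightarrow> norm (f x) \<le> g x"
  shows "norm (LINT x:A|M. f x) \<le> (LINT x:A|M. g x)"
proof -
  have "norm (LINT x:A|M. f x) \<le> (LINT x:A|M. norm (f x))"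
    unfolding set_lebesgue_integral_def
    by (rule order_trans[OF integral_norm_bound]) (simp add: indicator_def if_distrib norm_scaleR cong: if_cong)
  also have "\<dots> \<le> (LINT x:A|M. g x)"
    using assms by (intro set_integral_mono set_integrable_norm) auto
  finally show ?thesis .
qed

lemma set_integrable_bounded_interval:
  fixes f :: "real \<Rightarrow> 'b::euclidean_space"
  assumes "set_borel_measurable lborel {a..b} f" "\<And>x. x \<in> {a..b} \<Longrightarrow> norm (f x) \<le> K"
  shows "set_integrable lborel {a..b} f"
proof (rule set_integrable_bound[where f = "\<lambda>_. K"])
  show "set_integrable lborel {a..b} (\<lambda>_. K)"
    unfolding set_integrable_def by (intro borel_integrable_compact continuous_intros) auto
qed (use assms in \<open>auto intro!: AE_I2 order_trans[OF _ abs_ge_self]\<close>)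

text \<open>The difference V - Z is continuous on each path and has the integrable majorant 2 * Q
  for its increments, so dominated convergence along sequences of times applies; Z is L^1-continuous
  already.\<close>

lemma L1_continuous_dominated:
  fixes V Z :: "real \<Rightarrow> 'w \<Rightarrow> 'v::euclidean_space"
  assumes Z_L1: "L1_continuous P T Z" and V_int: "\<And>t. t \<in> {0..T} \<Longrightarrow> integrable P (V t)"
    and V_cont: "\<And>\<omega>. \<omega> \<in> space P \<Longrightarrow> continuous_on {0..T} (\<lambda>t. V t \<omega>)"
    and Z_cont: "\<And>\<omega>. \<omega> \<in> space P \<Longrightarrow> continuous_on {0..T} (\<lambda>t. Z t \<omega>)"
    and Q: "integrable P Q" and le: "AE \<omega> in P. \<forall>t\<in>{0..T}. norm (V t \<omega> - Z t \<omega>) \<le> Q \<omega>"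
  shows "L1_continuous P T V"
  unfolding L1_continuous_def
proof (intro conjI ballI V_int)
  have Z_integrable: "integrable P (Z t)" if "t \<in> {0..T}" for t
    using Z_L1 that by (simp add: L1_continuous_def)
  fix t assume t: "t \<in> {0..T}"
  let ?D = "\<lambda>s \<omega>. V s \<omega> - Z s \<omega>"
  have int: "integrable P (?D s)" if "s \<in> {0..T}" for s
    using V_int[OF that] Z_integrable[OF that] by auto
  have D: "((\<lambda>s. LINT \<omega>|P. norm (?D s \<omega> - ?D t \<omega>)) \<longlongrightarrow> 0) (at t within {0..T})"
  proof (subst tendsto_at_iff_sequentially, intro allI impI)
    fix s assume s: "\<forall>i. s i \<in> {0..T} - {t}" "s \<longlonglongrightarrow> t"
    have "(\<lambda>i. LINT \<omega>|P. norm (?D (s i) \<omega> - ?D t \<omega>)) \<longlonglongrightarrow> (LINT \<omega>|P. 0)"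
    proof (rule integral_dominated_convergence[where w = "\<lambda>\<omega>. 2 * Q \<omega>"])
      show "AE \<omega> in P. (\<lambda>i. norm (?D (s i) \<omega> - ?D t \<omega>)) \<longlonglongrightarrow> 0"
      proof (rule AE_I2)
        fix \<omega> assume w: "\<omega> \<in> space P"
        have "continuous_on {0..T} (\<lambda>s. ?D s \<omega>)"
          using w by (intro continuous_intros V_cont Z_cont)
        then have "(\<lambda>i. ?D (s i) \<omega>) \<longlonglongrightarrow> ?D t \<omega>"
          using s t by (intro continuous_on_tendsto_compose[where f = "\<lambda>s. ?D s \<omega>"]) (auto intro!: always_eventually)
        then show "(\<lambda>i. norm (?D (s i) \<omega> - ?D t \<omega>)) \<longlonglongrightarrow> 0"
          by (simp add: LIM_zero tendsto_norm_zero)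
      qed
      show "AE \<omega> in P. norm (norm (?D (s i) \<omega> - ?D t \<omega>)) \<le> 2 * Q \<omega>" for i
        using le
      proof eventually_elim
        case (elim \<omega>)
        have "s i \<in> {0..T}" using s(1) by blast
        then show "norm (norm (?D (s i) \<omega> - ?D t \<omega>)) \<le> 2 * Q \<omega>"
          using norm_triangle_ineq4[of "?D (s i) \<omega>" "?D t \<omega>"] bspec[OF elim, of "s i"]
            bspec[OF elim t] by simp
      qed
      show "(\<lambda>\<omega>. norm (?D (s i) \<omega> - ?D t \<omega>)) \<in> borel_measurable P" for i
        using s(1) int[of "s i"] int[OF t] by auto
    qed (use Q in auto)
    then show "((\<lambda>s. LINT \<omega>|P. norm (?D s \<omega> - ?D t \<omega>)) \<circ> s) \<longlonglongrightarrow> 0"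
      by (simp add: o_def)
  qed
  have Z0: "((\<lambda>s. LINT \<omega>|P. norm (Z s \<omega> - Z t \<omega>)) \<longlongrightarrow> 0) (at t within {0..T})"
    using Z_L1 t by (simp add: L1_continuous_def)
  show "((\<lambda>s. LINT \<omega>|P. norm (V s \<omega> - V t \<omega>)) \<longlongrightarrow> 0) (at t within {0..T})"
  proof (rule tendsto_sandwich[OF _ _ tendsto_const])
    show "((\<lambda>s. (LINT \<omega>|P. norm (?D s \<omega> - ?D t \<omega>)) + (LINT \<omega>|P. norm (Z s \<omega> - Z t \<omega>))) \<longlongrightarrow> 0) (at t within {0..T})"
      using tendsto_add[OF D Z0] by simp
    show "\<forall>\<^sub>F s in at t within {0..T}. (LINT \<omega>|P. norm (V s \<omega> - V t \<omega>)) \<le>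
      (LINT \<omega>|P. norm (?D s \<omega> - ?D t \<omega>)) + (LINT \<omega>|P. norm (Z s \<omega> - Z t \<omega>))"
      unfolding eventually_at_filter
    proof (intro always_eventually allI impI)
      fix s assume s: "s \<in> {0..T}"
      have "(LINT \<omega>|P. norm (V s \<omega> - V t \<omega>)) \<le> (LINT \<omega>|P. norm (?D s \<omega> - ?D t \<omega>) + norm (Z s \<omega> - Z t \<omega>))"
      proof (rule integral_mono)
        fix \<omega>
        show "norm (V s \<omega> - V t \<omega>) \<le> norm (?D s \<omega> - ?D t \<omega>) + norm (Z s \<omega> - Z t \<omega>)"
          using norm_triangle_ineq[of "?D s \<omega> - ?D t \<omega>" "Z s \<omega> - Z t \<omega>"] by (simp add: algebra_simps)
      qed (use V_int[OF s] V_int[OF t] Z_integrable[OF s] Z_integrable[OF t] int[OF s] int[OF t] in auto)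
      then show "(LINT \<omega>|P. norm (V s \<omega> - V t \<omega>)) \<le>
        (LINT \<omega>|P. norm (?D s \<omega> - ?D t \<omega>)) + (LINT \<omega>|P. norm (Z s \<omega> - Z t \<omega>))"
        using Z_integrable[OF s] Z_integrable[OF t] int[OF s] int[OF t] by simp
    qed
  qed (simp add: always_eventually)
qed

section \<open>The setting of the abstract equation\<close>

lemma filtered_measurable_mono:
  assumes "filtered_prob_space P Fl" "f \<in> borel_measurable (Fl s)" "s \<le> t"
  shows "f \<in> borel_measurable (Fl t)"
proof -
  have "sets (Fl s) \<subseteq> sets (Fl t)" "space (Fl s) = space (Fl t)"
    using assms(1,3) unfolding filtered_prob_space_def filtration_def subalgebra_def by auto
  then have "subalgebra (Fl t) (Fl s)" by (simp add: subalgebra_def)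
  then show ?thesis using assms(2) by (rule measurable_from_subalg)
qed

lemma filtered_measurable:
  assumes "filtered_prob_space P Fl" "f \<in> borel_measurable (Fl s)"
  shows "f \<in> borel_measurable P"
  using assms unfolding filtered_prob_space_def by (meson measurable_from_subalg)

text \<open>Z collects initial value and noise, so a solution is a pathwise fixed point V = Z +
  integral of the drift. The mean field enters through a random variable, with L^1(P) in the role of
  W_1. Measurability in time is demanded only at a fixed state and along L^1-continuous processes;
  joint measurability follows from the Lipschitz bound by
  \<open>borel_measurable_Caratheodory\<close>.\<close>

locale mckean_vlasov = prob_space P
  for P :: "'w measure" +
  fixes Fl :: "real \<Rightarrow> 'w measure" and T :: real
    and Z :: "real \<Rightarrow> 'w \<Rightarrow> 'v::euclidean_space"
    and F :: "real \<Rightarrow> ('w \<Rightarrow> 'v) \<Rightarrow> 'v \<Rightarrow> 'v" and C B Zb :: real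
  assumes filt: "filtered_prob_space P Fl"
    and T: "0 < T" and C: "0 \<le> C" and B: "0 \<le> B"
    and Z_adapted: "\<And>t. t \<in> {0..T} \<Longrightarrow> Z t \<in> borel_measurable (Fl t)"
    and Z_cont: "\<And>\<omega>. \<omega> \<in> space P \<Longrightarrow> continuous_on {0..T} (\<lambda>t. Z t \<omega>)"
    and Z_L1: "L1_continuous P T Z"
    and Z_bound: "\<And>t. t \<in> {0..T} \<Longrightarrow> (LINT \<omega>|P. norm (Z t \<omega>)) \<le> Zb"
    and F_lip: "\<And>t \<xi> \<xi>' v v'. t \<in> {0..T} \<Longrightarrow> integrable P \<xi> \<Longrightarrow> integrable P \<xi>' \<Longrightarrow>
      norm (F t \<xi> v - F t \<xi>' v') \<le> C * (norm (v - v') + (LINT \<omega>|P. norm (\<xi> \<omega> - \<xi>' \<omega>)))"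
    and F_zero: "\<And>t. t \<in> {0..T} \<Longrightarrow> norm (F t (\<lambda>_. 0) 0) \<le> B"
    and F_meas: "\<And>V v. L1_continuous P T V \<Longrightarrow>
      (\<lambda>s. indicator {0..T} s *\<^sub>R F s (V s) v) \<in> borel_measurable lborel"
begin

lemma space_Fl [simp]: "space (Fl t) = space P"
  using filt unfolding filtered_prob_space_def subalgebra_def by auto

lemmas borel_measurable_Fl_mono = filtered_measurable_mono[OF filt]
lemmas borel_measurable_Fl = filtered_measurable[OF filt]

lemma Z_integrable: "t \<in> {0..T} \<Longrightarrow> integrable P (Z t)"
  using Z_L1 by (simp add: L1_continuous_def)

lemma Zb_nonneg: "0 \<le> Zb"
proof -
  have "0 \<le> (LINT \<omega>|P. norm (Z 0 \<omega>))" by simp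
  also have "\<dots> \<le> Zb" using Z_bound[of 0] T by simp
  finally show ?thesis .
qed

lemma F_growth:
  assumes "t \<in> {0..T}" "integrable P \<xi>"
  shows "norm (F t \<xi> v) \<le> B + C * (norm v + (LINT \<omega>|P. norm (\<xi> \<omega>)))"
  using F_lip[OF assms(1,2), of "\<lambda>_. 0" v 0] F_zero[OF assms(1)]
    norm_triangle_ineq2[of "F t \<xi> v" "F t (\<lambda>_. 0) 0"] by simp

text \<open>The class on which the Picard map acts. The majorant Q is independent of time and valid
  on every path, so estimates stay pathwise and dominated convergence in L^1(P) is
  available.\<close>

definition dominated :: "('w \<Rightarrow> real) \<Rightarrow> (real \<Rightarrow> 'w \<Rightarrow> 'v) \<Rightarrow> bool" where
  "dominated Q V \<longleftrightarrow> integrable P Q \<and>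
     (\<forall>t\<in>{0..T}. V t \<in> borel_measurable (Fl t)) \<and>
     (\<forall>\<omega>\<in>space P. continuous_on {0..T} (\<lambda>t. V t \<omega>)) \<and>
     (\<forall>t\<in>{0..T}. \<forall>\<omega>\<in>space P. norm (V t \<omega> - Z t \<omega>) \<le> Q \<omega>)"

definition drift_integral :: "(real \<Rightarrow> 'w \<Rightarrow> 'v) \<Rightarrow> real \<Rightarrow> 'w \<Rightarrow> 'v" where
  "drift_integral V t \<omega> = (LINT s:{0..t}|lborel. F s (V s) (V s \<omega>))"

definition Picard_map :: "(real \<Rightarrow> 'w \<Rightarrow> 'v) \<Rightarrow> real \<Rightarrow> 'w \<Rightarrow> 'v" where
  "Picard_map V t \<omega> = Z t \<omega> + drift_integral V t \<omega>"

lemma dominated_Z: "dominated (\<lambda>_. 0) Z"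
  using Z_adapted Z_cont by (simp add: dominated_def)

context
  fixes Q V assumes dom: "dominated Q V"
begin

lemma dominated_adapted: "t \<in> {0..T} \<Longrightarrow> V t \<in> borel_measurable (Fl t)"
  and dominated_cont: "\<omega> \<in> space P \<Longrightarrow> continuous_on {0..T} (\<lambda>t. V t \<omega>)"
  and dominated_Q: "integrable P Q"
  and dominated_le: "t \<in> {0..T} \<Longrightarrow> \<omega> \<in> space P \<Longrightarrow> norm (V t \<omega> - Z t \<omega>) \<le> Q \<omega>"
  using dom by (auto simp: dominated_def)

lemma dominated_nonneg: "\<omega> \<in> space P \<Longrightarrow> 0 \<le> Q \<omega>"
  using dominated_le[of 0 \<omega>] T by (auto intro: order_trans[OF norm_ge_zero])

lemma dominated_meas: "t \<in> {0..T} \<Longrightarrow> V t \<in> borel_measurable P"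
  using dominated_adapted borel_measurable_Fl by blast

lemma dominated_integrable:
  assumes t: "t \<in> {0..T}" shows "integrable P (V t)"
proof -
  have "integrable P (\<lambda>\<omega>. V t \<omega> - Z t \<omega>)"
    using dominated_meas[OF t] Z_integrable[OF t] dominated_le[OF t] dominated_nonneg
    by (intro Bochner_Integration.integrable_bound[OF dominated_Q]) auto
  from Bochner_Integration.integrable_add[OF this Z_integrable[OF t]] show ?thesis by simp
qed

lemma dominated_mean:
  assumes t: "t \<in> {0..T}" shows "(LINT \<omega>|P. norm (V t \<omega>)) \<le> Zb + (LINT \<omega>|P. Q \<omega>)"
proof -
  have "(LINT \<omega>|P. norm (V t \<omega>)) \<le> (LINT \<omega>|P. norm (Z t \<omega>) + Q \<omega>)"
  proof (rule integral_mono)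
    fix \<omega> assume "\<omega> \<in> space P"
    then show "norm (V t \<omega>) \<le> norm (Z t \<omega>) + Q \<omega>"
      using dominated_le[OF t] norm_triangle_ineq2[of "V t \<omega>" "Z t \<omega>"] by fastforce
  qed (use dominated_integrable[OF t] Z_integrable[OF t] dominated_Q in auto)
  also have "\<dots> = (LINT \<omega>|P. norm (Z t \<omega>)) + (LINT \<omega>|P. Q \<omega>)"
    using Z_integrable[OF t] dominated_Q by simp
  finally show ?thesis using Z_bound[OF t] by linarith
qed

lemma dominated_L1_continuous: "L1_continuous P T V"
  using Z_L1 dominated_integrable dominated_cont Z_cont dominated_Q
  by (rule L1_continuous_dominated) (use dominated_le in \<open>auto intro!: AE_I2\<close>)

text \<open>Measurability with respect to \<open>Fl t\<close>, and not only P, is what makes the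
  drift integral up to t adapted. The clipped process agrees with V wherever the indicator does not
  vanish.\<close>

lemma drift_jointly_measurable:
  assumes t: "t \<in> {0..T}"
  shows "(\<lambda>(\<omega>, s). indicator {0..t} s *\<^sub>R F s (V s) (V s \<omega>)) \<in> borel_measurable (Fl t \<Otimes>\<^sub>M lborel)"
proof -
  let ?f = "\<lambda>x v. indicator {0..t} (snd x) *\<^sub>R F (snd x) (V (snd x)) v"
  let ?c = "\<lambda>x. V (max 0 (min t (snd x))) (fst x)"
  have "(\<lambda>x. ?f x (?c x)) \<in> borel_measurable (Fl t \<Otimes>\<^sub>M lborel)"
  proof (rule borel_measurable_Caratheodory[where f = ?f and c = ?c])
    have "(\<lambda>(\<omega>, s). V (max 0 (min t s)) \<omega>) \<in> borel_measurable (Fl t \<Otimes>\<^sub>M lborel)"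
    proof (rule continuous_process_jointly_measurable)
      show "V s \<in> borel_measurable (Fl t)" if "s \<in> {0..t}" for s
        using borel_measurable_Fl_mono[OF dominated_adapted, of s t] that t by auto
      show "continuous_on {0..t} (\<lambda>s. V s \<omega>)" if "\<omega> \<in> space (Fl t)" for \<omega>
        using dominated_cont[of \<omega>] that t by (auto intro: continuous_on_subset)
    qed (use t in auto)
    then show "?c \<in> borel_measurable (Fl t \<Otimes>\<^sub>M lborel)" by (simp add: case_prod_beta')
    fix v
    have "(\<lambda>s. indicator {0..t} s *\<^sub>R (indicator {0..T} s *\<^sub>R F s (V s) v)) \<in> borel_measurable lborel"
      using F_meas[OF dominated_L1_continuous, of v] by measurable
    also have "(\<lambda>s. indicator {0..t} s *\<^sub>R (indicator {0..T} s *\<^sub>R F s (V s) v)) =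
        (\<lambda>s. indicator {0..t} s *\<^sub>R F s (V s) v)"
      using t by (auto simp: indicator_def)
    finally show "(\<lambda>x. ?f x v) \<in> borel_measurable (Fl t \<Otimes>\<^sub>M lborel)"
      using measurable_compose[OF measurable_snd] by blast
  next
    fix x :: "'w \<times> real"
    have "C-lipschitz_on UNIV (?f x)"
    proof (rule lipschitz_onI)
      fix v v'
      show "dist (?f x v) (?f x v') \<le> C * dist v v'"
      proof (cases "snd x \<in> {0..t}")
        case True
        then have "snd x \<in> {0..T}" using t by auto
        then show ?thesis
          using F_lip[of "snd x" "V (snd x)" "V (snd x)" v v'] dominated_integrable[of "snd x"] True
          by (simp add: dist_norm)
      qed (use C in auto)
    qed (use C in auto)
    then show "continuous_on UNIV (?f x)"
      by (rule lipschitz_on_continuous_on)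
  qed
  also have "(\<lambda>x. ?f x (?c x)) = (\<lambda>(\<omega>, s). indicator {0..t} s *\<^sub>R F s (V s) (V s \<omega>))"
    by (auto simp: indicator_def fun_eq_iff min_def max_def)
  finally show ?thesis .
qed

lemma drift_integral_measurable:
  assumes "t \<in> {0..T}" shows "drift_integral V t \<in> borel_measurable (Fl t)"
  unfolding drift_integral_def[abs_def] set_lebesgue_integral_def
  using lborel.borel_measurable_lebesgue_integral[OF drift_jointly_measurable[OF assms]] .

lemma drift_le:
  assumes s: "s \<in> {0..T}" and w: "\<omega> \<in> space P"
  shows "norm (F s (V s) (V s \<omega>)) \<le>
    B + C * (Q \<omega> + Zb + (LINT \<omega>|P. Q \<omega>)) + C * norm (Z s \<omega>)"
proof -
  have "norm (V s \<omega>) \<le> norm (Z s \<omega>) + Q \<omega>"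
    using dominated_le[OF s w] norm_triangle_ineq2[of "V s \<omega>" "Z s \<omega>"] by simp
  then have "norm (V s \<omega>) + (LINT \<omega>|P. norm (V s \<omega>)) \<le>
      norm (Z s \<omega>) + Q \<omega> + (Zb + (LINT \<omega>|P. Q \<omega>))"
    using dominated_mean[OF s] by linarith
  from mult_left_mono[OF this C] show ?thesis
    using F_growth[OF s dominated_integrable[OF s], of "V s \<omega>"] by (simp add: algebra_simps)
qed

lemma drift_set_integrable:
  assumes w: "\<omega> \<in> space P" and t: "t \<in> {0..T}"
  shows "set_integrable lborel {0..t} (\<lambda>s. F s (V s) (V s \<omega>))"
proof -
  have "(\<lambda>s. (\<omega>, s)) \<in> lborel \<rightarrow>\<^sub>M Fl t \<Otimes>\<^sub>M lborel"
    using w by (intro measurable_Pair) auto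
  from measurable_compose[OF this drift_jointly_measurable[OF t]]
  have meas: "set_borel_measurable lborel {0..t} (\<lambda>s. F s (V s) (V s \<omega>))"
    unfolding set_borel_measurable_def by simp
  have "compact ((\<lambda>s. Z s \<omega>) ` {0..T})"
    using Z_cont[OF w] by (intro compact_continuous_image) auto
  then obtain K where K: "\<And>s. s \<in> {0..T} \<Longrightarrow> norm (Z s \<omega>) \<le> K"
    using compact_imp_bounded by (fastforce simp: bounded_iff)
  show ?thesis
  proof (rule set_integrable_bounded_interval[OF meas])
    fix s assume "s \<in> {0..t}"
    then have s: "s \<in> {0..T}" using t by auto
    show "norm (F s (V s) (V s \<omega>)) \<le> B + C * (Q \<omega> + Zb + (LINT \<omega>|P. Q \<omega>)) + C * K"
      using drift_le[OF s w] mult_left_mono[OF K[OF s] C] by linarith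
  qed
qed

end

lemma Z_set_integrable:
  assumes "\<omega> \<in> space P" "{a..b} \<subseteq> {0..T}"
  shows "set_integrable lborel {a..b} (\<lambda>s. norm (Z s \<omega>))"
  unfolding set_integrable_def
  using continuous_on_subset[OF Z_cont[OF assms(1)] assms(2)]
  by (intro borel_integrable_compact continuous_intros) auto

text \<open>The drift grows linearly in the state, so integrals of norm (Z s \<omega>) appear in all
  bounds. The first claim makes the Picard majorants integrable; the second makes mean increments of
  the drift integral proportional to b - a.\<close>

lemma Z_Fubini:
  assumes ab: "{a..b} \<subseteq> {0..T}" "a \<le> b"
  shows "integrable P (\<lambda>\<omega>. LINT s:{a..b}|lborel. norm (Z s \<omega>))"
    and "(LINT \<omega>|P. (LINT s:{a..b}|lborel. norm (Z s \<omega>))) \<le> (b - a) * Zb"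
proof -
  interpret lP: pair_sigma_finite "lborel :: real measure" P ..
  let ?f = "\<lambda>(s, \<omega>). indicator {a..b} s *\<^sub>R norm (Z s \<omega>)"
  have "(\<lambda>(\<omega>, s). Z (max 0 (min T s)) \<omega>) \<in> borel_measurable (P \<Otimes>\<^sub>M lborel)"
    using T Z_cont borel_measurable_Fl[OF Z_adapted] by (intro continuous_process_jointly_measurable) auto
  then have "(\<lambda>(s, \<omega>). Z (max 0 (min T s)) \<omega>) \<in> borel_measurable (lborel \<Otimes>\<^sub>M P)"
    by (subst measurable_pair_swap_iff) (simp add: case_prod_beta')
  then have "(\<lambda>x. indicator {a..b} (fst x) *\<^sub>R norm (Z (max 0 (min T (fst x))) (snd x))) \<in> borel_measurable (lborel \<Otimes>\<^sub>M P)"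
    by (simp add: case_prod_beta')
  also have "(\<lambda>x. indicator {a..b} (fst x) *\<^sub>R norm (Z (max 0 (min T (fst x))) (snd x))) = ?f"
  proof -
    have "max 0 (min T s) = s" if "s \<in> {a..b}" for s using ab that by auto
    then show ?thesis by (auto simp: fun_eq_iff indicator_def)
  qed
  finally have meas: "?f \<in> borel_measurable (lborel \<Otimes>\<^sub>M P)" .
  have meas': "(\<lambda>s. LINT \<omega>|P. ?f (s, \<omega>)) \<in> borel_measurable lborel"
    using borel_measurable_lebesgue_integral[of "\<lambda>s \<omega>. ?f (s, \<omega>)" lborel] meas by (simp add: case_prod_beta')
  have i1: "integrable lborel (\<lambda>s. indicator {a..b} s *\<^sub>R Zb)"
    using set_integrable_bounded_interval[of a b "\<lambda>_. Zb" "\<bar>Zb\<bar>"]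
    by (auto simp: set_integrable_def set_borel_measurable_def)
  have i2: "integrable lborel (\<lambda>s. LINT \<omega>|P. ?f (s, \<omega>))"
  proof (rule Bochner_Integration.integrable_bound[OF i1 meas'], rule AE_I2)
    show "norm (LINT \<omega>|P. ?f (s, \<omega>)) \<le> norm (indicator {a..b} s *\<^sub>R Zb)" for s
      using Z_bound[of s] ab Zb_nonneg by (cases "s \<in> {a..b}") auto
  qed
  have int: "integrable (lborel \<Otimes>\<^sub>M P) ?f"
  proof (rule lP.Fubini_integrable[OF meas])
    have "(\<lambda>s. LINT \<omega>|P. norm (?f (s, \<omega>))) = (\<lambda>s. LINT \<omega>|P. ?f (s, \<omega>))" by auto
    then show "integrable lborel (\<lambda>s. LINT \<omega>|P. norm (?f (s, \<omega>)))" using i2 by simp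
    have "integrable P (\<lambda>\<omega>. ?f (s, \<omega>))" for s
      using Z_integrable[of s] ab by (cases "s \<in> {a..b}") auto
    then show "AE s in lborel. integrable P (\<lambda>\<omega>. ?f (s, \<omega>))" by auto
  qed
  have "integrable P (\<lambda>\<omega>. LINT s|lborel. ?f (s, \<omega>))"
    using lP.integrable_snd[of "\<lambda>s \<omega>. ?f (s, \<omega>)"] int by simp
  then show "integrable P (\<lambda>\<omega>. LINT s:{a..b}|lborel. norm (Z s \<omega>))"
    by (simp add: set_lebesgue_integral_def)
  have "(LINT \<omega>|P. LINT s|lborel. ?f (s, \<omega>)) = (LINT s|lborel. LINT \<omega>|P. ?f (s, \<omega>))"
    using lP.Fubini_integral[of "\<lambda>s \<omega>. ?f (s, \<omega>)"] int by simp
  also have "\<dots> \<le> (LINT s|lborel. indicator {a..b} s *\<^sub>R Zb)"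
    using i2 i1
  proof (rule integral_mono)
    show "(LINT \<omega>|P. ?f (s, \<omega>)) \<le> indicator {a..b} s *\<^sub>R Zb" for s
      using Z_bound[of s] ab by (cases "s \<in> {a..b}") auto
  qed
  also have "\<dots> = (b - a) * Zb" using ab by simp
  finally show "(LINT \<omega>|P. (LINT s:{a..b}|lborel. norm (Z s \<omega>))) \<le> (b - a) * Zb"
    by (simp add: set_lebesgue_integral_def)
qed

end

section \<open>Picard iteration with factorial decay\<close>

context mckean_vlasov
begin

lemma set_integrable_const: "set_integrable lborel {a..b::real} (\<lambda>_. c::real)"
  unfolding set_integrable_def by (intro borel_integrable_compact continuous_intros compact_Icc)

lemma set_integral_const: "a \<le> b \<Longrightarrow> (LINT s:{a..b::real}|lborel. c) = (b - a) * (c::real)"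
  by (simp add: set_lebesgue_integral_def)

lemma drift_integral_diff_le:
  assumes dom: "dominated Q V" and w: "\<omega> \<in> space P" and t: "0 \<le> a" "a \<le> b" "b \<le> T"
  shows "norm (drift_integral V b \<omega> - drift_integral V a \<omega>) \<le>
    (b - a) * (B + C * (Q \<omega> + Zb + (LINT \<omega>|P. Q \<omega>))) + C * (LINT s:{a..b}|lborel. norm (Z s \<omega>))"
proof -
  let ?f = "\<lambda>s. F s (V s) (V s \<omega>)"
  let ?c = "B + C * (Q \<omega> + Zb + (LINT \<omega>|P. Q \<omega>))"
  have b: "set_integrable lborel {0..b} ?f"
    using drift_set_integrable[OF dom w, of b] t by auto
  have ab: "set_integrable lborel {a..b} ?f" and a: "set_integrable lborel {0..a} ?f"
    by (rule set_integrable_subset[OF b]; use t in auto)+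
  have Zab: "set_integrable lborel {a..b} (\<lambda>s. C * norm (Z s \<omega>))"
    by (intro set_integrable_mult_right Z_set_integrable w) (use t in auto)
  have "integral {0..b} ?f = integral {0..a} ?f + integral {a..b} ?f"
    using set_borel_integral_eq_integral(1)[OF b] t by (simp add: Henstock_Kurzweil_Integration.integral_combine)
  then have "drift_integral V b \<omega> - drift_integral V a \<omega> = (LINT s:{a..b}|lborel. ?f s)"
    unfolding drift_integral_def by (simp add: set_borel_integral_eq_integral(2)[OF a]
        set_borel_integral_eq_integral(2)[OF b] set_borel_integral_eq_integral(2)[OF ab])
  also have "norm \<dots> \<le> (LINT s:{a..b}|lborel. ?c + C * norm (Z s \<omega>))"
  proof (rule set_integral_norm_le[OF ab])
    show "set_integrable lborel {a..b} (\<lambda>s. ?c + C * norm (Z s \<omega>))"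
      using set_integral_add(1)[OF set_integrable_const Zab] .
    show "norm (?f s) \<le> ?c + C * norm (Z s \<omega>)" if "s \<in> {a..b}" for s
      using drift_le[OF dom _ w, of s] that t by auto
  qed
  also have "\<dots> = (b - a) * ?c + C * (LINT s:{a..b}|lborel. norm (Z s \<omega>))"
    using t by (simp add: set_integral_add(2)[OF set_integrable_const Zab] set_integral_const)
  finally show ?thesis .
qed

lemma drift_integral_0 [simp]: "drift_integral V 0 \<omega> = 0"
proof -
  have "AE s in lborel. s \<noteq> (0::real)" by (rule AE_lborel_singleton)
  then show ?thesis
    unfolding drift_integral_def set_lebesgue_integral_def
    by (intro integral_eq_zero_AE) auto
qed

definition Z_int :: "'w \<Rightarrow> real" where
  "Z_int \<omega> = (LINT s:{0..T}|lborel. norm (Z s \<omega>))"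

lemma Z_int_nonneg: "0 \<le> Z_int \<omega>"
  unfolding Z_int_def set_lebesgue_integral_def by simp

lemma Z_int_integrable: "integrable P Z_int"
  unfolding Z_int_def[abs_def] using Z_Fubini(1)[of 0 T] T by auto

lemma Z_int_mono:
  assumes "\<omega> \<in> space P" "{a..b} \<subseteq> {0..T}"
  shows "(LINT s:{a..b}|lborel. norm (Z s \<omega>)) \<le> Z_int \<omega>"
  unfolding Z_int_def set_lebesgue_integral_def
proof (rule integral_mono)
  show "integrable lborel (\<lambda>x. indicator {a..b} x *\<^sub>R norm (Z x \<omega>))"
    and "integrable lborel (\<lambda>x. indicator {0..T} x *\<^sub>R norm (Z x \<omega>))"
    using Z_set_integrable[OF assms] Z_set_integrable[OF assms(1), of 0 T]
    by (auto simp: set_integrable_def)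
qed (use assms(2) in \<open>auto simp: indicator_def\<close>)

text \<open>The bound of \<open>drift_le\<close> integrated over {0..T}: a majorant for the image of
  a process with majorant Q.\<close>

definition Picard_bound :: "('w \<Rightarrow> real) \<Rightarrow> 'w \<Rightarrow> real" where
  "Picard_bound Q \<omega> = T * (B + C * (Q \<omega> + Zb + (LINT \<omega>|P. Q \<omega>))) + C * Z_int \<omega>"

lemma Picard_map_dominated:
  assumes dom: "dominated Q V"
  shows "dominated (Picard_bound Q) (Picard_map V)"
  unfolding dominated_def
proof (intro conjI ballI)
  show "integrable P (Picard_bound Q)"
    unfolding Picard_bound_def[abs_def] using dominated_Q[OF dom] Z_int_integrable by auto
  show "Picard_map V t \<in> borel_measurable (Fl t)" if "t \<in> {0..T}" for t
    unfolding Picard_map_def[abs_def] using drift_integral_measurable[OF dom that] Z_adapted[OF that] by auto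
  fix \<omega> assume w: "\<omega> \<in> space P"
  have int: "set_integrable lborel {0..t} (\<lambda>s. F s (V s) (V s \<omega>))" if "t \<in> {0..T}" for t
    using drift_set_integrable[OF dom w that] .
  have "continuous_on {0..T} (\<lambda>t. integral {0..t} (\<lambda>s. F s (V s) (V s \<omega>)))"
    using set_borel_integral_eq_integral(1)[OF int, of T] T by (intro indefinite_integral_continuous_1) auto
  then have "continuous_on {0..T} (\<lambda>t. drift_integral V t \<omega>)"
    unfolding drift_integral_def
    by (rule continuous_on_cong[THEN iffD1, rotated -1]) (use set_borel_integral_eq_integral(2)[OF int] in auto)
  then show "continuous_on {0..T} (\<lambda>t. Picard_map V t \<omega>)"
    unfolding Picard_map_def using Z_cont[OF w] by (intro continuous_intros)
next
  fix t \<omega> assume t: "t \<in> {0..T}" and w: "\<omega> \<in> space P"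
  have "norm (drift_integral V t \<omega>) \<le>
      t * (B + C * (Q \<omega> + Zb + (LINT \<omega>|P. Q \<omega>))) + C * (LINT s:{0..t}|lborel. norm (Z s \<omega>))"
    using drift_integral_diff_le[OF dom w, of 0 t] t by simp
  also have "\<dots> \<le> Picard_bound Q \<omega>"
    unfolding Picard_bound_def
  proof (intro add_mono mult_right_mono mult_left_mono C)
    have "0 \<le> (LINT \<omega>|P. Q \<omega>)"
      using dominated_nonneg[OF dom] by (intro Bochner_Integration.integral_nonneg) auto
    then show "0 \<le> B + C * (Q \<omega> + Zb + (LINT \<omega>|P. Q \<omega>))"
      using B C Zb_nonneg dominated_nonneg[OF dom w] by auto
    show "(LINT s:{0..t}|lborel. norm (Z s \<omega>)) \<le> Z_int \<omega>"
      using Z_int_mono[OF w, of 0 t] t by auto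
  qed (use t in auto)
  finally show "norm (Picard_map V t \<omega> - Z t \<omega>) \<le> Picard_bound Q \<omega>"
    by (simp add: Picard_map_def)
qed

text \<open>The majorant of the first Picard step plus its mean. Including the mean gives the shape
  that reproduces itself in \<open>drift_diff_le\<close>.\<close>

definition Picard_const :: "'w \<Rightarrow> real" where
  "Picard_const \<omega> = Picard_bound (\<lambda>_. 0) \<omega> + (LINT \<omega>|P. Picard_bound (\<lambda>_. 0) \<omega>)"

text \<open>The shape S + E S reproduces itself: its mean is 2 E S, so the pathwise term and the
  mean-field term add up to S + 3 E S, which is at most 3 (S + E S). This is the origin of 3 * C in
  the exponentials. The bound at \<omega> and the bound almost everywhere are separate hypotheses,
  so that the lemma also serves uniqueness, where the equations hold only almost everywhere.\<close>

lemma drift_diff_le: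
  assumes s: "s \<in> {0..T}" and int: "integrable P (V s)" "integrable P (V' s)" and S: "integrable P S"
    and S0: "0 \<le> S \<omega>" "0 \<le> (LINT \<omega>|P. S \<omega>)" and p: "0 \<le> p"
    and le: "norm (V s \<omega> - V' s \<omega>) \<le> (S \<omega> + (LINT \<omega>|P. S \<omega>)) * p"
    and AE: "AE \<omega> in P. norm (V s \<omega> - V' s \<omega>) \<le> (S \<omega> + (LINT \<omega>|P. S \<omega>)) * p"
  shows "norm (F s (V s) (V s \<omega>) - F s (V' s) (V' s \<omega>)) \<le> (S \<omega> + (LINT \<omega>|P. S \<omega>)) * (3 * C * p)"
proof -
  have "(LINT \<omega>|P. norm (V s \<omega> - V' s \<omega>)) \<le> (LINT \<omega>|P. (S \<omega> + (LINT \<omega>|P. S \<omega>)) * p)"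
    using int S AE by (intro integral_mono_AE) auto
  also have "\<dots> = 2 * (LINT \<omega>|P. S \<omega>) * p"
    using S by (simp add: prob_space)
  finally have "norm (V s \<omega> - V' s \<omega>) + (LINT \<omega>|P. norm (V s \<omega> - V' s \<omega>)) \<le>
      (S \<omega> + (LINT \<omega>|P. S \<omega>)) * p + 2 * (LINT \<omega>|P. S \<omega>) * p"
    using le by linarith
  also have "\<dots> \<le> (S \<omega> + (LINT \<omega>|P. S \<omega>)) * (3 * p)"
    using S0 p by (simp add: algebra_simps)
  finally have "norm (V s \<omega> - V' s \<omega>) + (LINT \<omega>|P. norm (V s \<omega> - V' s \<omega>)) \<le>
      (S \<omega> + (LINT \<omega>|P. S \<omega>)) * (3 * p)" .
  from mult_left_mono[OF this C] show ?thesis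
    using F_lip[OF s int, of "V s \<omega>" "V' s \<omega>"] by (simp add: algebra_simps)
qed

text \<open>
  The factor 3 absorbs the mean-field term, so that iterating the Lipschitz estimate yields the
  usual factorial decay pathwise, without measurability of the mean distance in time.
\<close>
lemma drift_integral_power_le:
  assumes t: "t \<in> {0..T}"
    and int: "set_integrable lborel {0..t} f" "set_integrable lborel {0..t} g"
    and le: "\<And>s. s \<in> {0..t} \<Longrightarrow> norm (f s - g s) \<le> K * (3 * C * ((3 * C * s) ^ n / fact n))"
  shows "norm ((LINT s:{0..t}|lborel. f s) - (LINT s:{0..t}|lborel. g s :: 'v)) \<le>
    K * ((3 * C * t) ^ Suc n / fact (Suc n))"
proof -
  have i: "set_integrable lborel {0..t} (\<lambda>s. K * (3 * C * ((3 * C * s) ^ n / fact n)))"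
    using set_integral_power_fact(1)[of t "3 * C" n] t by (intro set_integrable_mult_right) auto
  have "norm (LINT s:{0..t}|lborel. f s - g s) \<le>
      (LINT s:{0..t}|lborel. K * (3 * C * ((3 * C * s) ^ n / fact n)))"
    by (rule set_integral_norm_le[OF set_integral_diff(1)[OF int] i le])
  also have "\<dots> = K * ((3 * C * t) ^ Suc n / fact (Suc n))"
    using set_integral_power_fact(2)[of t "3 * C" n] t by (simp only: set_integral_mult_right) simp
  finally show ?thesis
    using set_integral_diff(2)[OF int] by simp
qed

lemma Picard_bound_nonneg: "0 \<le> Picard_bound (\<lambda>_. 0) \<omega>"
  unfolding Picard_bound_def using T B C Zb_nonneg Z_int_nonneg by simp

lemma Picard_const_integrable: "integrable P Picard_const"
  and Picard_const_nonneg: "0 \<le> Picard_const \<omega>"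
proof -
  have "integrable P (Picard_bound (\<lambda>_. 0))"
    using dominated_Q[OF Picard_map_dominated[OF dominated_Z]] .
  then show "integrable P Picard_const" unfolding Picard_const_def[abs_def] by auto
  show "0 \<le> Picard_const \<omega>"
    unfolding Picard_const_def using Picard_bound_nonneg
    by (intro add_nonneg_nonneg Bochner_Integration.integral_nonneg) auto
qed

lemma Picard_step_le:
  assumes t: "t \<in> {0..T}" and w: "\<omega> \<in> space P"
  shows "norm ((Picard_map ^^ Suc n) Z t \<omega> - (Picard_map ^^ n) Z t \<omega>) \<le>
    Picard_const \<omega> * ((3 * C * t) ^ n / fact n)"
  using t w
proof (induction n arbitrary: t \<omega>)
  case 0
  have "norm (Picard_map Z t \<omega> - Z t \<omega>) \<le> Picard_bound (\<lambda>_. 0) \<omega>"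
    using Picard_map_dominated[OF dominated_Z] 0 by (auto simp: dominated_def)
  moreover have "0 \<le> (LINT \<omega>|P. Picard_bound (\<lambda>_. 0) \<omega>)"
    using Picard_bound_nonneg by (intro Bochner_Integration.integral_nonneg) auto
  ultimately show ?case by (simp add: Picard_const_def)
next
  case (Suc n)
  define V where "V m = (Picard_map ^^ m) Z" for m
  have VS: "V (Suc m) = Picard_map (V m)" for m by (simp add: V_def)
  have "\<exists>Q. dominated Q (V m)" for m
    by (induction m) (use dominated_Z Picard_map_dominated in \<open>auto simp: V_def\<close>)
  then obtain Q where dom: "\<And>m. dominated (Q m) (V m)" by metis
  let ?b = "Picard_bound (\<lambda>_. 0)"
  have b: "integrable P ?b" using dominated_Q[OF Picard_map_dominated[OF dominated_Z]] .
  have b0: "0 \<le> (LINT \<omega>|P. ?b \<omega>)"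
    using Picard_bound_nonneg by (intro Bochner_Integration.integral_nonneg) auto
  have IH: "norm (V (Suc n) s \<omega> - V n s \<omega>) \<le> (?b \<omega> + (LINT \<omega>|P. ?b \<omega>)) * ((3 * C * s) ^ n / fact n)"
    if "s \<in> {0..T}" "\<omega> \<in> space P" for s \<omega>
    using Suc.IH[OF that] by (simp add: V_def Picard_const_def)
  have "norm (drift_integral (V (Suc n)) t \<omega> - drift_integral (V n) t \<omega>) \<le>
      Picard_const \<omega> * ((3 * C * t) ^ Suc n / fact (Suc n))"
    unfolding drift_integral_def
  proof (rule drift_integral_power_le)
    fix s assume "s \<in> {0..t}"
    then have s: "s \<in> {0..T}" using Suc.prems by auto
    show "norm (F s (V (Suc n) s) (V (Suc n) s \<omega>) - F s (V n s) (V n s \<omega>)) \<le>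
        Picard_const \<omega> * (3 * C * ((3 * C * s) ^ n / fact n))"
      unfolding Picard_const_def
    proof (rule drift_diff_le)
      show "AE \<omega> in P. norm (V (Suc n) s \<omega> - V n s \<omega>) \<le> (?b \<omega> + (LINT \<omega>|P. ?b \<omega>)) * ((3 * C * s) ^ n / fact n)"
        using IH[OF s] by (intro AE_I2)
    qed (use s Suc.prems b b0 IH Picard_bound_nonneg dominated_integrable[OF dom] C in auto)
  qed (use Suc.prems drift_set_integrable[OF dom] in auto)
  moreover have "V (Suc m) t \<omega> = Z t \<omega> + drift_integral (V m) t \<omega>" for m
    by (simp only: VS Picard_map_def)
  ultimately show ?case
    unfolding V_def[symmetric] by simp
qed

text \<open>Built from Z, T and the constants C, B, Zb alone; the drift enters only through these.
  This is the source of all bounds that are uniform in the controls.\<close>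

definition solution_bound :: "'w \<Rightarrow> real" where
  "solution_bound \<omega> = Picard_const \<omega> * exp (3 * C * T)"

text \<open>The increments of the iteration are dominated by the exponential series, uniformly in
  time on every path. So adaptedness and continuity of paths survive in the limit, and the equation
  holds for every \<omega> rather than almost every one.\<close>

theorem solution_exists:
  obtains V where "dominated solution_bound V"
    and "\<And>t \<omega>. t \<in> {0..T} \<Longrightarrow> \<omega> \<in> space P \<Longrightarrow> V t \<omega> = Z t \<omega> + drift_integral V t \<omega>"
proof -
  define VV where "VV m = (Picard_map ^^ m) Z" for m
  define D where "D m t \<omega> = VV (Suc m) t \<omega> - VV m t \<omega>" for m t \<omega>
  define e where "e k = (3 * C * T) ^ k / fact k" for k
  define V where "V t \<omega> = Z t \<omega> + (\<Sum>k. D k t \<omega>)" for t \<omega>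
  define tail where "tail n = (\<Sum>k. e (k + n))" for n
  have VVS: "VV (Suc m) = Picard_map (VV m)" for m by (simp add: VV_def)
  have "\<exists>Q. dominated Q (VV m)" for m
    by (induction m) (use dominated_Z Picard_map_dominated in \<open>auto simp: VV_def\<close>)
  then obtain Q where dom: "\<And>m. dominated (Q m) (VV m)" by metis
  have e_sums: "e sums exp (3 * C * T)"
    unfolding e_def using exp_converges[of "3 * C * T"] by (simp add: divide_inverse mult.commute)
  then have e_sum: "summable e" by (rule sums_summable)
  have e0: "0 \<le> e k" for k unfolding e_def using C T by simp
  have De: "norm (D k t \<omega>) \<le> Picard_const \<omega> * e k" if "t \<in> {0..T}" "\<omega> \<in> space P" for k t \<omega>
  proof -
    have "norm (D k t \<omega>) \<le> Picard_const \<omega> * ((3 * C * t) ^ k / fact k)"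
      using Picard_step_le[OF that, of k] unfolding D_def VV_def .
    also have "\<dots> \<le> Picard_const \<omega> * e k"
      unfolding e_def using that C Picard_const_nonneg
      by (intro mult_left_mono divide_right_mono power_mono mult_nonneg_nonneg) auto
    finally show ?thesis .
  qed
  have Dsum: "summable (\<lambda>k. D k t \<omega>)" if "t \<in> {0..T}" "\<omega> \<in> space P" for t \<omega>
    by (rule summable_comparison_test'[OF summable_mult[OF e_sum, of "Picard_const \<omega>"], of 0], rule De[OF that])
  have VVsum: "VV n t \<omega> = Z t \<omega> + (\<Sum>k<n. D k t \<omega>)" for n t \<omega>
    using sum_lessThan_telescope[of "\<lambda>m. VV m t \<omega>" n] unfolding D_def by (simp add: VV_def)
  have tail_le: "norm (V t \<omega> - VV n t \<omega>) \<le> Picard_const \<omega> * tail n"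
    if tw: "t \<in> {0..T}" "\<omega> \<in> space P" for n t \<omega>
  proof -
    have "V t \<omega> - VV n t \<omega> = (\<Sum>k. D (k + n) t \<omega>)"
      unfolding V_def VVsum using suminf_minus_initial_segment[OF Dsum[OF tw], of n] by simp
    also have "norm \<dots> \<le> (\<Sum>k. Picard_const \<omega> * e (k + n))"
      using De[OF tw] e_sum by (intro norm_suminf_le summable_mult) (auto simp: summable_iff_shift)
    also have "\<dots> = Picard_const \<omega> * tail n"
      unfolding tail_def using e_sum by (intro suminf_mult) (auto simp: summable_iff_shift)
    finally show ?thesis .
  qed
  have tail0: "tail \<longlonglongrightarrow> 0"
    unfolding tail_def by (rule suminf_exist_split2[OF e_sum])
  have tail_nonneg: "0 \<le> tail n" for n
    unfolding tail_def using e0 e_sum by (intro suminf_nonneg) (auto simp: summable_iff_shift)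
  have tailP: "(\<lambda>n. c * tail n) \<longlonglongrightarrow> 0" for c
    using tendsto_mult_left[OF tail0, of c] by simp
  have lim: "(\<lambda>n. VV n t \<omega>) \<longlonglongrightarrow> V t \<omega>" if "t \<in> {0..T}" "\<omega> \<in> space P" for t \<omega>
    by (rule LIM_zero_cancel, rule Lim_null_comparison[OF _ tailP[of "Picard_const \<omega>"]])
       (use tail_le[OF that] in \<open>simp add: norm_minus_commute\<close>)
  have domV: "dominated solution_bound V"
    unfolding dominated_def
  proof (intro conjI ballI)
    show "integrable P solution_bound"
      unfolding solution_bound_def[abs_def] using Picard_const_integrable by auto
    show "V t \<in> borel_measurable (Fl t)" if t: "t \<in> {0..T}" for t
      by (rule borel_measurable_LIMSEQ_metric[OF dominated_adapted[OF dom t] lim[OF t]]) simp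
    show "norm (V t \<omega> - Z t \<omega>) \<le> solution_bound \<omega>" if "t \<in> {0..T}" "\<omega> \<in> space P" for t \<omega>
    proof -
      have "VV 0 = Z" "tail 0 = exp (3 * C * T)"
        using e_sums by (auto simp: VV_def tail_def sums_iff)
      then show ?thesis using tail_le[OF that, of 0] by (simp add: solution_bound_def)
    qed
    fix \<omega> assume w: "\<omega> \<in> space P"
    show "continuous_on {0..T} (\<lambda>t. V t \<omega>)"
    proof (rule uniform_limit_theorem[where F = sequentially and f = "\<lambda>n t. VV n t \<omega>"])
      show "uniform_limit {0..T} (\<lambda>n t. VV n t \<omega>) (\<lambda>t. V t \<omega>) sequentially"
      proof (rule uniform_limitI)
        fix r :: real assume "r > 0"
        then have "\<forall>\<^sub>F n in sequentially. Picard_const \<omega> * tail n < r"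
          using order_tendstoD(2)[OF tailP] by blast
        then show "\<forall>\<^sub>F n in sequentially. \<forall>t\<in>{0..T}. dist (VV n t \<omega>) (V t \<omega>) < r"
        proof eventually_elim
          case (elim n)
          then show ?case
            using le_less_trans[OF tail_le[OF _ w, of _ n]] by (simp add: dist_norm norm_minus_commute)
        qed
      qed
    qed (use dominated_cont[OF dom w] in auto)
  qed
  show thesis
  proof (rule that[OF domV])
    fix t \<omega> assume t: "t \<in> {0..T}" and w: "\<omega> \<in> space P"
    \<comment> \<open>The Lipschitz bound for the drift, with distance at most
      \<open>Picard_const\<close> times the tail on the path and in the mean, integrated over
      {0..t}.\<close>
    define c where "c = t * (C * (Picard_const \<omega> + (LINT \<omega>|P. Picard_const \<omega>)))"
    have le: "norm (drift_integral V t \<omega> - drift_integral (VV n) t \<omega>) \<le> c * tail n" for n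
    proof -
      note i = drift_set_integrable[OF domV w t] drift_set_integrable[OF dom[of n] w t]
      have "norm (LINT s:{0..t}|lborel. F s (V s) (V s \<omega>) - F s (VV n s) (VV n s \<omega>)) \<le>
          (LINT s:{0..t}|lborel. C * ((Picard_const \<omega> + (LINT \<omega>|P. Picard_const \<omega>)) * tail n))"
      proof (rule set_integral_norm_le[OF set_integral_diff(1)[OF i] set_integrable_const])
        fix s assume "s \<in> {0..t}"
        then have s: "s \<in> {0..T}" using t by auto
        note int = dominated_integrable[OF domV s] dominated_integrable[OF dom[of n] s]
        have "(LINT \<omega>|P. norm (V s \<omega> - VV n s \<omega>)) \<le> (LINT \<omega>|P. Picard_const \<omega> * tail n)"
          using int Picard_const_integrable tail_le[OF s] by (intro integral_mono) auto
        then have "norm (V s \<omega> - VV n s \<omega>) + (LINT \<omega>|P. norm (V s \<omega> - VV n s \<omega>)) \<le>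
            (Picard_const \<omega> + (LINT \<omega>|P. Picard_const \<omega>)) * tail n"
          using tail_le[OF s w, of n] by (simp add: algebra_simps)
        from mult_left_mono[OF this C]
        show "norm (F s (V s) (V s \<omega>) - F s (VV n s) (VV n s \<omega>)) \<le>
            C * ((Picard_const \<omega> + (LINT \<omega>|P. Picard_const \<omega>)) * tail n)"
          using F_lip[OF s int, of "V s \<omega>" "VV n s \<omega>"] by linarith
      qed
      also have "\<dots> = c * tail n"
        using t by (simp add: set_integral_const c_def)
      finally show ?thesis
        unfolding drift_integral_def using set_integral_diff(2)[OF i] by simp
    qed
    have "(\<lambda>n. drift_integral (VV n) t \<omega>) \<longlonglongrightarrow> drift_integral V t \<omega>"
      by (rule LIM_zero_cancel, rule Lim_null_comparison[OF _ tailP[of c]])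
         (use le in \<open>simp add: norm_minus_commute\<close>)
    then have "(\<lambda>n. VV (Suc n) t \<omega>) \<longlonglongrightarrow> Z t \<omega> + drift_integral V t \<omega>"
      unfolding VVS Picard_map_def by (intro tendsto_intros)
    moreover have "(\<lambda>n. VV (Suc n) t \<omega>) \<longlonglongrightarrow> V t \<omega>"
      using lim[OF t w] by (rule LIMSEQ_Suc)
    ultimately show "V t \<omega> = Z t \<omega> + drift_integral V t \<omega>"
      using LIMSEQ_unique by blast
  qed
qed


section \<open>A priori bounds, uniqueness and time regularity of arbitrary solutions\<close>

definition solves :: "(real \<Rightarrow> 'w \<Rightarrow> 'v) \<Rightarrow> 'w \<Rightarrow> bool" where
  "solves V \<omega> \<longleftrightarrow> (\<forall>t\<in>{0..T}. set_integrable lborel {0..t} (\<lambda>s. F s (V s) (V s \<omega>)) \<and>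
     V t \<omega> = Z t \<omega> + drift_integral V t \<omega>)"

text \<open>
  The drift along a single good path bounds the mean-field part of the drift for all paths, so
  that no integrability in time of the means needs to be known beforehand.
\<close>
lemma solution_a_priori:
  assumes int: "\<And>t. t \<in> {0..T} \<Longrightarrow> integrable P (V t)"
    and cont: "\<And>\<omega>. \<omega> \<in> space P \<Longrightarrow> continuous_on {0..T} (\<lambda>t. V t \<omega>)"
    and sol: "AE \<omega> in P. solves V \<omega>"
  obtains Q where "integrable P Q" "\<And>\<omega>. 0 \<le> Q \<omega>"
    "\<And>\<omega> t. \<omega> \<in> space P \<Longrightarrow> solves V \<omega> \<Longrightarrow> t \<in> {0..T} \<Longrightarrow> norm (V t \<omega> - Z t \<omega>) \<le> Q \<omega>"
proof -
  have "\<exists>\<omega>\<in>space P. solves V \<omega>"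
  proof (rule ccontr)
    assume *: "\<not> ?thesis"
    have "AE \<omega> in P. False" using sol AE_space by eventually_elim (use * in auto)
    then show False by simp
  qed
  then obtain w0 where w0: "w0 \<in> space P" "solves V w0" by blast
  define \<psi> where "\<psi> s = norm (F s (V s) (V s w0)) + C * norm (V s w0)" for s
  have V_int: "set_integrable lborel {a..b} (\<lambda>s. norm (V s \<omega>))"
    if "\<omega> \<in> space P" "{a..b} \<subseteq> {0..T}" for \<omega> a b
    unfolding set_integrable_def
    using continuous_on_subset[OF cont[OF that(1)] that(2)]
    by (intro borel_integrable_compact continuous_intros) auto
  have psi: "set_integrable lborel {0..T} \<psi>"
    unfolding \<psi>_def
  proof (rule set_integral_add(1))
    show "set_integrable lborel {0..T} (\<lambda>s. norm (F s (V s) (V s w0)))"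
      using w0(2) T by (intro set_integrable_norm) (auto simp: solves_def)
    show "set_integrable lborel {0..T} (\<lambda>s. C * norm (V s w0))"
      using V_int[OF w0(1), of 0 T] by (intro set_integrable_mult_right) auto
  qed
  have psi0: "0 \<le> \<psi> s" for s unfolding \<psi>_def using C by simp
  define A where "A \<omega> = (LINT s:{0..T}|lborel. \<psi> s) + C * Z_int \<omega>" for \<omega>
  have A0: "0 \<le> A \<omega>" for \<omega>
    unfolding A_def set_lebesgue_integral_def using psi0 C Z_int_nonneg by simp
  show thesis
  proof (rule that[of "\<lambda>\<omega>. A \<omega> * exp (C * T)"])
    show "integrable P (\<lambda>\<omega>. A \<omega> * exp (C * T))"
      unfolding A_def using Z_int_integrable by auto
    show "0 \<le> A \<omega> * exp (C * T)" for \<omega> using A0 by simp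
    fix \<omega> t assume w: "\<omega> \<in> space P" and sw: "solves V \<omega>" and t: "t \<in> {0..T}"
    have D_cont: "continuous_on {0..T} (\<lambda>s. norm (V s \<omega> - Z s \<omega>))"
      using cont[OF w] Z_cont[OF w] by (intro continuous_intros)
    have D_int: "set_integrable lborel {0..t} (\<lambda>s. norm (V s \<omega> - Z s \<omega>))" if "t \<in> {0..T}" for t
      unfolding set_integrable_def
      by (intro borel_integrable_compact continuous_on_subset[OF D_cont]) (use that in auto)
    have "norm (V t \<omega> - Z t \<omega>) \<le> A \<omega> * exp (C * t)"
    proof (rule Gronwall_integral[OF D_cont C _ t])
      fix t assume t: "t \<in> {0..T}"
      have sub: "{0..t} \<subseteq> {0..T}" using t by auto
      have psit: "set_integrable lborel {0..t} \<psi>"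
        by (rule set_integrable_subset[OF psi]) (use t in auto)
      have Zt: "set_integrable lborel {0..t} (\<lambda>s. C * norm (Z s \<omega>))"
        using Z_set_integrable[OF w sub] by (rule set_integrable_mult_right)
      have Dt: "set_integrable lborel {0..t} (\<lambda>s. C * norm (V s \<omega> - Z s \<omega>))"
        using D_int[OF t] by (rule set_integrable_mult_right)
      have "norm (V t \<omega> - Z t \<omega>) = norm (drift_integral V t \<omega>)"
        using sw t by (simp add: solves_def)
      also have "\<dots> \<le> (LINT s:{0..t}|lborel. \<psi> s + C * norm (Z s \<omega>) + C * norm (V s \<omega> - Z s \<omega>))"
        unfolding drift_integral_def
      proof (rule set_integral_norm_le)
        show "set_integrable lborel {0..t} (\<lambda>s. F s (V s) (V s \<omega>))" using sw t by (simp add: solves_def)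
        show "set_integrable lborel {0..t} (\<lambda>s. \<psi> s + C * norm (Z s \<omega>) + C * norm (V s \<omega> - Z s \<omega>))"
          using psit Zt Dt by (intro set_integral_add(1))
        fix s assume "s \<in> {0..t}"
        then have s: "s \<in> {0..T}" using t by auto
        have "norm (F s (V s) (V s \<omega>) - F s (V s) (V s w0)) \<le> C * norm (V s \<omega> - V s w0)"
          using F_lip[OF s int[OF s] int[OF s], of "V s \<omega>" "V s w0"] by simp
        also have "\<dots> \<le> C * (norm (V s \<omega> - Z s \<omega>) + norm (Z s \<omega>) + norm (V s w0))"
          using norm_triangle_ineq4[of "V s \<omega>" "V s w0"] norm_triangle_ineq2[of "V s \<omega>" "Z s \<omega>"]
          by (intro mult_left_mono C) linarith
        finally show "norm (F s (V s) (V s \<omega>)) \<le> \<psi> s + C * norm (Z s \<omega>) + C * norm (V s \<omega> - Z s \<omega>)"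
          using norm_triangle_ineq2[of "F s (V s) (V s \<omega>)" "F s (V s) (V s w0)"]
          unfolding \<psi>_def by (simp add: algebra_simps)
      qed
      also have "\<dots> = (LINT s:{0..t}|lborel. \<psi> s) + C * (LINT s:{0..t}|lborel. norm (Z s \<omega>)) +
          C * integral {0..t} (\<lambda>s. norm (V s \<omega> - Z s \<omega>))"
        using psit Zt Dt set_borel_integral_eq_integral(2)[OF D_int[OF t]]
        by (simp add: set_integral_add)
      also have "\<dots> \<le> A \<omega> + C * integral {0..t} (\<lambda>s. norm (V s \<omega> - Z s \<omega>))"
      proof -
        have "(LINT s:{0..t}|lborel. \<psi> s) \<le> (LINT s:{0..T}|lborel. \<psi> s)"
          unfolding set_lebesgue_integral_def
        proof (rule integral_mono)
          show "integrable lborel (\<lambda>x. indicator {0..t} x *\<^sub>R \<psi> x)"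
            and "integrable lborel (\<lambda>x. indicator {0..T} x *\<^sub>R \<psi> x)"
            using psi psit by (auto simp: set_integrable_def)
        qed (use t psi0 in \<open>auto simp: indicator_def\<close>)
        then show ?thesis
          unfolding A_def using mult_left_mono[OF Z_int_mono[OF w sub] C] by linarith
      qed
      finally show "norm (V t \<omega> - Z t \<omega>) \<le> A \<omega> + C * integral {0..t} (\<lambda>s. norm (V s \<omega> - Z s \<omega>))" .
    qed
    also have "\<dots> \<le> A \<omega> * exp (C * T)"
      using t A0 C by (intro mult_left_mono) (auto intro: mult_left_mono)
    finally show "norm (V t \<omega> - Z t \<omega>) \<le> A \<omega> * exp (C * T)" .
  qed
qed

lemma solution_L1_continuous:
  assumes int: "\<And>t. t \<in> {0..T} \<Longrightarrow> integrable P (V t)"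
    and cont: "\<And>\<omega>. \<omega> \<in> space P \<Longrightarrow> continuous_on {0..T} (\<lambda>t. V t \<omega>)"
    and sol: "AE \<omega> in P. solves V \<omega>"
  shows "L1_continuous P T V"
proof -
  obtain Q where Q: "integrable P Q"
    "\<And>\<omega> t. \<omega> \<in> space P \<Longrightarrow> solves V \<omega> \<Longrightarrow> t \<in> {0..T} \<Longrightarrow> norm (V t \<omega> - Z t \<omega>) \<le> Q \<omega>"
    using solution_a_priori[OF int cont sol] by metis
  show ?thesis
    using Z_L1 int cont Z_cont Q(1)
  proof (rule L1_continuous_dominated)
    show "AE \<omega> in P. \<forall>t\<in>{0..T}. norm (V t \<omega> - Z t \<omega>) \<le> Q \<omega>"
      using sol AE_space by eventually_elim (use Q(2) in blast)
  qed
qed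

text \<open>The a priori bounds give distance at most S = Q + Q'. Each passage through the equation
  improves the factor to the next term (3 C t)^n / n!, which tends to 0. The exceptional set is
  fixed once in \<open>good\<close>, so equality holds for all times simultaneously.\<close>

theorem solution_unique:
  assumes int: "\<And>t. t \<in> {0..T} \<Longrightarrow> integrable P (V t)" "\<And>t. t \<in> {0..T} \<Longrightarrow> integrable P (V' t)"
    and cont: "\<And>\<omega>. \<omega> \<in> space P \<Longrightarrow> continuous_on {0..T} (\<lambda>t. V t \<omega>)"
      "\<And>\<omega>. \<omega> \<in> space P \<Longrightarrow> continuous_on {0..T} (\<lambda>t. V' t \<omega>)"
    and sol: "AE \<omega> in P. solves V \<omega>" "AE \<omega> in P. solves V' \<omega>"
  shows "AE \<omega> in P. \<forall>t\<in>{0..T}. V t \<omega> = V' t \<omega>"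
proof -
  obtain Q where Q: "integrable P Q" "\<And>\<omega>. 0 \<le> Q \<omega>"
    "\<And>\<omega> t. \<omega> \<in> space P \<Longrightarrow> solves V \<omega> \<Longrightarrow> t \<in> {0..T} \<Longrightarrow> norm (V t \<omega> - Z t \<omega>) \<le> Q \<omega>"
    using solution_a_priori[OF int(1) cont(1) sol(1)] by metis
  obtain Q' where Q': "integrable P Q'" "\<And>\<omega>. 0 \<le> Q' \<omega>"
    "\<And>\<omega> t. \<omega> \<in> space P \<Longrightarrow> solves V' \<omega> \<Longrightarrow> t \<in> {0..T} \<Longrightarrow> norm (V' t \<omega> - Z t \<omega>) \<le> Q' \<omega>"
    using solution_a_priori[OF int(2) cont(2) sol(2)] by metis
  define S where "S \<omega> = Q \<omega> + Q' \<omega>" for \<omega>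
  have S: "integrable P S" unfolding S_def[abs_def] using Q(1) Q'(1) by auto
  have S0: "0 \<le> S \<omega>" for \<omega> using Q(2) Q'(2) by (simp add: S_def)
  have ES0: "0 \<le> (LINT \<omega>|P. S \<omega>)" using S0 by simp
  define good where "good \<omega> \<longleftrightarrow> \<omega> \<in> space P \<and> solves V \<omega> \<and> solves V' \<omega>" for \<omega>
  have good: "AE \<omega> in P. good \<omega>"
    using sol AE_space by eventually_elim (simp add: good_def)
  have le: "norm (V t \<omega> - V' t \<omega>) \<le> (S \<omega> + (LINT \<omega>|P. S \<omega>)) * ((3 * C * t) ^ n / fact n)"
    if "good \<omega>" "t \<in> {0..T}" for n t \<omega>
    using that
  proof (induction n arbitrary: t \<omega>)
    case 0
    have "norm (V t \<omega> - V' t \<omega>) \<le> norm (V t \<omega> - Z t \<omega>) + norm (V' t \<omega> - Z t \<omega>)"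
      using norm_triangle_ineq4[of "V t \<omega> - Z t \<omega>" "V' t \<omega> - Z t \<omega>"] by simp
    also have "\<dots> \<le> S \<omega>"
      unfolding S_def using 0 by (intro add_mono Q(3) Q'(3)) (auto simp: good_def)
    finally show ?case using ES0 by simp
  next
    case (Suc n)
    have t: "t \<in> {0..T}" by fact
    have "norm (drift_integral V t \<omega> - drift_integral V' t \<omega>) \<le>
        (S \<omega> + (LINT \<omega>|P. S \<omega>)) * ((3 * C * t) ^ Suc n / fact (Suc n))"
      unfolding drift_integral_def
    proof (rule drift_integral_power_le[OF t])
      fix s assume "s \<in> {0..t}"
      then have s: "s \<in> {0..T}" using t by auto
      show "norm (F s (V s) (V s \<omega>) - F s (V' s) (V' s \<omega>)) \<le>
          (S \<omega> + (LINT \<omega>|P. S \<omega>)) * (3 * C * ((3 * C * s) ^ n / fact n))"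
      proof (rule drift_diff_le[where S = S and V = V and V' = V' and s = s and \<omega> = \<omega>, OF s int(1)[OF s] int(2)[OF s] S S0[of \<omega>] ES0])
        show "0 \<le> (3 * C * s) ^ n / fact n" using C s by simp
        show "norm (V s \<omega> - V' s \<omega>) \<le> (S \<omega> + (LINT \<omega>|P. S \<omega>)) * ((3 * C * s) ^ n / fact n)"
          using Suc.IH[OF Suc.prems(1) s] .
        show "AE \<omega> in P. norm (V s \<omega> - V' s \<omega>) \<le> (S \<omega> + (LINT \<omega>|P. S \<omega>)) * ((3 * C * s) ^ n / fact n)"
          using good Suc.IH[OF _ s] by (rule eventually_mono)
      qed
    qed (use Suc.prems in \<open>auto simp: good_def solves_def\<close>)
    then show ?case
      using Suc.prems by (simp add: good_def solves_def del: power_Suc fact_Suc)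
  qed
  show ?thesis
    using good
  proof eventually_elim
    case (elim \<omega>)
    show ?case
    proof
      fix t assume t: "t \<in> {0..T}"
      have "(\<lambda>n. (3 * C * t) ^ n / fact n) \<longlonglongrightarrow> 0"
        using summable_LIMSEQ_zero[OF summable_exp[of "3 * C * t"]] by (simp add: divide_inverse mult.commute)
      then have "(\<lambda>n. (S \<omega> + (LINT \<omega>|P. S \<omega>)) * ((3 * C * t) ^ n / fact n)) \<longlonglongrightarrow> 0"
        by (rule tendsto_mult_right_zero)
      then have "norm (V t \<omega> - V' t \<omega>) \<le> 0"
        by (rule LIMSEQ_le_const) (use le[OF elim t] in blast)
      then show "V t \<omega> = V' t \<omega>" by simp
    qed
  qed
qed

text \<open>The drift enters the right-hand side only through B, C and the mean of Q, so this
  modulus is shared by all controls. The factor 2 counts Q together with its mean, and Zb once from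
  the bound of the means and once from the time integral of the norm of Z.\<close>

lemma solution_L1_modulus:
  assumes dom: "dominated Q V"
    and sol: "\<And>t \<omega>. t \<in> {0..T} \<Longrightarrow> \<omega> \<in> space P \<Longrightarrow> V t \<omega> = Z t \<omega> + drift_integral V t \<omega>"
    and st: "s \<in> {0..T}" "t \<in> {0..T}"
  shows "(LINT \<omega>|P. norm (V t \<omega> - V s \<omega>)) \<le>
    (LINT \<omega>|P. norm (Z t \<omega> - Z s \<omega>)) + \<bar>t - s\<bar> * (B + 2 * C * (Zb + (LINT \<omega>|P. Q \<omega>)))"
  using st
proof (induction s t rule: linorder_wlog)
  case (le a b)
  let ?q = "LINT \<omega>|P. Q \<omega>"
  have ab: "{a..b} \<subseteq> {0..T}" using le by auto
  let ?g = "\<lambda>\<omega>. norm (Z b \<omega> - Z a \<omega>) + ((b - a) * (B + C * (Q \<omega> + Zb + ?q)) +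
    C * (LINT s:{a..b}|lborel. norm (Z s \<omega>)))"
  note [simp] = Z_integrable[OF le(2)] Z_integrable[OF le(3)] dominated_Q[OF dom] Z_Fubini(1)[OF ab le(1)]
  have "(LINT \<omega>|P. norm (V b \<omega> - V a \<omega>)) \<le> (LINT \<omega>|P. ?g \<omega>)"
  proof (rule integral_mono)
    fix \<omega> assume w: "\<omega> \<in> space P"
    have "norm (V b \<omega> - V a \<omega>) \<le> norm (Z b \<omega> - Z a \<omega>) + norm (drift_integral V b \<omega> - drift_integral V a \<omega>)"
      using norm_triangle_ineq[of "Z b \<omega> - Z a \<omega>" "drift_integral V b \<omega> - drift_integral V a \<omega>"]
      by (simp add: sol[OF le(2) w] sol[OF le(3) w] algebra_simps)
    then show "norm (V b \<omega> - V a \<omega>) \<le> ?g \<omega>"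
      using drift_integral_diff_le[OF dom w, of a b] le by auto
  qed (use dominated_integrable[OF dom] le in auto)
  also have "\<dots> = (LINT \<omega>|P. norm (Z b \<omega> - Z a \<omega>)) + ((b - a) * (B + C * (?q + Zb + ?q)) +
      C * (LINT \<omega>|P. (LINT s:{a..b}|lborel. norm (Z s \<omega>))))"
    by (simp add: prob_space)
  also have "\<dots> \<le> (LINT \<omega>|P. norm (Z b \<omega> - Z a \<omega>)) + ((b - a) * (B + C * (?q + Zb + ?q)) + C * ((b - a) * Zb))"
    using mult_left_mono[OF Z_Fubini(2)[OF ab le(1)] C] by simp
  also have "\<dots> = (LINT \<omega>|P. norm (Z b \<omega> - Z a \<omega>)) + \<bar>b - a\<bar> * (B + 2 * C * (Zb + ?q))"
    using le(1) by (simp add: algebra_simps)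
  finally show ?case .
next
  case (sym a b)
  then show ?case by (simp add: norm_minus_commute abs_minus_commute)
qed

end

section \<open>Laws, Wasserstein distance and Gaussian increments\<close>

lemma (in prob_space) law_integral:
  fixes \<xi> :: "'a \<Rightarrow> 'b::euclidean_space" and f :: "'b \<Rightarrow> 'c::euclidean_space"
  assumes "\<xi> \<in> borel_measurable M" "continuous_on UNIV f"
  shows "(LINT x|law M \<xi>. f x) = (LINT \<omega>|M. f (\<xi> \<omega>))"
  unfolding law_def
  by (intro integral_distr assms borel_measurable_continuous_onI)

lemma (in prob_space) law_in_wasserstein_space:
  fixes \<xi> :: "'a \<Rightarrow> 'b::euclidean_space"
  assumes "integrable M \<xi>"
  shows "law M \<xi> \<in> wasserstein_space 1"
proof -
  have [measurable]: "\<xi> \<in> borel_measurable M" using assms by auto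
  have "integrable (law M \<xi>) (\<lambda>x. norm x)"
    unfolding law_def using assms by (subst integrable_distr_eq) auto
  then have "integrable (law M \<xi>) (\<lambda>x. norm x powr 1)" by simp
  then show ?thesis
    unfolding wasserstein_space_def law_def by (auto intro: prob_space_distr)
qed

lemma (in prob_space) integrable_if_law_in_wasserstein_space:
  fixes \<xi> :: "'a \<Rightarrow> 'b::euclidean_space"
  assumes [measurable]: "\<xi> \<in> borel_measurable M" and "law M \<xi> \<in> wasserstein_space p" "1 \<le> p"
  shows "integrable M \<xi>"
proof -
  have "integrable (distr M borel \<xi>) (\<lambda>x. norm x powr p)"
    using assms(2) by (simp add: wasserstein_space_def law_def)
  then have "integrable M (\<lambda>\<omega>. norm (\<xi> \<omega>) powr p)"
    by (subst (asm) integrable_distr_eq) auto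
  then have "integrable M (\<lambda>\<omega>. 1 + norm (\<xi> \<omega>) powr p)" by auto
  then show ?thesis
  proof (rule Bochner_Integration.integrable_bound)
    have "r \<le> 1 + r powr p" if "0 \<le> r" for r :: real
    proof (cases "r \<le> 1")
      case False
      then have "r powr 1 \<le> r powr p" using assms(3) by (intro powr_mono) auto
      then show ?thesis using False by simp
    qed (auto intro: order_trans)
    then show "AE \<omega> in M. norm (\<xi> \<omega>) \<le> norm (1 + norm (\<xi> \<omega>) powr p)"
      by (intro AE_I2) auto
  qed simp
qed

text \<open>The joint law of \<xi> and \<eta> is a coupling of the two laws, and its cost is the L^1
  distance.\<close>

lemma (in prob_space) wasserstein_dist_law_le:
  fixes \<xi> \<eta> :: "'a \<Rightarrow> 'b::euclidean_space"
  assumes "integrable M \<xi>" "integrable M \<eta>"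
  shows "wasserstein_dist 1 (law M \<xi>) (law M \<eta>) \<le> (LINT \<omega>|M. norm (\<xi> \<omega> - \<eta> \<omega>))"
proof -
  have [measurable]: "\<xi> \<in> borel_measurable M" "\<eta> \<in> borel_measurable M" using assms by auto
  let ?\<pi> = "distr M borel (\<lambda>\<omega>. (\<xi> \<omega>, \<eta> \<omega>))"
  let ?c = "\<lambda>\<pi>. LINT z|\<pi>. dist (fst z) (snd z :: 'b) powr 1"
  have [measurable]: "(\<lambda>\<omega>. (\<xi> \<omega>, \<eta> \<omega>)) \<in> borel_measurable M" by simp
  have "?\<pi> \<in> couplings (law M \<xi>) (law M \<eta>)"
    unfolding couplings_def law_def
    by (auto intro!: prob_space_distr simp: distr_distr o_def borel_measurable_continuous_onI continuous_intros)
  moreover have "bdd_below (?c ` couplings (law M \<xi>) (law M \<eta>))"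
    by (intro bdd_belowI[of _ 0]) auto
  ultimately have "(INF \<pi>\<in>couplings (law M \<xi>) (law M \<eta>). ?c \<pi>) \<le> ?c ?\<pi>"
    by (rule cINF_lower[rotated])
  also have "?c ?\<pi> = (LINT \<omega>|M. norm (\<xi> \<omega> - \<eta> \<omega>))"
    by (subst integral_distr) (auto simp: dist_norm intro!: borel_measurable_continuous_onI continuous_intros)
  finally have le: "(INF \<pi>\<in>couplings (law M \<xi>) (law M \<eta>). ?c \<pi>) \<le> (LINT \<omega>|M. norm (\<xi> \<omega> - \<eta> \<omega>))" .
  \<comment> \<open>The outer exponent 1 cancels for a nonnegative infimum; the coupling above shows
    that the infimum is over a nonempty set.\<close>
  have "0 \<le> (INF \<pi>\<in>couplings (law M \<xi>) (law M \<eta>). ?c \<pi>)"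
    using \<open>?\<pi> \<in> _\<close> by (intro cINF_greatest) auto
  then show ?thesis using le unfolding wasserstein_dist_def by simp
qed

text \<open>\<open>topology\<close> can be unfolded only for a family that satisfies
  \<open>istopology\<close>. For intersections the smaller radius is taken.\<close>

lemma openin_wasserstein_topology:
  "openin (wasserstein_topology p) S \<longleftrightarrow> S \<subseteq> wasserstein_space p \<and>
     (\<forall>\<mu>\<in>S. \<exists>r>0. \<forall>\<nu>\<in>wasserstein_space p. wasserstein_dist p \<mu> \<nu> < r \<longrightarrow> \<nu> \<in> S)"
proof -
  have "istopology (\<lambda>S. S \<subseteq> wasserstein_space p \<and>
       (\<forall>\<mu>\<in>S. \<exists>r>0. \<forall>\<nu>\<in>wasserstein_space p. wasserstein_dist p \<mu> \<nu> < r \<longrightarrow> \<nu> \<in> S))" (is "istopology ?O")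
    unfolding istopology_def
  proof (intro conjI allI impI)
    fix S T assume S: "?O S" and T: "?O T"
    show "S \<inter> T \<subseteq> wasserstein_space p" using S by blast
    show "\<forall>\<mu>\<in>S \<inter> T. \<exists>r>0. \<forall>\<nu>\<in>wasserstein_space p. wasserstein_dist p \<mu> \<nu> < r \<longrightarrow> \<nu> \<in> S \<inter> T"
    proof
      fix \<mu> assume "\<mu> \<in> S \<inter> T"
      then have "\<mu> \<in> S" "\<mu> \<in> T" by auto
      obtain r where "r > 0" "\<forall>\<nu>\<in>wasserstein_space p. wasserstein_dist p \<mu> \<nu> < r \<longrightarrow> \<nu> \<in> S"
        using S \<open>\<mu> \<in> S\<close> by blast
      moreover obtain r' where "r' > 0" "\<forall>\<nu>\<in>wasserstein_space p. wasserstein_dist p \<mu> \<nu> < r' \<longrightarrow> \<nu> \<in> T"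
        using T \<open>\<mu> \<in> T\<close> by blast
      ultimately show "\<exists>r>0. \<forall>\<nu>\<in>wasserstein_space p. wasserstein_dist p \<mu> \<nu> < r \<longrightarrow> \<nu> \<in> S \<inter> T"
        by (intro exI[of _ "min r r'"]) auto
    qed
  next
    fix K assume K: "\<forall>S\<in>K. ?O S"
    then show "\<Union>K \<subseteq> wasserstein_space p" by blast
    show "\<forall>\<mu>\<in>\<Union>K. \<exists>r>0. \<forall>\<nu>\<in>wasserstein_space p. wasserstein_dist p \<mu> \<nu> < r \<longrightarrow> \<nu> \<in> \<Union>K"
    proof
      fix \<mu> assume "\<mu> \<in> \<Union>K"
      then obtain S where "S \<in> K" "\<mu> \<in> S" by blast
      moreover then obtain r where "r > 0" "\<forall>\<nu>\<in>wasserstein_space p. wasserstein_dist p \<mu> \<nu> < r \<longrightarrow> \<nu> \<in> S"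
        using K by blast
      ultimately show "\<exists>r>0. \<forall>\<nu>\<in>wasserstein_space p. wasserstein_dist p \<mu> \<nu> < r \<longrightarrow> \<nu> \<in> \<Union>K"
        by blast
    qed
  qed
  from topology_inverse'[OF this] show ?thesis
    unfolding wasserstein_topology_def by (rule fun_cong)
qed

lemma topspace_wasserstein_topology [simp]:
  "topspace (wasserstein_topology p) = wasserstein_space p"
proof -
  have "openin (wasserstein_topology p) (wasserstein_space p)"
    unfolding openin_wasserstein_topology by (auto intro: exI[of _ 1])
  moreover have "topspace (wasserstein_topology p) \<subseteq> wasserstein_space p"
    using openin_topspace[of "wasserstein_topology p"] openin_wasserstein_topology by blast
  ultimately show ?thesis using openin_subset by blast
qed

text \<open>The distance is measured from \<mu> because the balls of the topology are centred there.
  Any majorant D that tends to 0 will do; below it is an L^1 distance.\<close>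

lemma limitin_wasserstein_topology:
  assumes "\<mu> \<in> wasserstein_space p" "\<forall>\<^sub>F x in G. \<nu> x \<in> wasserstein_space p"
    and "((\<lambda>x. D x) \<longlongrightarrow> 0) G" "\<forall>\<^sub>F x in G. wasserstein_dist p \<mu> (\<nu> x) \<le> D x"
  shows "limitin (wasserstein_topology p) \<nu> \<mu> G"
  unfolding limitin_def
proof (intro conjI allI impI)
  fix S assume "openin (wasserstein_topology p) S \<and> \<mu> \<in> S"
  then obtain r where r: "r > 0" "\<And>\<nu>. \<nu> \<in> wasserstein_space p \<Longrightarrow> wasserstein_dist p \<mu> \<nu> < r \<Longrightarrow> \<nu> \<in> S"
    unfolding openin_wasserstein_topology by blast
  have "\<forall>\<^sub>F x in G. D x < r" using order_tendstoD(2)[OF assms(3) r(1)] .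
  then show "\<forall>\<^sub>F x in G. \<nu> x \<in> S"
    using assms(2,4) by eventually_elim (auto intro: r(2))
qed (use assms(1) in simp)

section \<open>First moments of Gaussian increments\<close>

lemma nn_integral_normal_density: "0 < s \<Longrightarrow> (\<integral>\<^sup>+x. ennreal (normal_density 0 s x) \<partial>lborel) = 1"
  using prob_space.emeasure_space_1[OF prob_space_normal_density, of s 0]
  by (simp add: emeasure_density)

lemma nn_integral_abs_normal_density:
  assumes "0 < s"
  shows "(\<integral>\<^sup>+x. ennreal (\<bar>x\<bar> * normal_density 0 s x) \<partial>lborel) = ennreal (s * sqrt (2 / pi))"
proof -
  have "has_bochner_integral lborel (\<lambda>x. normal_density 0 s x * \<bar>x\<bar>) (s * sqrt (2 / pi))"
    using normal_moment_abs_odd[of s 0 0] assms by simp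
  then show ?thesis
    by (subst nn_integral_eq_integral) (auto simp: has_bochner_integral_iff mult.commute)
qed

text \<open>The integral of one coordinate's absolute value against the product density factors:
  that coordinate contributes the absolute moment s * sqrt (2 / pi), at most s, and the others
  contribute 1. The Euclidean norm is at most the sum over the coordinates.\<close>

lemma gaussian_increment_L1:
  fixes D :: "'w \<Rightarrow> real^'d"
  assumes D: "distributed P lborel D (\<lambda>x. ennreal (\<Prod>i\<in>UNIV. normal_density 0 s (x $ i)))" and s: "0 < s"
  shows "integrable P D" "(LINT \<omega>|P. norm (D \<omega>)) \<le> real CARD('d) * s"
proof -
  have [measurable]: "D \<in> borel_measurable P"
    using distributed_measurable[OF D] by simp
  have dist: "distr P lborel D = density lborel (\<lambda>x. ennreal (\<Prod>i\<in>UNIV. normal_density 0 s (x $ i)))"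
    using D by (simp add: distributed_def)
  have one: "(\<integral>\<^sup>+\<omega>. ennreal \<bar>D \<omega> $ i\<bar> \<partial>P) = ennreal (s * sqrt (2 / pi))" for i
  proof -
    \<comment> \<open>Absorbing \<bar>x\<bar> into the factor of the axis i makes the integrand a
      product over \<open>Basis\<close>, so that the Lebesgue integral factors.\<close>
    let ?f = "\<lambda>b x. if b = axis i (1::real) then \<bar>x\<bar> * normal_density 0 s x else normal_density 0 s x"
    have B: "(Basis :: (real^'d) set) = (\<lambda>i. axis i 1) ` UNIV"
      by (auto simp: Basis_vec_def)
    have inj: "inj (\<lambda>i::'d. axis i (1::real))"
      by (auto simp: inj_on_def axis_eq_axis)
    have "(\<integral>\<^sup>+\<omega>. ennreal \<bar>D \<omega> $ i\<bar> \<partial>P) = (\<integral>\<^sup>+x. ennreal \<bar>x $ i\<bar> \<partial>distr P lborel D)"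
      by (subst nn_integral_distr) (auto simp: cart_eq_inner_axis)
    also have "\<dots> = (\<integral>\<^sup>+x. ennreal (\<Prod>i\<in>UNIV. normal_density 0 s (x $ i)) * ennreal \<bar>x $ i\<bar> \<partial>lborel)"
      unfolding dist by (subst nn_integral_density) (auto simp: cart_eq_inner_axis)
    also have "\<dots> = (\<integral>\<^sup>+x. (\<Prod>b\<in>Basis. ennreal (?f b ((x::real^'d) \<bullet> b))) \<partial>lborel)"
    proof (rule nn_integral_cong)
      fix x :: "real^'d"
      have "(\<Prod>b\<in>Basis. ?f b (x \<bullet> b)) = (\<Prod>j\<in>UNIV. ?f (axis j 1) (x $ j))"
        unfolding B by (subst prod.reindex[OF inj]) (auto intro!: prod.cong simp: inner_axis axis_eq_axis)
      also have "\<dots> = (\<Prod>j\<in>UNIV. (if j = i then \<bar>x $ j\<bar> else 1) * normal_density 0 s (x $ j))"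
        by (intro prod.cong) (auto simp: axis_eq_axis)
      also have "\<dots> = \<bar>x $ i\<bar> * (\<Prod>j\<in>UNIV. normal_density 0 s (x $ j))"
        by (simp add: prod.distrib)
      finally have "(\<Prod>b\<in>Basis. ?f b (x \<bullet> b)) = \<bar>x $ i\<bar> * (\<Prod>j\<in>UNIV. normal_density 0 s (x $ j))" .
      moreover have "(\<Prod>b\<in>Basis. ennreal (?f b (x \<bullet> b))) = ennreal (\<Prod>b\<in>Basis. ?f b (x \<bullet> b))"
        by (intro prod_ennreal) auto
      ultimately show "ennreal (\<Prod>i\<in>UNIV. normal_density 0 s (x $ i)) * ennreal \<bar>x $ i\<bar> =
          (\<Prod>b\<in>Basis. ennreal (?f b (x \<bullet> b)))"
        by (simp add: ennreal_mult' mult.commute prod_nonneg)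
    qed
    also have "\<dots> = (\<Prod>b\<in>(Basis :: (real^'d) set). (\<integral>\<^sup>+x. ennreal (?f b x) \<partial>lborel))"
      by (rule nn_integral_lborel_prod) auto
    also have "\<dots> = (\<Prod>b\<in>(Basis :: (real^'d) set). if b = axis i 1 then ennreal (s * sqrt (2 / pi)) else 1)"
      using s by (intro prod.cong) (auto simp: nn_integral_normal_density nn_integral_abs_normal_density)
    also have "\<dots> = ennreal (s * sqrt (2 / pi))"
      by (subst prod.delta) auto
    finally show ?thesis .
  qed
  have sq: "sqrt (2 / pi) \<le> 1"
    using pi_ge_two by simp
  have int: "integrable P (\<lambda>\<omega>. D \<omega> $ i)" for i
    using one[of i] by (intro integrableI_bounded) (auto simp: cart_eq_inner_axis)
  have le: "(LINT \<omega>|P. \<bar>D \<omega> $ i\<bar>) \<le> s" for i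
  proof -
    have "ennreal (LINT \<omega>|P. \<bar>D \<omega> $ i\<bar>) = ennreal (s * sqrt (2 / pi))"
      using one[of i] int[of i] by (subst nn_integral_eq_integral[symmetric]) auto
    then have "(LINT \<omega>|P. \<bar>D \<omega> $ i\<bar>) = s * sqrt (2 / pi)"
      using s by (simp add: ennreal_inj)
    then show ?thesis
      using mult_left_mono[OF sq, of s] s by simp
  qed
  have sum: "integrable P (\<lambda>\<omega>. \<Sum>i\<in>UNIV. \<bar>D \<omega> $ i\<bar>)" using int by auto
  show "integrable P D"
    by (rule Bochner_Integration.integrable_bound[OF sum]) (auto intro!: AE_I2 order_trans[OF norm_le_l1_cart])
  then have "(LINT \<omega>|P. norm (D \<omega>)) \<le> (LINT \<omega>|P. (\<Sum>i\<in>UNIV. \<bar>D \<omega> $ i\<bar>))"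
    using sum norm_le_l1_cart by (intro integral_mono) auto
  also have "\<dots> = (\<Sum>i\<in>UNIV. LINT \<omega>|P. \<bar>D \<omega> $ i\<bar>)"
    using int by (intro Bochner_Integration.integral_sum) auto
  also have "\<dots> \<le> (\<Sum>i\<in>(UNIV::'d set). s)"
    using le by (rule sum_mono)
  finally show "(LINT \<omega>|P. norm (D \<omega>)) \<le> real CARD('d) * s" by simp
qed

section \<open>Matrix products, vectors and pairs under the integral\<close>

lemma bounded_bilinear_matrix_vector_mult:
  "bounded_bilinear ((*v) :: real^'n^'m \<Rightarrow> real^'n \<Rightarrow> real^'m)"
  unfolding bilinear_conv_bounded_bilinear[symmetric] bilinear_def
  by (auto intro!: linearI simp: matrix_vector_mult_add_rdistrib matrix_vector_right_distrib
      scaleR_matrix_vector_assoc[symmetric] matrix_vector_mult_scaleR)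

lemma norm_vec_le_sum: "norm (x :: 'a::real_normed_vector^'n) \<le> (\<Sum>i\<in>UNIV. norm (x $ i))"
  by (simp add: norm_vec_def L2_set_le_sum)

lemma borel_measurable_vec_lambda:
  fixes f :: "'n::finite \<Rightarrow> 'a \<Rightarrow> 'b::euclidean_space"
  assumes "\<And>i. f i \<in> borel_measurable M"
  shows "(\<lambda>x. \<chi> i. f i x) \<in> borel_measurable M"
  unfolding borel_measurable_euclidean_space[where 'c = "'b^'n"]
proof
  fix b :: "'b^'n" assume "b \<in> Basis"
  then obtain i u where "b = axis i u" by (auto simp: Basis_vec_def)
  then show "(\<lambda>x. (\<chi> i. f i x) \<bullet> b) \<in> borel_measurable M"
    using assms by (simp add: inner_axis)
qed

lemma integrable_Pair:
  fixes f :: "'a \<Rightarrow> 'b::euclidean_space" and g :: "'a \<Rightarrow> 'c::euclidean_space"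
  assumes "integrable M f" "integrable M g"
  shows "integrable M (\<lambda>x. (f x, g x))"
proof (rule Bochner_Integration.integrable_bound)
  show "integrable M (\<lambda>x. norm (f x) + norm (g x))" using assms by auto
  show "AE x in M. norm (f x, g x) \<le> norm (norm (f x) + norm (g x))"
    by (intro AE_I2) (auto intro: norm_Pair_le)
qed (use assms in simp)

lemma integral_Pair:
  fixes f :: "'a \<Rightarrow> 'b::euclidean_space" and g :: "'a \<Rightarrow> 'c::euclidean_space"
  assumes "integrable M (\<lambda>x. (f x, g x))"
  shows "(LINT x|M. (f x, g x)) = (LINT x|M. f x, LINT x|M. g x)"
  using integral_bounded_linear[OF bounded_linear_fst assms] integral_bounded_linear[OF bounded_linear_snd assms]
  by (simp add: prod_eq_iff)

lemma set_integrable_Pair: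
  fixes f :: "'a \<Rightarrow> 'b::euclidean_space" and g :: "'a \<Rightarrow> 'c::euclidean_space"
  shows "set_integrable M A (\<lambda>x. (f x, g x)) \<longleftrightarrow> set_integrable M A f \<and> set_integrable M A g"
  unfolding set_integrable_def scaleR_Pair
  using integrable_Pair[of M "\<lambda>x. indicator A x *\<^sub>R f x" "\<lambda>x. indicator A x *\<^sub>R g x"]
    integrable_bounded_linear[OF bounded_linear_fst, of M "\<lambda>x. (indicator A x *\<^sub>R f x, indicator A x *\<^sub>R g x)"]
    integrable_bounded_linear[OF bounded_linear_snd, of M "\<lambda>x. (indicator A x *\<^sub>R f x, indicator A x *\<^sub>R g x)"]
  by auto

lemma set_integral_Pair:
  fixes f :: "'a \<Rightarrow> 'b::euclidean_space" and g :: "'a \<Rightarrow> 'c::euclidean_space"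
  assumes "set_integrable M A (\<lambda>x. (f x, g x))"
  shows "(LINT x:A|M. (f x, g x)) = (LINT x:A|M. f x, LINT x:A|M. g x)"
  using assms unfolding set_integrable_def set_lebesgue_integral_def scaleR_Pair by (rule integral_Pair)

lemma set_integrable_vec:
  fixes f :: "'n::finite \<Rightarrow> 'a \<Rightarrow> 'b::euclidean_space"
  shows "set_integrable M A (\<lambda>x. \<chi> i. f i x) \<longleftrightarrow> (\<forall>i. set_integrable M A (f i))"
proof -
  have eq: "(\<lambda>x. indicator A x *\<^sub>R (\<chi> i. f i x)) = (\<lambda>x. \<chi> i. indicator A x *\<^sub>R f i x)"
    by (simp add: fun_eq_iff vec_eq_iff)
  show ?thesis
    unfolding set_integrable_def eq
  proof
    assume i: "integrable M (\<lambda>x. \<chi> i. indicator A x *\<^sub>R f i x)"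
    show "\<forall>i. integrable M (\<lambda>x. indicator A x *\<^sub>R f i x)"
      using integrable_bounded_linear[OF bounded_linear_vec_nth i] by simp
  next
    assume i: "\<forall>i. integrable M (\<lambda>x. indicator A x *\<^sub>R f i x)"
    show "integrable M (\<lambda>x. \<chi> i. indicator A x *\<^sub>R f i x)"
    proof (rule Bochner_Integration.integrable_bound)
      show "integrable M (\<lambda>x. \<Sum>i\<in>UNIV. norm (indicator A x *\<^sub>R f i x))"
        using i by (intro Bochner_Integration.integrable_sum integrable_norm) auto
      show "(\<lambda>x. \<chi> i. indicator A x *\<^sub>R f i x) \<in> borel_measurable M"
        by (rule borel_measurable_vec_lambda, rule borel_measurable_integrable) (use i in blast)
      have "norm (\<chi> i. indicator A x *\<^sub>R f i x) \<le> (\<Sum>i\<in>UNIV. norm (indicator A x *\<^sub>R f i x))" for x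
        by (rule order_trans[OF norm_vec_le_sum]) simp
      then show "AE x in M. norm (\<chi> i. indicator A x *\<^sub>R f i x) \<le>
          norm (\<Sum>i\<in>UNIV. norm (indicator A x *\<^sub>R f i x))"
        unfolding real_norm_def by (intro AE_I2 order_trans[OF _ abs_ge_self])
    qed
  qed
qed

lemma set_integral_vec_nth:
  fixes f :: "'a \<Rightarrow> 'b::euclidean_space^'n"
  assumes "set_integrable M A f"
  shows "(LINT x:A|M. f x) $ i = (LINT x:A|M. f x $ i)"
  using integral_bounded_linear[OF bounded_linear_vec_nth assms[unfolded set_integrable_def], of i]
  by (simp add: set_lebesgue_integral_def)

section \<open>The controlled system\<close>

lemma L1_continuous_imp_continuous_on:
  fixes \<phi> :: "real \<Rightarrow> 'b::real_normed_vector"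
  assumes "L1_continuous P T V"
    and "\<And>s t. s \<in> {0..T} \<Longrightarrow> t \<in> {0..T} \<Longrightarrow> norm (\<phi> s - \<phi> t) \<le> K * (LINT \<omega>|P. norm (V s \<omega> - V t \<omega>))"
  shows "continuous_on {0..T} \<phi>"
  unfolding continuous_on_def
proof
  fix t assume t: "t \<in> {0..T}"
  have "((\<lambda>s. K * (LINT \<omega>|P. norm (V s \<omega> - V t \<omega>))) \<longlongrightarrow> 0) (at t within {0..T})"
    using assms(1) t by (intro tendsto_mult_right_zero) (simp add: L1_continuous_def)
  moreover have "\<forall>\<^sub>F s in at t within {0..T}. norm (\<phi> s - \<phi> t) \<le> K * (LINT \<omega>|P. norm (V s \<omega> - V t \<omega>))"
    unfolding eventually_at_filter using assms(2)[OF _ t] by (simp add: always_eventually)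
  ultimately have "((\<lambda>s. \<phi> s - \<phi> t) \<longlongrightarrow> 0) (at t within {0..T})"
    by (rule Lim_null_comparison[rotated])
  then show "(\<phi> \<longlongrightarrow> \<phi> t) (at t within {0..T})"
    by (rule LIM_zero_cancel)
qed

lemma norm_fst_le_norm: "norm (fst z) \<le> norm z" and norm_snd_le_norm: "norm (snd z) \<le> norm z"
  by (cases z; simp add: norm_fst_le norm_snd_le)+

lemma L1_continuous_fst:
  assumes "L1_continuous P T V"
  shows "L1_continuous P T (\<lambda>t \<omega>. fst (V t \<omega>))"
  unfolding L1_continuous_def
proof (intro conjI ballI)
  have V: "integrable P (V t)" if "t \<in> {0..T}" for t
    using assms that by (simp add: L1_continuous_def)
  then show int: "integrable P (\<lambda>\<omega>. fst (V t \<omega>))" if "t \<in> {0..T}" for t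
    using that integrable_bounded_linear[OF bounded_linear_fst] by blast
  fix t assume t: "t \<in> {0..T}"
  have "((\<lambda>s. LINT \<omega>|P. norm (V s \<omega> - V t \<omega>)) \<longlongrightarrow> 0) (at t within {0..T})"
    using assms t by (simp add: L1_continuous_def)
  moreover have "norm (LINT \<omega>|P. norm (fst (V s \<omega>) - fst (V t \<omega>))) \<le> (LINT \<omega>|P. norm (V s \<omega> - V t \<omega>))"
    if "s \<in> {0..T}" for s
  proof -
    have "(LINT \<omega>|P. norm (fst (V s \<omega>) - fst (V t \<omega>))) \<le> (LINT \<omega>|P. norm (V s \<omega> - V t \<omega>))"
      using V[OF t] V[OF that] int[OF t] int[OF that]
      by (intro integral_mono) (auto simp: fst_diff[symmetric] norm_fst_le_norm simp del: fst_diff)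
    then show ?thesis by simp
  qed
  then have "\<forall>\<^sub>F s in at t within {0..T}.
      norm (LINT \<omega>|P. norm (fst (V s \<omega>) - fst (V t \<omega>))) \<le> (LINT \<omega>|P. norm (V s \<omega> - V t \<omega>))"
    unfolding eventually_at_filter by (simp add: always_eventually)
  ultimately show "((\<lambda>s. LINT \<omega>|P. norm (fst (V s \<omega>) - fst (V t \<omega>))) \<longlongrightarrow> 0) (at t within {0..T})"
    by (rule Lim_null_comparison[rotated])
qed

lemma lipschitz_imp_continuous:
  fixes H :: "'a::real_normed_vector \<Rightarrow> 'b::real_normed_vector"
  assumes "0 \<le> L" "\<And>x y. norm (H x - H y) \<le> L * norm (x - y)"
  shows "continuous_on A H"
proof -
  have "L-lipschitz_on A H"
    using assms by (intro lipschitz_onI) (auto simp: dist_norm)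
  then show ?thesis by (rule lipschitz_on_continuous_on)
qed

lemma mean_const: "(1 / real CARD('m::finite)) *\<^sub>R (\<Sum>j\<in>(UNIV::'m set). c) = (c :: 'a::real_vector)"
  by (simp only: sum_constant_scaleR) simp

section \<open>Lipschitz dependence of kernels and feedback on the law\<close>

context prob_space
begin

context
  fixes H :: "'b::euclidean_space \<Rightarrow> 'b" and L :: real
  assumes L: "0 \<le> L" and H: "\<And>x y. norm (H x - H y) \<le> L * norm (x - y)"
begin

lemma integrable_lipschitz_kernel:
  assumes "integrable M \<xi>" shows "integrable M (\<lambda>\<omega>. H (x - \<xi> \<omega>))"
proof (rule Bochner_Integration.integrable_bound)
  show "integrable M (\<lambda>\<omega>. norm (H x) + L * norm (\<xi> \<omega>))" using assms by auto
  have "norm (H (x - \<xi> \<omega>)) \<le> norm (H x) + L * norm (\<xi> \<omega>)" for \<omega>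
    using H[of "x - \<xi> \<omega>" x] norm_triangle_ineq2[of "H (x - \<xi> \<omega>)" "H x"] by simp
  then show "AE \<omega> in M. norm (H (x - \<xi> \<omega>)) \<le> norm (norm (H x) + L * norm (\<xi> \<omega>))"
    unfolding real_norm_def by (intro AE_I2 order_trans[OF _ abs_ge_self])
  have "(\<lambda>\<omega>. x - \<xi> \<omega>) \<in> borel_measurable M" using assms by auto
  moreover have "H \<in> borel_measurable borel"
    using lipschitz_imp_continuous[OF L H] by (intro borel_measurable_continuous_onI)
  ultimately show "(\<lambda>\<omega>. H (x - \<xi> \<omega>)) \<in> borel_measurable M"
    by (rule measurable_compose)
qed

lemma kernel_conv_law:
  assumes "integrable M \<xi>"
  shows "kernel_conv H (law M \<xi>) x = (LINT \<omega>|M. H (x - \<xi> \<omega>))"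
  unfolding kernel_conv_def
  using assms by (intro law_integral continuous_on_compose2[OF lipschitz_imp_continuous[OF L H]])
    (auto intro!: continuous_intros)

text \<open>With both laws realised on one probability space the convolutions are means of H (x -
  \<xi>), and the Lipschitz bound of H is applied under the integral.\<close>

lemma kernel_conv_law_lipschitz:
  assumes "integrable M \<xi>" "integrable M \<xi>'"
  shows "norm (kernel_conv H (law M \<xi>) x - kernel_conv H (law M \<xi>') x') \<le>
    L * (norm (x - x') + (LINT \<omega>|M. norm (\<xi> \<omega> - \<xi>' \<omega>)))"
proof -
  have "norm (kernel_conv H (law M \<xi>) x - kernel_conv H (law M \<xi>') x') =
      norm (LINT \<omega>|M. H (x - \<xi> \<omega>) - H (x' - \<xi>' \<omega>))"
    using assms by (simp add: kernel_conv_law integrable_lipschitz_kernel)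
  also have "\<dots> \<le> (LINT \<omega>|M. norm (H (x - \<xi> \<omega>) - H (x' - \<xi>' \<omega>)))"
    by (rule integral_norm_bound)
  also have "\<dots> \<le> (LINT \<omega>|M. L * (norm (x - x') + norm (\<xi> \<omega> - \<xi>' \<omega>)))"
  proof (rule integral_mono)
    show "integrable M (\<lambda>\<omega>. norm (H (x - \<xi> \<omega>) - H (x' - \<xi>' \<omega>)))"
      using assms by (intro integrable_norm Bochner_Integration.integrable_diff integrable_lipschitz_kernel)
    show "integrable M (\<lambda>\<omega>. L * (norm (x - x') + norm (\<xi> \<omega> - \<xi>' \<omega>)))"
      using assms by auto
    fix \<omega>
    have "norm (x - \<xi> \<omega> - (x' - \<xi>' \<omega>)) \<le> norm (x - x') + norm (\<xi> \<omega> - \<xi>' \<omega>)"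
      using norm_triangle_ineq4[of "x - x'" "\<xi> \<omega> - \<xi>' \<omega>"] by (simp add: algebra_simps)
    from mult_left_mono[OF this L] H[of "x - \<xi> \<omega>" "x' - \<xi>' \<omega>"]
    show "norm (H (x - \<xi> \<omega>) - H (x' - \<xi>' \<omega>)) \<le> L * (norm (x - x') + norm (\<xi> \<omega> - \<xi>' \<omega>))"
      by linarith
  qed
  also have "\<dots> = L * (norm (x - x') + (LINT \<omega>|M. norm (\<xi> \<omega> - \<xi>' \<omega>)))"
    using assms by (simp add: prob_space)
  finally show ?thesis .
qed

lemma mean_kernel_lipschitz:
  fixes u u' :: "'m::finite \<Rightarrow> 'b"
  assumes "\<And>j. norm (u j - u' j) \<le> r"
  shows "norm ((1 / real CARD('m)) *\<^sub>R (\<Sum>j\<in>UNIV. H (u j)) - (1 / real CARD('m)) *\<^sub>R (\<Sum>j\<in>UNIV. H (u' j))) \<le> L * r"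
proof -
  have "norm (\<Sum>j\<in>UNIV. H (u j) - H (u' j)) \<le> (\<Sum>j\<in>(UNIV::'m set). L * r)"
    by (intro sum_norm_le order_trans[OF H] mult_left_mono assms L)
  also have "\<dots> = real CARD('m) * (L * r)" by simp
  finally have "norm (\<Sum>j\<in>UNIV. H (u j) - H (u' j)) \<le> real CARD('m) * (L * r)" .
  then have "(1 / real CARD('m)) * norm (\<Sum>j\<in>UNIV. H (u j) - H (u' j)) \<le> L * r"
    by (simp add: field_simps)
  then show ?thesis
    by (simp add: scaleR_diff_right[symmetric] sum_subtractf[symmetric] del: scaleR_diff_right)
qed

end

lemma feedback_law_lipschitz:
  assumes "g \<in> feedback_maps Mb Lb" "integrable M \<xi>" "integrable M \<xi>'" "0 \<le> Lb"
  shows "norm (g (law M \<xi>) - g (law M \<xi>')) \<le> Lb * (LINT \<omega>|M. norm (\<xi> \<omega> - \<xi>' \<omega>))"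
proof -
  have "dist (g (law M \<xi>)) (g (law M \<xi>')) \<le> Lb * wasserstein_dist 1 (law M \<xi>) (law M \<xi>')"
    using assms(1-3) law_in_wasserstein_space unfolding feedback_maps_def by blast
  also have "\<dots> \<le> Lb * (LINT \<omega>|M. norm (\<xi> \<omega> - \<xi>' \<omega>))"
    using assms by (intro mult_left_mono wasserstein_dist_law_le)
  finally show ?thesis by (simp add: dist_norm)
qed

end

section \<open>The controlled system and its uniform constants\<close>

text \<open>L is a common Lipschitz constant of the four kernels and KU bounds the matrices in U as
  operators. They are parameters because the bounds on the states are explicit expressions in them.
  The topology of U and the cost enter only in \<open>optimal_control\<close>.\<close>

locale control_problem = prob_space P
  for P :: "'w measure" +
  fixes Fl :: "real \<Rightarrow> 'w measure" and W :: "real \<Rightarrow> 'w \<Rightarrow> real^'d"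
    and T \<sigma> Mb Lb L KU :: real
    and H1 H2 K1 K2 :: "real^'d \<Rightarrow> real^'d"
    and X0 :: "'w \<Rightarrow> real^'d" and Y0 :: "(real^'d)^'m" and U :: "(real^'l^'d) set"
  assumes T: "0 < T" and Mb: "0 \<le> Mb" and Lb: "0 \<le> Lb" and L: "0 \<le> L" and KU: "0 \<le> KU"
    and filt: "filtered_prob_space P Fl" and bm: "brownian_motion P Fl T W" and sigma: "0 \<le> \<sigma>"
    and H1: "\<And>x y. norm (H1 x - H1 y) \<le> L * norm (x - y)"
    and H2: "\<And>x y. norm (H2 x - H2 y) \<le> L * norm (x - y)"
    and K1: "\<And>x y. norm (K1 x - K1 y) \<le> L * norm (x - y)"
    and K2: "\<And>x y. norm (K2 x - K2 y) \<le> L * norm (x - y)"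
    and X0: "X0 \<in> borel_measurable (Fl 0)" "integrable P X0"
    and KU_bound: "\<And>A x. A \<in> U \<Longrightarrow> norm (A *v x) \<le> KU * norm x"
begin

text \<open>The drift-free follower. W 0 is subtracted because it vanishes only almost everywhere,
  whereas the value at time 0 is to be X0 on every path.\<close>

definition free :: "real \<Rightarrow> 'w \<Rightarrow> real^'d" where
  "free t \<omega> = X0 \<omega> + sqrt (2 * \<sigma>) *\<^sub>R (W t \<omega> - W 0 \<omega>)"

text \<open>Representatives of controls that are Borel and U-valued at every time.
  \<open>regular_representative\<close> provides them; \<open>mv_cong\<close> and
  \<open>optimal_value_eq\<close> show that solutions and values do not notice the change.\<close>

abbreviation regular :: "('m \<Rightarrow> real \<Rightarrow> real^'l^'d) \<Rightarrow> bool" where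
  "regular h \<equiv> \<forall>i. h i \<in> borel_measurable borel \<and> (\<forall>s. h i s \<in> U)"

text \<open>The leaders are carried as random variables, which turns the system into a single
  equation on the product space. Only the law of the first component enters the drift.\<close>

definition joint_drift ::
  "('m \<Rightarrow> real \<Rightarrow> real^'l^'d) \<Rightarrow> ('m \<Rightarrow> (real^'d) measure \<Rightarrow> real^'l) \<Rightarrow>
   real \<Rightarrow> ('w \<Rightarrow> (real^'d) \<times> ((real^'d)^'m)) \<Rightarrow> (real^'d) \<times> ((real^'d)^'m) \<Rightarrow> (real^'d) \<times> ((real^'d)^'m)" where
  "joint_drift h g s \<xi> v =
    (follower_drift H1 K1 (law P (\<lambda>\<omega>. fst (\<xi> \<omega>))) (snd v) (fst v),
     \<chi> i. leader_drift H2 K2 (law P (\<lambda>\<omega>. fst (\<xi> \<omega>))) (snd v) i + h i s *v g i (law P (\<lambda>\<omega>. fst (\<xi> \<omega>))))"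

text \<open>In the follower's drift x occurs in H1 and K1 and y occurs in K1, which gives 3 * L
  together with the mean. Each leader contributes 3 * L + KU * Lb, and the norm of the vector of
  leaders is bounded by the sum of the norms of its components.\<close>

definition drift_lip :: real where
  "drift_lip = 3 * L + real CARD('m) * (3 * L + KU * Lb)"

definition drift_zero :: real where
  "drift_zero = norm (H1 0) + norm (K1 0) + real CARD('m) * (norm (K2 0) + norm (H2 0) + KU * Mb)"

definition noise_const :: real where
  "noise_const = sqrt (2 * \<sigma>) * real CARD('d)"

definition free_bound :: real where
  "free_bound = (LINT \<omega>|P. norm (X0 \<omega>)) + noise_const * sqrt T"

lemma drift_lip_nonneg: "0 \<le> drift_lip"
  unfolding drift_lip_def using L KU Lb by auto

lemma drift_zero_nonneg: "0 \<le> drift_zero"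
  unfolding drift_zero_def using KU Mb by auto

lemmas Fl_measurable_P = filtered_measurable[OF filt]
lemmas Fl_mono = filtered_measurable_mono[OF filt]

lemma free_adapted: "t \<in> {0..T} \<Longrightarrow> free t \<in> borel_measurable (Fl t)"
proof -
  assume t: "t \<in> {0..T}"
  have [measurable]: "W t \<in> borel_measurable (Fl t)" "W 0 \<in> borel_measurable (Fl t)" "X0 \<in> borel_measurable (Fl t)"
    using bm t T Fl_mono[of "W 0" 0 t] Fl_mono[of X0 0 t] X0
    by (auto simp: brownian_motion_def dest: bspec[of _ _ 0])
  show ?thesis unfolding free_def[abs_def] by measurable
qed

lemma free_cont: "\<omega> \<in> space P \<Longrightarrow> continuous_on {0..T} (\<lambda>t. free t \<omega>)"
  unfolding free_def using bm by (intro continuous_intros) (auto simp: brownian_motion_def)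

lemma noise_increment:
  assumes "0 \<le> s" "s \<le> t" "t \<le> T"
  shows "integrable P (\<lambda>\<omega>. W t \<omega> - W s \<omega>)"
    and "(LINT \<omega>|P. norm (W t \<omega> - W s \<omega>)) \<le> real CARD('d) * sqrt (t - s)"
proof -
  have "integrable P (\<lambda>\<omega>. W t \<omega> - W s \<omega>) \<and> (LINT \<omega>|P. norm (W t \<omega> - W s \<omega>)) \<le> real CARD('d) * sqrt (t - s)"
  proof (cases "s = t")
    case False
    then have "distributed P lborel (\<lambda>\<omega>. W t \<omega> - W s \<omega>)
          (\<lambda>x. ennreal (\<Prod>i\<in>UNIV. normal_density 0 (sqrt (t - s)) (x $ i)))"
      using bm assms unfolding brownian_motion_def by simp
    then show ?thesis
      using gaussian_increment_L1[of P "\<lambda>\<omega>. W t \<omega> - W s \<omega>" "sqrt (t - s)"] assms False by auto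
  qed simp
  then show "integrable P (\<lambda>\<omega>. W t \<omega> - W s \<omega>)"
    "(LINT \<omega>|P. norm (W t \<omega> - W s \<omega>)) \<le> real CARD('d) * sqrt (t - s)" by auto
qed

lemma free_integrable:
  assumes "t \<in> {0..T}" shows "integrable P (free t)"
  unfolding free_def[abs_def] using noise_increment(1)[of 0 t] X0 assms by auto

lemma free_modulus:
  assumes "s \<in> {0..T}" "t \<in> {0..T}"
  shows "(LINT \<omega>|P. norm (free t \<omega> - free s \<omega>)) \<le> noise_const * sqrt \<bar>t - s\<bar>"
  using assms
proof (induction s t rule: linorder_wlog)
  case (le s t)
  have "(LINT \<omega>|P. norm (free t \<omega> - free s \<omega>)) = (LINT \<omega>|P. sqrt (2 * \<sigma>) * norm (W t \<omega> - W s \<omega>))"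
  proof (rule Bochner_Integration.integral_cong[OF refl])
    fix \<omega>
    have "free t \<omega> - free s \<omega> = sqrt (2 * \<sigma>) *\<^sub>R (W t \<omega> - W s \<omega>)"
      by (simp add: free_def algebra_simps)
    then show "norm (free t \<omega> - free s \<omega>) = sqrt (2 * \<sigma>) * norm (W t \<omega> - W s \<omega>)"
      using sigma by simp
  qed
  also have "\<dots> = sqrt (2 * \<sigma>) * (LINT \<omega>|P. norm (W t \<omega> - W s \<omega>))" by simp
  also have "\<dots> \<le> sqrt (2 * \<sigma>) * (real CARD('d) * sqrt (t - s))"
    using noise_increment(2)[of s t] le sigma by (intro mult_left_mono) auto
  finally show ?case using le(1) by (simp add: noise_const_def mult.assoc)
qed (simp add: norm_minus_commute abs_minus_commute)

lemma noise_const_nonneg: "0 \<le> noise_const"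
  unfolding noise_const_def using sigma by simp

lemma free_mean:
  assumes "t \<in> {0..T}" shows "(LINT \<omega>|P. norm (free t \<omega>)) \<le> free_bound"
proof -
  have 0: "0 \<in> {0..T}" using T by simp
  have "(LINT \<omega>|P. norm (free t \<omega>)) \<le> (LINT \<omega>|P. norm (X0 \<omega>) + norm (free t \<omega> - free 0 \<omega>))"
  proof (rule integral_mono)
    show "norm (free t \<omega>) \<le> norm (X0 \<omega>) + norm (free t \<omega> - free 0 \<omega>)" for \<omega>
      using norm_triangle_ineq[of "X0 \<omega>" "free t \<omega> - free 0 \<omega>"] by (simp add: free_def)
  qed (use free_integrable[OF assms] free_integrable[OF 0] X0 in auto)
  also have "\<dots> = (LINT \<omega>|P. norm (X0 \<omega>)) + (LINT \<omega>|P. norm (free t \<omega> - free 0 \<omega>))"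
    using free_integrable[OF assms] free_integrable[OF 0] X0 by simp
  also have "\<dots> \<le> free_bound"
    unfolding free_bound_def
    using order_trans[OF free_modulus[OF 0 assms] mult_left_mono[of "sqrt \<bar>t - 0\<bar>" "sqrt T", OF _ noise_const_nonneg]] assms
    by auto
  finally show ?thesis .
qed

lemma free_L1: "L1_continuous P T free"
  unfolding L1_continuous_def
proof (intro conjI ballI free_integrable)
  fix t assume t: "t \<in> {0..T}"
  have "((\<lambda>s. noise_const * sqrt \<bar>s - t\<bar>) \<longlongrightarrow> noise_const * sqrt \<bar>t - t\<bar>) (at t within {0..T})"
    by (intro tendsto_intros)
  then have *: "((\<lambda>s. noise_const * sqrt \<bar>s - t\<bar>) \<longlongrightarrow> 0) (at t within {0..T})" by simp
  show "((\<lambda>s. LINT \<omega>|P. norm (free s \<omega> - free t \<omega>)) \<longlongrightarrow> 0) (at t within {0..T})"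
    by (rule Lim_null_comparison[OF _ *])
      (use free_modulus[OF t] in \<open>auto simp: eventually_at_filter intro!: always_eventually\<close>)
qed

lemma follower_drift_lipschitz:
  assumes "integrable P \<xi>" "integrable P \<xi>'"
  shows "norm (follower_drift H1 K1 (law P \<xi>) y x - follower_drift H1 K1 (law P \<xi>') (y' :: (real^'d)^'m) x') \<le>
    L * (2 * norm (x - x') + norm (y - y') + (LINT \<omega>|P. norm (\<xi> \<omega> - \<xi>' \<omega>)))"
proof -
  have "norm (y $ j - x - (y' $ j - x')) \<le> norm (y - y') + norm (x - x')" for j
    using norm_triangle_ineq4[of "y $ j - y' $ j" "x - x'"] Finite_Cartesian_Product.norm_nth_le[of "y - y'" j]
    by (simp add: algebra_simps)
  from mean_kernel_lipschitz[of L K1 "\<lambda>j. y $ j - x" "\<lambda>j. y' $ j - x'", OF L K1 this]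
    kernel_conv_law_lipschitz[OF L H1 assms, of x x']
  show ?thesis
    unfolding follower_drift_def
    by (intro order_trans[OF norm_diff_triangle_ineq]) (simp add: algebra_simps)
qed

lemma leader_drift_lipschitz:
  assumes "integrable P \<xi>" "integrable P \<xi>'"
  shows "norm (leader_drift H2 K2 (law P \<xi>) y i - leader_drift H2 K2 (law P \<xi>') (y' :: (real^'d)^'m) i) \<le>
    L * (3 * norm (y - y') + (LINT \<omega>|P. norm (\<xi> \<omega> - \<xi>' \<omega>)))"
proof -
  have n: "norm (y $ j - y' $ j) \<le> norm (y - y')" for j
    using Finite_Cartesian_Product.norm_nth_le[of "y - y'" j] by simp
  have "norm (y $ j - y $ i - (y' $ j - y' $ i)) \<le> 2 * norm (y - y')" for j
    using norm_triangle_ineq4[of "y $ j - y' $ j" "y $ i - y' $ i"] n[of i] n[of j]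
    by (simp add: algebra_simps)
  from mean_kernel_lipschitz[of L H2 "\<lambda>j. y $ j - y $ i" "\<lambda>j. y' $ j - y' $ i", OF L H2 this]
    kernel_conv_law_lipschitz[OF L K2 assms, of "y $ i" "y' $ i"] mult_left_mono[OF n[of i] L]
  show ?thesis
    unfolding leader_drift_def
    by (intro order_trans[OF norm_diff_triangle_ineq]) (simp add: algebra_simps)
qed

lemma joint_drift_lipschitz:
  assumes h: "regular h" and g: "\<And>i. g i \<in> feedback_maps Mb Lb"
    and \<xi>: "integrable P \<xi>" "integrable P \<xi>'"
  shows "norm (joint_drift h g t \<xi> v - joint_drift h g t \<xi>' v') \<le>
    drift_lip * (norm (v - v') + (LINT \<omega>|P. norm (\<xi> \<omega> - \<xi>' \<omega>)))"
proof -
  define e where "e = (LINT \<omega>|P. norm (fst (\<xi> \<omega>) - fst (\<xi>' \<omega>)))"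
  define E where "E = (LINT \<omega>|P. norm (\<xi> \<omega> - \<xi>' \<omega>))"
  let ?N = "norm (v - v') + E"
  have i: "integrable P (\<lambda>\<omega>. fst (\<xi> \<omega>))" "integrable P (\<lambda>\<omega>. fst (\<xi>' \<omega>))"
    using integrable_bounded_linear[OF bounded_linear_fst] \<xi> by blast+
  have eE: "e \<le> E"
    unfolding e_def E_def using i \<xi>
    by (intro integral_mono) (auto simp: fst_diff[symmetric] norm_fst_le_norm simp del: fst_diff)
  have e0: "0 \<le> e" unfolding e_def by simp
  have x: "norm (fst v - fst v') \<le> norm (v - v')" and y: "norm (snd v - snd v') \<le> norm (v - v')"
    using norm_fst_le_norm[of "v - v'"] norm_snd_le_norm[of "v - v'"] by simp_all
  have 1: "norm (fst (joint_drift h g t \<xi> v - joint_drift h g t \<xi>' v')) \<le> 3 * L * ?N"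
  proof -
    have "norm (fst (joint_drift h g t \<xi> v - joint_drift h g t \<xi>' v')) \<le>
        L * (2 * norm (fst v - fst v') + norm (snd v - snd v') + e)"
      using follower_drift_lipschitz[OF i] by (simp add: joint_drift_def e_def)
    also have "\<dots> \<le> L * (3 * ?N)"
      using x y eE e0 by (intro mult_left_mono L) argo
    finally show ?thesis by (simp only: ac_simps)
  qed
  have 2: "norm (snd (joint_drift h g t \<xi> v - joint_drift h g t \<xi>' v') $ j) \<le> (3 * L + KU * Lb) * ?N" for j
  proof -
    let ?l = "\<lambda>\<xi> v. leader_drift H2 K2 (law P (\<lambda>\<omega>. fst (\<xi> \<omega>))) (snd v) j"
    let ?c = "\<lambda>\<xi>. h j t *v g j (law P (\<lambda>\<omega>. fst (\<xi> \<omega>)))"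
    have "norm (?l \<xi> v - ?l \<xi>' v') \<le> L * (3 * norm (snd v - snd v') + e)"
      unfolding e_def by (rule leader_drift_lipschitz[OF i])
    also have "\<dots> \<le> L * (3 * ?N)"
      using y eE e0 by (intro mult_left_mono L) argo
    finally have l: "norm (?l \<xi> v - ?l \<xi>' v') \<le> 3 * L * ?N" by (simp only: ac_simps)
    have "norm (?c \<xi> - ?c \<xi>') = norm (h j t *v (g j (law P (\<lambda>\<omega>. fst (\<xi> \<omega>))) - g j (law P (\<lambda>\<omega>. fst (\<xi>' \<omega>)))))"
      by (simp add: matrix_vector_mult_diff_distrib)
    also have "\<dots> \<le> KU * (Lb * e)"
      unfolding e_def using h feedback_law_lipschitz[OF g i Lb]
      by (intro order_trans[OF KU_bound] mult_left_mono KU) auto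
    also have "\<dots> \<le> KU * (Lb * ?N)"
      using eE KU Lb by (intro mult_left_mono) (auto intro: add_increasing)
    finally have c: "norm (?c \<xi> - ?c \<xi>') \<le> KU * Lb * ?N" by (simp only: ac_simps)
    have "norm (snd (joint_drift h g t \<xi> v - joint_drift h g t \<xi>' v') $ j) \<le> norm (?l \<xi> v - ?l \<xi>' v') + norm (?c \<xi> - ?c \<xi>')"
      unfolding joint_drift_def by (simp add: norm_diff_triangle_ineq)
    also have "\<dots> \<le> (3 * L + KU * Lb) * ?N"
      using l c by (simp only: distrib_right)
    finally show ?thesis .
  qed
  have "norm (snd (joint_drift h g t \<xi> v - joint_drift h g t \<xi>' v')) \<le> (\<Sum>j\<in>(UNIV::'m set). (3 * L + KU * Lb) * ?N)"
    by (rule order_trans[OF norm_vec_le_sum]) (rule sum_mono[OF 2])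
  then have "norm (snd (joint_drift h g t \<xi> v - joint_drift h g t \<xi>' v')) \<le> real CARD('m) * ((3 * L + KU * Lb) * ?N)"
    by simp
  then have "norm (joint_drift h g t \<xi> v - joint_drift h g t \<xi>' v') \<le> 3 * L * ?N + real CARD('m) * ((3 * L + KU * Lb) * ?N)"
    using 1 norm_Pair_le[of "fst (joint_drift h g t \<xi> v - joint_drift h g t \<xi>' v')"
      "snd (joint_drift h g t \<xi> v - joint_drift h g t \<xi>' v')"] by (simp only: prod.collapse)
  then show ?thesis
    unfolding drift_lip_def E_def by (simp only: distrib_right mult.assoc)
qed

lemma kernel_conv_law_0: "continuous_on UNIV H \<Longrightarrow> kernel_conv H (law P (\<lambda>_. 0)) x = H x"
  unfolding kernel_conv_def
  by (subst law_integral) (auto simp: prob_space intro!: continuous_on_compose2[of UNIV H] continuous_intros)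

lemma follower_drift_zero:
  "norm (follower_drift H1 K1 (law P (\<lambda>_. 0)) (0 :: (real^'d)^'m) 0) \<le> norm (H1 0) + norm (K1 0)"
  unfolding follower_drift_def kernel_conv_law_0[OF lipschitz_imp_continuous[OF L H1]]
  by (rule order_trans[OF norm_triangle_ineq]) (simp add: mean_const del: sum_constant)

lemma joint_drift_zero:
  assumes h: "regular h" and g: "\<And>i. g i \<in> feedback_maps Mb Lb"
  shows "norm (joint_drift h g t (\<lambda>_. 0) 0) \<le> drift_zero"
proof -
  have law0: "law P (\<lambda>_. 0 :: real^'d) \<in> wasserstein_space 1"
    by (rule law_in_wasserstein_space) simp
  have c: "norm (h j t *v g j (law P (\<lambda>_. 0))) \<le> KU * Mb" for j
    using h g[of j] law0 by (intro order_trans[OF KU_bound] mult_left_mono KU) (auto simp: feedback_maps_def)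
  have y: "norm (leader_drift H2 K2 (law P (\<lambda>_. 0)) (0 :: (real^'d)^'m) j) \<le> norm (K2 0) + norm (H2 0)" for j
    unfolding leader_drift_def kernel_conv_law_0[OF lipschitz_imp_continuous[OF L K2]]
    by (rule order_trans[OF norm_triangle_ineq]) (simp add: mean_const del: sum_constant)
  have "norm (snd (joint_drift h g t (\<lambda>_. 0) 0)) \<le> (\<Sum>j\<in>(UNIV::'m set). norm (K2 0) + norm (H2 0) + KU * Mb)"
    by (rule order_trans[OF norm_vec_le_sum], rule sum_mono)
      (use order_trans[OF norm_triangle_ineq add_mono[OF y c]] in \<open>simp add: joint_drift_def\<close>)
  then show ?thesis
    using follower_drift_zero norm_Pair_le[of "fst (joint_drift h g t (\<lambda>_. 0) 0)" "snd (joint_drift h g t (\<lambda>_. 0) 0)"]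
    unfolding drift_zero_def by (simp add: joint_drift_def)
qed

end

lemma borel_measurable_matrix_vector_mult:
  fixes A :: "'a \<Rightarrow> real^'n^'m" and x :: "'a \<Rightarrow> real^'n"
  assumes "A \<in> borel_measurable M" "x \<in> borel_measurable M"
  shows "(\<lambda>s. A s *v x s) \<in> borel_measurable M"
  using assms
  by (rule borel_measurable_continuous_Pair)
    (intro bounded_bilinear.continuous_on[OF bounded_bilinear_matrix_vector_mult] continuous_intros)

lemma continuous_on_vec_componentwise:
  fixes f :: "real \<Rightarrow> 'a::euclidean_space^'n"
  assumes "\<And>i. continuous_on S (\<lambda>t. f t $ i)"
  shows "continuous_on S f"
  using assms unfolding continuous_on_def by (auto intro: vec_tendstoI)

lemma continuous_on_bounded_interval:
  fixes f :: "real \<Rightarrow> 'a::real_normed_vector"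
  assumes "continuous_on {a..b} f"
  obtains K where "0 \<le> K" "\<And>t. t \<in> {a..b} \<Longrightarrow> norm (f t) \<le> K"
proof -
  have "bounded (f ` {a..b})"
    using assms by (intro compact_imp_bounded compact_continuous_image) auto
  then obtain K where "\<forall>t\<in>{a..b}. norm (f t) \<le> K" by (auto simp: bounded_iff)
  then show thesis by (intro that[of "max 0 K"]) (auto simp: max.coboundedI2)
qed

section \<open>The three instances of the abstract equation\<close>

context control_problem
begin

lemma follower_drift_continuous:
  assumes X: "L1_continuous P T X" and Y: "continuous_on {0..T} (Y :: real \<Rightarrow> (real^'d)^'m)"
  shows "continuous_on {0..T} (\<lambda>s. follower_drift H1 K1 (law P (X s)) (Y s) x)"
proof -
  have "continuous_on {0..T} (\<lambda>s. kernel_conv H1 (law P (X s)) x)"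
    using X
  proof (rule L1_continuous_imp_continuous_on)
    show "norm (kernel_conv H1 (law P (X s)) x - kernel_conv H1 (law P (X t)) x) \<le> L * (LINT \<omega>|P. norm (X s \<omega> - X t \<omega>))"
      if "s \<in> {0..T}" "t \<in> {0..T}" for s t
      using kernel_conv_law_lipschitz[OF L H1, of "X s" "X t" x x] X that by (simp add: L1_continuous_def)
  qed
  then show ?thesis
    unfolding follower_drift_def using Y
    by (intro continuous_intros continuous_on_compose2[OF lipschitz_imp_continuous[OF L K1, of UNIV]]) auto
qed

text \<open>The instance for the limit equation. Its field b arises as a pointwise limit, and only
  afterwards is it recognised as the drift generated by the law of the solution.\<close>

lemma decoupled:
  assumes b: "\<And>t x x'. t \<in> {0..T} \<Longrightarrow> norm (b t x - b t x') \<le> K * norm (x - x')"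
    "\<And>t. t \<in> {0..T} \<Longrightarrow> norm (b t 0) \<le> B"
    and cont: "\<And>x. continuous_on {0..T} (\<lambda>t. b t x)" and K: "0 \<le> K" and B: "0 \<le> B"
  shows "mckean_vlasov P Fl T free (\<lambda>t \<xi>. b t) K B free_bound"
proof unfold_locales
  show "(\<lambda>s. indicator {0..T} s *\<^sub>R b s v) \<in> borel_measurable lborel" for v
    using borel_measurable_continuous_on_indicator[OF _ cont] by simp
  fix t :: real and \<xi> \<xi>' :: "'w \<Rightarrow> real^'d" and v v'
  assume "t \<in> {0..T}"
  then show "norm (b t v - b t v') \<le> K * (norm (v - v') + (LINT \<omega>|P. norm (\<xi> \<omega> - \<xi>' \<omega>)))"
    using b(1)[of t v v'] K by (simp add: distrib_left add_increasing2)
qed (use filt T K B b(2) free_adapted free_cont free_L1 free_mean in auto)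

text \<open>Made for \<open>mv_L1_continuous\<close>: for an arbitrary solution the leaders' path is
  continuous and can be frozen. The remaining equation contains no control, so this works before
  anything is known about the measurability of controls.\<close>

lemma follower_given_leaders:
  fixes Y :: "real \<Rightarrow> (real^'d)^'m"
  assumes Y: "continuous_on {0..T} Y"
  obtains B where "mckean_vlasov P Fl T free (\<lambda>t \<xi>. follower_drift H1 K1 (law P \<xi>) (Y t)) (2 * L) B free_bound"
proof -
  obtain K where K: "0 \<le> K" "\<And>t. t \<in> {0..T} \<Longrightarrow> norm (Y t) \<le> K"
    using continuous_on_bounded_interval[OF Y] by blast
  let ?F = "\<lambda>t \<xi>. follower_drift H1 K1 (law P \<xi>) (Y t)"
  have "mckean_vlasov P Fl T free ?F (2 * L) (norm (H1 0) + norm (K1 0) + L * K) free_bound"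
  proof unfold_locales
    fix V :: "real \<Rightarrow> 'w \<Rightarrow> real^'d" and v assume V: "L1_continuous P T V"
    from follower_drift_continuous[OF V Y]
    show "(\<lambda>s. indicator {0..T} s *\<^sub>R follower_drift H1 K1 (law P (V s)) (Y s) v) \<in> borel_measurable lborel"
      using borel_measurable_continuous_on_indicator[of "{0..T}"] by fastforce
  next
    fix t v v' and \<xi> \<xi>' :: "'w \<Rightarrow> real^'d" assume "t \<in> {0..T}" and i: "integrable P \<xi>" "integrable P \<xi>'"
    have nn: "0 \<le> (LINT \<omega>|P. norm (\<xi> \<omega> - \<xi>' \<omega>))" by simp
    show "norm (follower_drift H1 K1 (law P \<xi>) (Y t) v - follower_drift H1 K1 (law P \<xi>') (Y t) v') \<le>
        2 * L * (norm (v - v') + (LINT \<omega>|P. norm (\<xi> \<omega> - \<xi>' \<omega>)))"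
      using mult_nonneg_nonneg[OF L nn] follower_drift_lipschitz[OF i, of "Y t" v "Y t" v']
      by (simp add: algebra_simps)
  next
    fix t assume t: "t \<in> {0..T}"
    have "norm (follower_drift H1 K1 (law P (\<lambda>_. 0)) (Y t) 0 - follower_drift H1 K1 (law P (\<lambda>_. 0)) (0 :: (real^'d)^'m) 0) \<le> L * norm (Y t)"
      using follower_drift_lipschitz[of "\<lambda>_. 0" "\<lambda>_. 0" "Y t" 0 0 0] by simp
    also have "\<dots> \<le> L * K" by (rule mult_left_mono[OF K(2)[OF t] L])
    finally show "norm (follower_drift H1 K1 (law P (\<lambda>_. 0)) (Y t) 0) \<le> norm (H1 0) + norm (K1 0) + L * K"
      using follower_drift_zero
        norm_triangle_ineq2[of "follower_drift H1 K1 (law P (\<lambda>_. 0)) (Y t) 0" "follower_drift H1 K1 (law P (\<lambda>_. 0)) (0 :: (real^'d)^'m) 0"]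
      by linarith
  qed (use filt T K L free_adapted free_cont free_L1 free_mean in auto)
  then show thesis by (rule that)
qed

definition joint_free :: "real \<Rightarrow> 'w \<Rightarrow> (real^'d) \<times> ((real^'d)^'m)" where
  "joint_free t \<omega> = (free t \<omega>, Y0)"

lemma joint_free_diff: "norm (joint_free t \<omega> - joint_free s \<omega>) = norm (free t \<omega> - free s \<omega>)"
  by (simp add: joint_free_def norm_Pair)

lemma joint_free_L1: "L1_continuous P T joint_free"
  using free_L1 free_integrable
  by (simp add: L1_continuous_def joint_free_diff) (simp add: joint_free_def[abs_def] integrable_Pair)

lemma joint_free_mean:
  assumes "t \<in> {0..T}" shows "(LINT \<omega>|P. norm (joint_free t \<omega>)) \<le> free_bound + norm Y0"
proof -
  have "(LINT \<omega>|P. norm (joint_free t \<omega>)) \<le> (LINT \<omega>|P. norm (free t \<omega>) + norm Y0)"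
  proof (rule integral_mono)
    show "integrable P (\<lambda>\<omega>. norm (joint_free t \<omega>))"
      using joint_free_L1 assms by (simp add: L1_continuous_def)
  qed (use free_integrable[OF assms] in \<open>auto simp: joint_free_def norm_Pair_le\<close>)
  also have "\<dots> = (LINT \<omega>|P. norm (free t \<omega>)) + norm Y0"
    using free_integrable[OF assms] by (simp add: prob_space)
  finally show ?thesis using free_mean[OF assms] by linarith
qed

lemma feedback_continuous:
  assumes "g \<in> feedback_maps Mb Lb" "L1_continuous P T X"
  shows "continuous_on {0..T} (\<lambda>s. g (law P (X s)))"
  using assms(2)
proof (rule L1_continuous_imp_continuous_on)
  show "norm (g (law P (X s)) - g (law P (X t))) \<le> Lb * (LINT \<omega>|P. norm (X s \<omega> - X t \<omega>))"
    if "s \<in> {0..T}" "t \<in> {0..T}" for s t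
    using feedback_law_lipschitz[OF assms(1) _ _ Lb] assms(2) that by (auto simp: L1_continuous_def)
qed

lemma leader_drift_continuous:
  assumes X: "L1_continuous P T X" and Y: "continuous_on {0..T} (Y :: real \<Rightarrow> (real^'d)^'m)"
  shows "continuous_on {0..T} (\<lambda>s. leader_drift H2 K2 (law P (X s)) (Y s) i)"
  unfolding continuous_on_def
proof
  fix t assume t: "t \<in> {0..T}"
  have lim: "((\<lambda>s. L * (3 * norm (Y s - Y t) + (LINT \<omega>|P. norm (X s \<omega> - X t \<omega>)))) \<longlongrightarrow>
      L * (3 * norm (Y t - Y t) + 0)) (at t within {0..T})"
    using Y X t by (intro tendsto_intros) (auto simp: continuous_on_def L1_continuous_def)
  have "((\<lambda>s. leader_drift H2 K2 (law P (X s)) (Y s) i - leader_drift H2 K2 (law P (X t)) (Y t) i) \<longlongrightarrow> 0)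
      (at t within {0..T})"
  proof (rule Lim_null_comparison)
    show "\<forall>\<^sub>F s in at t within {0..T}.
      norm (leader_drift H2 K2 (law P (X s)) (Y s) i - leader_drift H2 K2 (law P (X t)) (Y t) i) \<le>
        L * (3 * norm (Y s - Y t) + (LINT \<omega>|P. norm (X s \<omega> - X t \<omega>)))"
      unfolding eventually_at_filter
      using leader_drift_lipschitz X t by (intro always_eventually) (auto simp: L1_continuous_def)
  qed (use lim in simp)
  then show "((\<lambda>s. leader_drift H2 K2 (law P (X s)) (Y s) i) \<longlongrightarrow> leader_drift H2 K2 (law P (X t)) (Y t) i)
      (at t within {0..T})"
    by (rule LIM_zero_cancel)
qed

lemma joint_mckean_vlasov:
  assumes h: "regular h" and g: "\<And>i. g i \<in> feedback_maps Mb Lb"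
  shows "mckean_vlasov P Fl T joint_free (joint_drift h g) drift_lip drift_zero (free_bound + norm Y0)"
proof unfold_locales
  fix V :: "real \<Rightarrow> 'w \<Rightarrow> (real^'d) \<times> ((real^'d)^'m)" and v :: "(real^'d) \<times> ((real^'d)^'m)"
  assume "L1_continuous P T V"
  from L1_continuous_fst[OF this] have X: "L1_continuous P T (\<lambda>t \<omega>. fst (V t \<omega>))" .
  let ?mu = "\<lambda>s. law P (\<lambda>\<omega>. fst (V s \<omega>))"
  have f: "(\<lambda>s. indicator {0..T} s *\<^sub>R follower_drift H1 K1 (?mu s) (snd v) (fst v)) \<in> borel_measurable borel"
    using follower_drift_continuous[OF X continuous_on_const, of "snd v" "fst v"]
    by (intro borel_measurable_continuous_on_indicator) auto
  have l: "(\<lambda>s. indicator {0..T} s *\<^sub>R leader_drift H2 K2 (?mu s) (snd v) i) \<in> borel_measurable borel" for i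
    using leader_drift_continuous[OF X continuous_on_const, of "snd v"]
    by (intro borel_measurable_continuous_on_indicator) auto
  \<comment> \<open>The indicator sits on the feedback, which is continuous only on {0..T}; the
    control is Borel on the whole line.\<close>
  have c: "(\<lambda>s. h i s *v (indicator {0..T} s *\<^sub>R g i (?mu s))) \<in> borel_measurable borel" for i
    using h feedback_continuous[OF g X]
    by (intro borel_measurable_matrix_vector_mult borel_measurable_continuous_on_indicator) auto
  have "(\<lambda>s. indicator {0..T} s *\<^sub>R joint_drift h g s (V s) v) =
      (\<lambda>s. (indicator {0..T} s *\<^sub>R follower_drift H1 K1 (?mu s) (snd v) (fst v),
        \<chi> i. indicator {0..T} s *\<^sub>R leader_drift H2 K2 (?mu s) (snd v) i + h i s *v (indicator {0..T} s *\<^sub>R g i (?mu s))))"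
    by (auto simp: fun_eq_iff joint_drift_def vec_eq_iff matrix_vector_mult_scaleR scaleR_add_right)
  also have "\<dots> \<in> borel_measurable borel"
    by (intro borel_measurable_Pair f borel_measurable_vec_lambda borel_measurable_add l c)
  finally show "(\<lambda>s. indicator {0..T} s *\<^sub>R joint_drift h g s (V s) v) \<in> borel_measurable lborel"
    by simp
next
  show "joint_free t \<in> borel_measurable (Fl t)" if "t \<in> {0..T}" for t
    unfolding joint_free_def[abs_def] using free_adapted[OF that] by simp
  show "continuous_on {0..T} (\<lambda>t. joint_free t \<omega>)" if "\<omega> \<in> space P" for \<omega>
    unfolding joint_free_def using free_cont[OF that] by (intro continuous_intros)
  show "norm (joint_drift h g t (\<lambda>_. 0) 0) \<le> drift_zero" for t
    by (rule joint_drift_zero[OF h g])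
qed (use filt T drift_lip_nonneg drift_zero_nonneg joint_free_L1 joint_free_mean joint_drift_lipschitz[OF h g] in auto)


section \<open>Solutions of the controlled system and their uniqueness\<close>

abbreviation mv where
  "mv h g X Y \<equiv> mv_solution P Fl W T \<sigma> H1 H2 K1 K2 X0 Y0 h g X Y"

lemma mv_integrable:
  assumes "mv h g X Y" "t \<in> {0..T}" shows "integrable P (X t)"
  using assms Fl_measurable_P[of "X t" t]
  by (intro integrable_if_law_in_wasserstein_space[of _ 1]) (auto simp: mv_solution_def)

lemma mv_cont:
  assumes "mv h g X Y" "\<omega> \<in> space P" shows "continuous_on {0..T} (\<lambda>t. X t \<omega>)"
  using assms by (auto simp: mv_solution_def)

lemma mv_leaders_continuous:
  assumes mv: "mv h g X Y" shows "continuous_on {0..T} Y"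
proof (rule continuous_on_vec_componentwise)
  fix i
  let ?f = "\<lambda>s. leader_drift H2 K2 (law P (X s)) (Y s) i + h i s *v g i (law P (X s))"
  have i: "set_integrable lborel {0..t} ?f" and eq: "Y t $ i = Y0 $ i + (LINT s:{0..t}|lborel. ?f s)"
    if "t \<in> {0..T}" for t
    using mv that unfolding mv_solution_def by blast+
  have "continuous_on {0..T} (\<lambda>t. Y0 $ i + integral {0..t} ?f)"
    using set_borel_integral_eq_integral(1)[OF i, of T] T
    by (intro continuous_intros indefinite_integral_continuous_1) auto
  then show "continuous_on {0..T} (\<lambda>t. Y t $ i)"
    by (rule continuous_on_cong[THEN iffD1, rotated -1]) (use set_borel_integral_eq_integral(2)[OF i] eq in auto)
qed

lemma mv_L1_continuous:
  assumes mv: "mv h g X Y" shows "L1_continuous P T X"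
proof -
  obtain B where "mckean_vlasov P Fl T free (\<lambda>t \<xi>. follower_drift H1 K1 (law P \<xi>) (Y t)) (2 * L) B free_bound"
    using follower_given_leaders[OF mv_leaders_continuous[OF mv]] .
  then interpret F: mckean_vlasov P Fl T free "\<lambda>t \<xi>. follower_drift H1 K1 (law P \<xi>) (Y t)" "2 * L" B free_bound .
  show ?thesis
  proof (rule F.solution_L1_continuous[OF mv_integrable[OF mv] mv_cont[OF mv]])
    have "AE \<omega> in P. \<forall>t\<in>{0..T}.
        set_integrable lborel {0..t} (\<lambda>s. follower_drift H1 K1 (law P (X s)) (Y s) (X s \<omega>)) \<and>
        X t \<omega> = X0 \<omega> +
          (LINT s:{0..t}|lborel. follower_drift H1 K1 (law P (X s)) (Y s) (X s \<omega>)) +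
          sqrt (2 * \<sigma>) *\<^sub>R (W t \<omega> - W 0 \<omega>)"
      using mv by (simp add: mv_solution_def)
    then show "AE \<omega> in P. F.solves X \<omega>"
      by eventually_elim (simp add: F.solves_def F.drift_integral_def free_def)
  qed
qed

text \<open>The control enters only through time integrals. Comparing them almost everywhere
  requires both integrands to be measurable; the remaining factors are continuous along the
  L^1-continuous flow of laws.\<close>

lemma mv_cong:
  assumes mv: "mv h g X Y" and g: "\<And>i. g i \<in> feedback_maps Mb Lb"
    and h: "\<And>i. (\<lambda>s. indicator {0..T} s *\<^sub>R h i s) \<in> borel_measurable borel"
      "\<And>i. (\<lambda>s. indicator {0..T} s *\<^sub>R h' i s) \<in> borel_measurable borel"
    and eq: "\<And>i. AE s in lborel. s \<in> {0..T} \<longrightarrow> h i s = h' i s"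
  shows "mv h' g X Y"
proof -
  define f where "f h i s = leader_drift H2 K2 (law P (X s)) (Y s) i + h i s *v g i (law P (X s))" for h i s
  have mvf: "set_integrable lborel {0..t} (f h i)" "Y t $ i = Y0 $ i + (LINT s:{0..t}|lborel. f h i s)"
    if "t \<in> {0..T}" for t i
    using mv that unfolding f_def mv_solution_def by blast+
  have "set_integrable lborel {0..t} (f h' i) \<and> (LINT s:{0..t}|lborel. f h' i s) = (LINT s:{0..t}|lborel. f h i s)"
    if t: "t \<in> {0..T}" for t i
  proof -
    have gm: "(\<lambda>s. indicator {0..T} s *\<^sub>R g i (law P (X s))) \<in> borel_measurable borel"
      using feedback_continuous[OF g[of i] mv_L1_continuous[OF mv]]
      by (intro borel_measurable_continuous_on_indicator) auto
    have lm: "(\<lambda>s. indicator {0..T} s *\<^sub>R leader_drift H2 K2 (law P (X s)) (Y s) i) \<in> borel_measurable borel"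
      using leader_drift_continuous[OF mv_L1_continuous[OF mv] mv_leaders_continuous[OF mv]]
      by (intro borel_measurable_continuous_on_indicator) auto
    have "(\<lambda>s. indicator {0..t} s *\<^sub>R f h' i s) = (\<lambda>s. indicator {0..t} s *\<^sub>R
        (indicator {0..T} s *\<^sub>R leader_drift H2 K2 (law P (X s)) (Y s) i +
        (indicator {0..T} s *\<^sub>R h' i s) *v (indicator {0..T} s *\<^sub>R g i (law P (X s)))))"
      using t by (auto simp: fun_eq_iff f_def indicator_def)
    also have "\<dots> \<in> borel_measurable lborel"
      using borel_measurable_matrix_vector_mult[OF h(2) gm] lm by simp
    finally have m': "(\<lambda>s. indicator {0..t} s *\<^sub>R f h' i s) \<in> borel_measurable lborel" .
    have m: "(\<lambda>s. indicator {0..t} s *\<^sub>R f h i s) \<in> borel_measurable lborel"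
      using mvf(1)[OF t] by (auto simp: set_integrable_def)
    have AE: "AE s in lborel. indicator {0..t} s *\<^sub>R f h' i s = indicator {0..t} s *\<^sub>R f h i s"
      using eq[of i] by eventually_elim (use t in \<open>auto simp: f_def indicator_def\<close>)
    show ?thesis
      using integrable_cong_AE[OF m' m AE] integral_cong_AE[OF m' m AE] mvf(1)[OF t]
      by (simp add: set_integrable_def set_lebesgue_integral_def)
  qed
  then have "set_integrable lborel {0..t} (f h' i) \<and> Y t $ i = Y0 $ i + (LINT s:{0..t}|lborel. f h' i s)"
    if "t \<in> {0..T}" for t i
    using mvf(2)[OF that] that by auto
  then show ?thesis
    using mv unfolding mv_solution_def f_def by blast
qed

lemma mv_imp_solves:
  assumes mv: "mv h g X Y" and M: "mckean_vlasov P Fl T joint_free (joint_drift h g) c b z"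
  shows "AE \<omega> in P. mckean_vlasov.solves T joint_free (joint_drift h g) (\<lambda>t \<omega>. (X t \<omega>, Y t)) \<omega>"
proof -
  interpret M: mckean_vlasov P Fl T joint_free "joint_drift h g" c b z by (rule M)
  let ?l = "\<lambda>s. \<chi> i. leader_drift H2 K2 (law P (X s)) (Y s) i + h i s *v g i (law P (X s))"
  have li: "set_integrable lborel {0..t} ?l" and leq: "Y t = Y0 + (LINT s:{0..t}|lborel. ?l s)"
    if t: "t \<in> {0..T}" for t
  proof -
    have *: "set_integrable lborel {0..t} (\<lambda>s. ?l s $ i)" "Y t $ i = Y0 $ i + (LINT s:{0..t}|lborel. ?l s $ i)" for i
      using mv t unfolding mv_solution_def by simp_all
    then show li: "set_integrable lborel {0..t} ?l" by (simp add: set_integrable_vec)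
    show "Y t = Y0 + (LINT s:{0..t}|lborel. ?l s)"
      using *(2) by (simp add: vec_eq_iff set_integral_vec_nth[OF li])
  qed
  have "AE \<omega> in P. \<forall>t\<in>{0..T}.
      set_integrable lborel {0..t} (\<lambda>s. follower_drift H1 K1 (law P (X s)) (Y s) (X s \<omega>)) \<and>
      X t \<omega> = X0 \<omega> +
        (LINT s:{0..t}|lborel. follower_drift H1 K1 (law P (X s)) (Y s) (X s \<omega>)) +
        sqrt (2 * \<sigma>) *\<^sub>R (W t \<omega> - W 0 \<omega>)"
    using mv by (simp add: mv_solution_def)
  then show ?thesis
  proof eventually_elim
    case (elim \<omega>)
    have d: "joint_drift h g s (\<lambda>\<omega>. (X s \<omega>, Y s)) (X s \<omega>, Y s) =
        (follower_drift H1 K1 (law P (X s)) (Y s) (X s \<omega>), ?l s)" for s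
      by (simp add: joint_drift_def)
    show ?case
      unfolding M.solves_def M.drift_integral_def d
    proof (intro ballI conjI)
      fix t assume t: "t \<in> {0..T}"
      show i: "set_integrable lborel {0..t} (\<lambda>s. (follower_drift H1 K1 (law P (X s)) (Y s) (X s \<omega>), ?l s))"
        using elim t li[OF t] by (simp add: set_integrable_Pair)
      show "(X t \<omega>, Y t) = joint_free t \<omega> + (LINT s:{0..t}|lborel. (follower_drift H1 K1 (law P (X s)) (Y s) (X s \<omega>), ?l s))"
        unfolding set_integral_Pair[OF i] using elim t leq[OF t] by (simp add: joint_free_def free_def)
    qed
  qed
qed

text \<open>Laws and leaders are exactly what the cost sees of a solution. Equality of the leaders
  holds outright since they do not depend on \<omega> and P is not null.\<close>

lemma mv_unique:
  assumes h: "regular h" and g: "\<And>i. g i \<in> feedback_maps Mb Lb"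
    and mv: "mv h g X Y" "mv h g X' Y'" and t: "t \<in> {0..T}"
  shows "law P (X t) = law P (X' t)" "Y t = Y' t"
proof -
  note M = joint_mckean_vlasov[OF h g]
  interpret M: mckean_vlasov P Fl T joint_free "joint_drift h g" drift_lip drift_zero "free_bound + norm Y0" by (rule M)
  have int: "integrable P (\<lambda>\<omega>. (X t \<omega>, Y t))" if "mv h g X Y" "t \<in> {0..T}" for X Y t
    using mv_integrable[OF that] by (intro integrable_Pair) auto
  have cont: "continuous_on {0..T} (\<lambda>t. (X t \<omega>, Y t))" if "mv h g X Y" "\<omega> \<in> space P" for X Y \<omega>
    using mv_cont[OF that] mv_leaders_continuous[OF that(1)] by (intro continuous_intros)
  have "AE \<omega> in P. \<forall>t\<in>{0..T}. (X t \<omega>, Y t) = (X' t \<omega>, Y' t)"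
    by (rule M.solution_unique) (use int cont mv mv_imp_solves[OF _ M] in auto)
  then have AE: "AE \<omega> in P. X t \<omega> = X' t \<omega> \<and> Y t = Y' t"
    by eventually_elim (use t in auto)
  have m: "X t \<in> borel_measurable P" "X' t \<in> borel_measurable P"
    using mv_integrable[OF mv(1) t] mv_integrable[OF mv(2) t] by auto
  show "law P (X t) = law P (X' t)"
    unfolding law_def by (intro distr_cong_AE) (use AE m in auto)
  show "Y t = Y' t"
    using AE by auto
qed

section \<open>Bounds that do not depend on the control\<close>

text \<open>\<open>solution_bound\<close> for the constants of the joint system: one integrable
  majorant for the distance to the drift-free path, shared by all regular controls and all feedback
  maps of the class.\<close>

definition spread :: "'w \<Rightarrow> real" where
  "spread = mckean_vlasov.solution_bound P T joint_free drift_lip drift_zero (free_bound + norm Y0)"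

definition mean_spread :: real where
  "mean_spread = (LINT \<omega>|P. spread \<omega>)"

text \<open>The right-hand side of \<open>solution_L1_modulus\<close> for the joint system; the
  leaders' part of \<open>joint_free\<close> is constant and drops out of the first term.\<close>

definition modulus :: "real \<Rightarrow> real \<Rightarrow> real" where
  "modulus s t = (LINT \<omega>|P. norm (free t \<omega> - free s \<omega>)) +
     \<bar>t - s\<bar> * (drift_zero + 2 * drift_lip * (free_bound + norm Y0 + mean_spread))"

text \<open>What compactness needs of a solution: a common majorant, a common modulus, and the
  follower's equation. In contrast to \<open>mv_solution\<close> the equation is required on every
  path, because limits are taken path by path.\<close>

definition controlled :: "(real \<Rightarrow> 'w \<Rightarrow> real^'d) \<Rightarrow> (real \<Rightarrow> (real^'d)^'m) \<Rightarrow> bool" where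
  "controlled X Y \<longleftrightarrow>
     (\<forall>t\<in>{0..T}. \<forall>\<omega>\<in>space P. norm (X t \<omega> - free t \<omega>) \<le> spread \<omega> \<and>
        set_integrable lborel {0..t} (\<lambda>s. follower_drift H1 K1 (law P (X s)) (Y s) (X s \<omega>)) \<and>
        X t \<omega> = free t \<omega> + (LINT s:{0..t}|lborel. follower_drift H1 K1 (law P (X s)) (Y s) (X s \<omega>))) \<and>
     (\<forall>t\<in>{0..T}. norm (Y t - Y0) \<le> mean_spread) \<and>
     (\<forall>s\<in>{0..T}. \<forall>t\<in>{0..T}. (LINT \<omega>|P. norm (X t \<omega> - X s \<omega>)) \<le> modulus s t \<and> norm (Y t - Y s) \<le> modulus s t)"

text \<open>The joint equation yields leaders that might be random. Their drift contains \<omega>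
  only through the leaders themselves, as the mean field is a law, so any two paths obey the same
  ODE with the same initial value, and Gronwall with A = 0 identifies them.\<close>

lemma controlled_solution_exists:
  assumes h: "regular h" and g: "\<And>i. g i \<in> feedback_maps Mb Lb"
  obtains X Y where "mv h g X Y" "controlled X Y" "integrable P spread"
proof -
  note M = joint_mckean_vlasov[OF h g]
  interpret M: mckean_vlasov P Fl T joint_free "joint_drift h g" drift_lip drift_zero "free_bound + norm Y0" by (rule M)
  obtain V where dom: "M.dominated spread V"
    and V: "\<And>t \<omega>. t \<in> {0..T} \<Longrightarrow> \<omega> \<in> space P \<Longrightarrow> V t \<omega> = joint_free t \<omega> + M.drift_integral V t \<omega>"
    using M.solution_exists unfolding spread_def by metis
  obtain w0 where w0: "w0 \<in> space P" using not_empty by blast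
  define X where "X t \<omega> = fst (V t \<omega>)" for t \<omega>
  define Y where "Y t = snd (V t w0)" for t
  have lawX: "law P (\<lambda>\<omega>. fst (V t \<omega>)) = law P (X t)" for t by (simp add: X_def[abs_def])
  have det: "snd (V t \<omega>) = Y t" if w: "\<omega> \<in> space P" and t: "t \<in> {0..T}" for t \<omega>
  proof -
    let ?u = "\<lambda>t. norm (snd (V t \<omega>) - snd (V t w0))"
    have cu: "continuous_on {0..T} ?u"
      using M.dominated_cont[OF dom w] M.dominated_cont[OF dom w0] by (intro continuous_intros)
    have "?u t \<le> 0 * exp (drift_lip * t)"
    proof (rule Gronwall_integral[OF cu drift_lip_nonneg _ t])
      fix t assume t: "t \<in> {0..T}"
      note i = M.drift_set_integrable[OF dom w t] M.drift_set_integrable[OF dom w0 t]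
      let ?D = "\<lambda>s. snd (joint_drift h g s (V s) (V s \<omega>)) - snd (joint_drift h g s (V s) (V s w0))"
      have iu: "set_integrable lborel {0..t} ?u"
        unfolding set_integrable_def
        by (intro borel_integrable_compact continuous_on_subset[OF cu]) (use t in auto)
      have si: "set_integrable lborel {0..t} (\<lambda>s. snd (joint_drift h g s (V s) (V s \<omega>)))" if "\<omega> \<in> space P" for \<omega>
        using set_integrable_Pair[of lborel "{0..t}" "\<lambda>s. fst (joint_drift h g s (V s) (V s \<omega>))"
          "\<lambda>s. snd (joint_drift h g s (V s) (V s \<omega>))"] M.drift_set_integrable[OF dom that t] by simp
      have sn: "snd (V t \<omega>) = Y0 + (LINT s:{0..t}|lborel. snd (joint_drift h g s (V s) (V s \<omega>)))" if "\<omega> \<in> space P" for \<omega>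
        using set_integral_Pair[of lborel "{0..t}" "\<lambda>s. fst (joint_drift h g s (V s) (V s \<omega>))"
          "\<lambda>s. snd (joint_drift h g s (V s) (V s \<omega>))"] M.drift_set_integrable[OF dom that t] V[OF t that]
        by (simp add: M.drift_integral_def joint_free_def)
      have "?u t = norm (LINT s:{0..t}|lborel. ?D s)"
        using sn[OF w] sn[OF w0] set_integral_diff(2)[OF si[OF w] si[OF w0]] by simp
      also have "\<dots> \<le> (LINT s:{0..t}|lborel. drift_lip * ?u s)"
      proof (rule set_integral_norm_le[OF set_integral_diff(1)[OF si[OF w] si[OF w0]] set_integrable_mult_right])
        show "set_integrable lborel {0..t} ?u" by (rule iu)
        fix s assume "s \<in> {0..t}"
        then have s: "s \<in> {0..T}" using t by auto
        \<comment> \<open>A hybrid state: the follower of \<omega> with the leaders of w0. The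
          leaders' drift does not see the follower's component, so the Lipschitz bound at v measures
          only the distance of the leaders.\<close>
        define v where "v = (fst (V s \<omega>), snd (V s w0))"
        have "?D s = snd (joint_drift h g s (V s) (V s \<omega>) - joint_drift h g s (V s) v)"
          by (simp add: joint_drift_def v_def)
        also have "norm \<dots> \<le> drift_lip * norm (V s \<omega> - v)"
          using joint_drift_lipschitz[where t = s and v = "V s \<omega>" and v' = v,
              OF h g M.dominated_integrable[OF dom s] M.dominated_integrable[OF dom s]]
          by (intro order_trans[OF norm_snd_le_norm]) simp
        also have "V s \<omega> - v = (0, snd (V s \<omega>) - snd (V s w0))"
          by (simp add: v_def prod_eq_iff)
        finally show "norm (?D s) \<le> drift_lip * ?u s" by (simp add: norm_Pair)
      qed
      also have "\<dots> = 0 + drift_lip * integral {0..t} ?u"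
        using set_borel_integral_eq_integral(2)[OF iu] by simp
      finally show "?u t \<le> 0 + drift_lip * integral {0..t} ?u" .
    qed
    then show ?thesis by (simp add: Y_def)
  qed
  let ?f = "\<lambda>s \<omega>. follower_drift H1 K1 (law P (X s)) (Y s) (X s \<omega>)"
  let ?l = "\<lambda>s. \<chi> i. leader_drift H2 K2 (law P (X s)) (Y s) i + h i s *v g i (law P (X s))"
  have J: "joint_drift h g s (V s) (V s \<omega>) = (?f s \<omega>, ?l s)" if "s \<in> {0..T}" "\<omega> \<in> space P" for s \<omega>
    unfolding joint_drift_def lawX det[OF that(2,1)] by (simp add: X_def)
  have ci: "set_integrable lborel {0..t} (\<lambda>s. (?f s \<omega>, ?l s))"
    and ce: "V t \<omega> = joint_free t \<omega> + (LINT s:{0..t}|lborel. (?f s \<omega>, ?l s))"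
    if t: "t \<in> {0..T}" and w: "\<omega> \<in> space P" for t \<omega>
  proof -
    have eq: "joint_drift h g s (V s) (V s \<omega>) = (?f s \<omega>, ?l s)" if "s \<in> {0..t}" for s
      using J[OF _ w, of s] that t by auto
    show "set_integrable lborel {0..t} (\<lambda>s. (?f s \<omega>, ?l s))"
      using M.drift_set_integrable[OF dom w t]
      by (rule set_integrable_cong[THEN iffD1, rotated -1]) (use eq in auto)
    have "M.drift_integral V t \<omega> = (LINT s:{0..t}|lborel. (?f s \<omega>, ?l s))"
      unfolding M.drift_integral_def by (rule set_lebesgue_integral_cong) (use eq in auto)
    then show "V t \<omega> = joint_free t \<omega> + (LINT s:{0..t}|lborel. (?f s \<omega>, ?l s))"
      using V[OF t w] by simp
  qed
  have fi: "set_integrable lborel {0..t} (\<lambda>s. ?f s \<omega>)" and li: "set_integrable lborel {0..t} ?l"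
    if "t \<in> {0..T}" "\<omega> \<in> space P" for t \<omega>
    using ci[OF that] by (simp_all add: set_integrable_Pair)
  have fe: "X t \<omega> = free t \<omega> + (LINT s:{0..t}|lborel. ?f s \<omega>)" and le: "Y t = Y0 + (LINT s:{0..t}|lborel. ?l s)"
    if t: "t \<in> {0..T}" and w: "\<omega> \<in> space P" for t \<omega>
    using ce[OF that] set_integral_Pair[OF ci[OF that]] det[OF w t] by (simp_all add: X_def joint_free_def)
  have VP: "V t \<omega> = (X t \<omega>, Y t)" if "t \<in> {0..T}" "\<omega> \<in> space P" for t \<omega>
    using det[OF that(2,1)] by (simp add: X_def prod_eq_iff)
  have Xm: "X t \<in> borel_measurable (Fl t)" if "t \<in> {0..T}" for t
    unfolding X_def[abs_def]
    using M.dominated_adapted[OF dom that] by (rule measurable_compose) (intro borel_measurable_continuous_onI continuous_intros)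
  have Xi: "integrable P (X t)" if "t \<in> {0..T}" for t
    unfolding X_def[abs_def] using integrable_bounded_linear[OF bounded_linear_fst M.dominated_integrable[OF dom that]] .
  have lie: "set_integrable lborel {0..t} (\<lambda>s. leader_drift H2 K2 (law P (X s)) (Y s) i + h i s *v g i (law P (X s))) \<and>
      Y t $ i = Y0 $ i + (LINT s:{0..t}|lborel. leader_drift H2 K2 (law P (X s)) (Y s) i + h i s *v g i (law P (X s)))"
    if t: "t \<in> {0..T}" for t i
    using li[OF t w0] le[OF t w0] set_integral_vec_nth[OF li[OF t w0], of i] by (simp add: set_integrable_vec)
  have mv: "mv h g X Y"
    unfolding mv_solution_def
  proof (intro conjI ballI allI AE_I2)
    show "continuous_on {0..T} (\<lambda>t. X t \<omega>)" if "\<omega> \<in> space P" for \<omega>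
      unfolding X_def using M.dominated_cont[OF dom that] by (intro continuous_intros)
    show "X t \<omega> = X0 \<omega> + (LINT s:{0..t}|lborel. ?f s \<omega>) + sqrt (2 * \<sigma>) *\<^sub>R (W t \<omega> - W 0 \<omega>)"
      if "\<omega> \<in> space P" "t \<in> {0..T}" for \<omega> t
      using fe[OF that(2,1)] by (simp add: free_def)
  qed (use Xm fi lie law_in_wasserstein_space[OF Xi] in auto)
  have spread: "integrable P spread" using M.dominated_Q[OF dom] .
  have "controlled X Y"
    unfolding controlled_def
  proof (intro conjI ballI)
    fix t \<omega> assume t: "t \<in> {0..T}" and w: "\<omega> \<in> space P"
    have *: "norm (X t \<omega> - free t \<omega>, Y t - Y0) \<le> spread \<omega>"
      using M.dominated_le[OF dom t w] by (simp add: VP[OF t w] joint_free_def)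
    then show "norm (X t \<omega> - free t \<omega>) \<le> spread \<omega>" using norm_fst_le order_trans by blast
    show "set_integrable lborel {0..t} (\<lambda>s. ?f s \<omega>)" "X t \<omega> = free t \<omega> + (LINT s:{0..t}|lborel. ?f s \<omega>)"
      using fi[OF t w] fe[OF t w] by auto
  next
    fix t assume t: "t \<in> {0..T}"
    have "norm (Y t - Y0) \<le> spread \<omega>" if w: "\<omega> \<in> space P" for \<omega>
      using M.dominated_le[OF dom t w] norm_snd_le[of "Y t - Y0" "X t \<omega> - free t \<omega>"]
      by (simp add: VP[OF t w] joint_free_def)
    \<comment> \<open>A deterministic quantity that is below \<open>spread\<close> on every path is
      below its mean.\<close>
    then have "(LINT \<omega>|P. norm (Y t - Y0)) \<le> mean_spread"
      unfolding mean_spread_def using spread by (intro integral_mono) auto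
    then show "norm (Y t - Y0) \<le> mean_spread" by (simp add: prob_space)
  next
    fix s t assume s: "s \<in> {0..T}" and t: "t \<in> {0..T}"
    have "(LINT \<omega>|P. norm (V t \<omega> - V s \<omega>)) \<le> modulus s t"
      using M.solution_L1_modulus[OF dom V s t] unfolding modulus_def joint_free_diff mean_spread_def
      by (simp add: add.assoc)
    moreover have "(LINT \<omega>|P. norm (V t \<omega> - V s \<omega>)) = (LINT \<omega>|P. norm (X t \<omega> - X s \<omega>, Y t - Y s))"
      by (rule Bochner_Integration.integral_cong) (simp_all add: VP[OF s] VP[OF t])
    ultimately have *: "(LINT \<omega>|P. norm (X t \<omega> - X s \<omega>, Y t - Y s)) \<le> modulus s t" by simp
    have i: "integrable P (\<lambda>\<omega>. norm (X t \<omega> - X s \<omega>, Y t - Y s))"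
      using Xi[OF s] Xi[OF t] by (intro integrable_norm integrable_Pair) auto
    have "(LINT \<omega>|P. norm (X t \<omega> - X s \<omega>)) \<le> (LINT \<omega>|P. norm (X t \<omega> - X s \<omega>, Y t - Y s))"
      using i Xi[OF s] Xi[OF t] by (intro integral_mono) (auto simp: norm_fst_le)
    with * show "(LINT \<omega>|P. norm (X t \<omega> - X s \<omega>)) \<le> modulus s t" by simp
    have "(LINT \<omega>|P. norm (Y t - Y s)) \<le> (LINT \<omega>|P. norm (X t \<omega> - X s \<omega>, Y t - Y s))"
      using i by (intro integral_mono) (auto simp: norm_snd_le)
    with * show "norm (Y t - Y s) \<le> modulus s t" by (simp add: prob_space)
  qed
  then show thesis using that mv spread by blast
qed

end

section \<open>Compactness of states and feedback maps\<close>

lemma continuous_on_lipschitz_compose: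
  fixes b :: "real \<Rightarrow> 'a::real_normed_vector \<Rightarrow> 'b::real_normed_vector"
  assumes cont: "\<And>x. continuous_on S (\<lambda>s. b s x)" and c: "continuous_on S c"
    and lip: "\<And>s x x'. s \<in> S \<Longrightarrow> norm (b s x - b s x') \<le> K * norm (x - x')"
  shows "continuous_on S (\<lambda>s. b s (c s))"
  unfolding continuous_on_def
proof
  fix t assume t: "t \<in> S"
  have l: "((\<lambda>s. K * norm (c s - c t) + norm (b s (c t) - b t (c t))) \<longlongrightarrow>
      K * norm (c t - c t) + norm (b t (c t) - b t (c t))) (at t within S)"
    using c cont[of "c t"] t by (intro tendsto_intros) (auto simp: continuous_on_def)
  have "((\<lambda>s. b s (c s) - b t (c t)) \<longlongrightarrow> 0) (at t within S)"
  proof (rule Lim_null_comparison)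
    have "norm (b s (c s) - b t (c t)) \<le> K * norm (c s - c t) + norm (b s (c t) - b t (c t))" if "s \<in> S" for s
      using lip[OF that, of "c s" "c t"] norm_triangle_ineq[of "b s (c s) - b s (c t)" "b s (c t) - b t (c t)"] by simp
    then show "\<forall>\<^sub>F s in at t within S. norm (b s (c s) - b t (c t)) \<le> K * norm (c s - c t) + norm (b s (c t) - b t (c t))"
      by (simp add: eventually_at_filter always_eventually)
  qed (use l in simp)
  then show "((\<lambda>s. b s (c s)) \<longlongrightarrow> b t (c t)) (at t within S)" by (rule LIM_zero_cancel)
qed

lemma set_integrable_continuous_interval:
  fixes f :: "real \<Rightarrow> 'b::euclidean_space"
  assumes "continuous_on {a..b} f" shows "set_integrable lborel {a..b} f"
  unfolding set_integrable_def using assms by (intro borel_integrable_compact) auto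

text \<open>Tychonoff's theorem, so that separability of the Wasserstein space is not needed.\<close>
lemma feedback_maps_cluster_point:
  fixes g :: "nat \<Rightarrow> (real^'d) measure \<Rightarrow> real^'l"
  assumes g: "\<And>n. g n \<in> feedback_maps Mb Lb" and "0 \<le> Mb"
  obtains gs where "gs \<in> feedback_maps Mb Lb"
    "\<And>\<mu> l. \<mu> \<in> wasserstein_space 1 \<Longrightarrow> (\<lambda>n. g n \<mu>) \<longlonglongrightarrow> l \<Longrightarrow> gs \<mu> = l"
proof -
  \<comment> \<open>The value 0 off the Wasserstein space places the whole sequence in a product of
    balls over all measures, which is compact.\<close>
  define g' where "g' n \<mu> = (if \<mu> \<in> wasserstein_space 1 then g n \<mu> else 0)" for n \<mu>
  define G where "G = filtermap g' sequentially"
  have ev: "eventually (\<lambda>f. f \<in> C) G" if "\<And>n. g' n \<in> C" for C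
    using that by (simp add: G_def eventually_filtermap)
  have "compactin (product_topology (\<lambda>_::(real^'d) measure. euclidean) UNIV) (PiE UNIV (\<lambda>_. cball (0::real^'l) Mb))"
    by (simp add: compactin_PiE)
  then have "compact (PiE UNIV (\<lambda>_::(real^'d) measure. cball (0::real^'l) Mb))"
    by (simp add: euclidean_product_topology)
  moreover have "eventually (\<lambda>f. f \<in> PiE UNIV (\<lambda>_. cball 0 Mb)) G"
    using g \<open>0 \<le> Mb\<close> by (intro ev) (auto simp: g'_def feedback_maps_def)
  moreover have "G \<noteq> bot" by (simp add: G_def filtermap_bot_iff)
  ultimately obtain gs where gs: "inf (nhds gs) G \<noteq> bot"
    unfolding compact_filter by blast
  \<comment> \<open>A cluster point lies in every closed set that contains the sequence eventually.
    Each property wanted of gs is such a set, as it constrains only one or two coordinates.\<close>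
  have cluster: "gs \<in> C" if "closed C" "eventually (\<lambda>f. f \<in> C) G" for C
  proof (rule ccontr)
    assume "gs \<notin> C"
    then have "eventually (\<lambda>f. f \<in> - C) (nhds gs)"
      using that(1) by (intro eventually_nhds_in_open) auto
    then have "eventually (\<lambda>f. False) (inf (nhds gs) G)"
      using that(2) unfolding eventually_inf by blast
    then show False using gs by (simp add: eventually_False)
  qed
  show thesis
  proof (rule that[of gs])
    show "gs \<in> feedback_maps Mb Lb"
      unfolding feedback_maps_def
    proof (intro CollectI conjI ballI)
      fix \<mu> :: "(real^'d) measure" assume \<mu>: "\<mu> \<in> wasserstein_space 1"
      have "gs \<in> {f. norm (f \<mu>) \<le> Mb}"
        using g \<mu> by (intro cluster ev closed_Collect_le continuous_intros continuous_on_product_coordinates)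
          (auto simp: g'_def feedback_maps_def)
      then show "norm (gs \<mu>) \<le> Mb" by simp
      fix \<nu> :: "(real^'d) measure" assume \<nu>: "\<nu> \<in> wasserstein_space 1"
      have "gs \<in> {f. dist (f \<mu>) (f \<nu>) \<le> Lb * wasserstein_dist 1 \<mu> \<nu>}"
        using g \<mu> \<nu> by (intro cluster ev closed_Collect_le continuous_intros continuous_on_product_coordinates)
          (auto simp: g'_def feedback_maps_def)
      then show "dist (gs \<mu>) (gs \<nu>) \<le> Lb * wasserstein_dist 1 \<mu> \<nu>" by simp
    qed
    fix \<mu> :: "(real^'d) measure" and l
    assume \<mu>: "\<mu> \<in> wasserstein_space 1" and l: "(\<lambda>n. g n \<mu>) \<longlonglongrightarrow> l"
    have "dist (gs \<mu>) l \<le> e" if "e > 0" for e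
    proof -
      have "\<forall>\<^sub>F n in sequentially. dist (g n \<mu>) l < e" using tendstoD[OF l that] .
      then have "eventually (\<lambda>f. f \<in> {f. dist (f \<mu>) l \<le> e}) G"
        unfolding G_def eventually_filtermap by eventually_elim (use \<mu> in \<open>simp add: g'_def\<close>)
      moreover have "closed {f :: (real^'d) measure \<Rightarrow> real^'l. dist (f \<mu>) l \<le> e}"
        by (intro closed_Collect_le continuous_intros continuous_on_product_coordinates)
      ultimately show ?thesis using cluster by blast
    qed
    then have "dist (gs \<mu>) l \<le> 0" by (rule field_le_epsilon) (simp only: add_0)
    then show "gs \<mu> = l" by simp
  qed
qed

context control_problem
begin

lemma modulus_tendsto:
  assumes t: "t \<in> {0..T}" and e: "0 < e"
  obtains d where "0 < d" "\<And>s. s \<in> {0..T} \<Longrightarrow> \<bar>s - t\<bar> < d \<Longrightarrow> modulus t s < e"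
proof -
  let ?c = "drift_zero + 2 * drift_lip * (free_bound + norm Y0 + mean_spread)"
  have "((\<lambda>s. (LINT \<omega>|P. norm (free s \<omega> - free t \<omega>)) + \<bar>s - t\<bar> * ?c) \<longlongrightarrow> 0 + \<bar>t - t\<bar> * ?c) (at t within {0..T})"
    using free_L1 t by (intro tendsto_intros) (auto simp: L1_continuous_def)
  then have "((\<lambda>s. modulus t s) \<longlongrightarrow> 0) (at t within {0..T})"
    by (simp add: modulus_def)
  then have "\<forall>\<^sub>F s in at t within {0..T}. modulus t s < e"
    using order_tendstoD(2) e by blast
  then obtain d where d: "d > 0" "\<And>s. s \<in> {0..T} \<Longrightarrow> s \<noteq> t \<Longrightarrow> dist s t < d \<Longrightarrow> modulus t s < e"
    unfolding eventually_at by blast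
  moreover have "modulus t t = 0" by (simp add: modulus_def)
  ultimately show thesis
    using e by (intro that[OF d(1)]) (metis dist_real_def)
qed

lemma controlled_mean:
  assumes X: "controlled X Y" and int: "integrable P (X t)" "integrable P spread" and t: "t \<in> {0..T}"
  shows "(LINT \<omega>|P. norm (X t \<omega>)) \<le> free_bound + mean_spread"
proof -
  have "(LINT \<omega>|P. norm (X t \<omega>)) \<le> (LINT \<omega>|P. norm (free t \<omega>) + spread \<omega>)"
  proof (rule integral_mono)
    fix \<omega> assume "\<omega> \<in> space P"
    then have "norm (X t \<omega> - free t \<omega>) \<le> spread \<omega>"
      using X t unfolding controlled_def by blast
    then show "norm (X t \<omega>) \<le> norm (free t \<omega>) + spread \<omega>"
      using norm_triangle_ineq2[of "X t \<omega>" "free t \<omega>"] by linarith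
  qed (use int free_integrable[OF t] in auto)
  also have "\<dots> = (LINT \<omega>|P. norm (free t \<omega>)) + mean_spread"
    using int free_integrable[OF t] by (simp add: mean_spread_def)
  finally show ?thesis using free_mean[OF t] by linarith
qed

text \<open>Fields and leaders are treated as one family on pairs (t, x), so a single subsequence
  serves all times and states. The Lipschitz bound gives equicontinuity in x and, applied to two
  times of one trajectory, \<open>modulus\<close> gives it in t.\<close>

lemma drift_fields_convergent_subsequence:
  fixes X :: "nat \<Rightarrow> real \<Rightarrow> 'w \<Rightarrow> real^'d" and Y :: "nat \<Rightarrow> real \<Rightarrow> (real^'d)^'m"
  assumes ctl: "\<And>n. controlled (X n) (Y n)" and ints: "\<forall>n. \<forall>t\<in>{0..T}. integrable P (X n t)"
    and spread: "integrable P spread"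
  shows "\<exists>r b YY B. strict_mono (r :: nat \<Rightarrow> nat) \<and>
    (\<forall>t\<in>{0..T}. (\<forall>x. (\<lambda>n. follower_drift H1 K1 (law P (X (r n) t)) (Y (r n) t) x) \<longlonglongrightarrow> b t x) \<and>
      (\<lambda>n. Y (r n) t) \<longlonglongrightarrow> YY t \<and>
      (\<forall>n. norm (follower_drift H1 K1 (law P (X n t)) (Y n t) 0) \<le> B))"
proof -
  note int = ints[rule_format]
  define b where "b n t x = follower_drift H1 K1 (law P (X n t)) (Y n t) x" for n t x
  define B where "B = norm (H1 0) + norm (K1 0) + L * (norm Y0 + mean_spread + (free_bound + mean_spread))"
  have Yle: "norm (Y n t) \<le> norm Y0 + mean_spread" if "t \<in> {0..T}" for n t
  proof -
    have "norm (Y n t - Y0) \<le> mean_spread" using ctl[of n] that by (simp add: controlled_def)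
    then show ?thesis using norm_triangle_ineq2[of "Y n t" Y0] by linarith
  qed
  have b_lip: "norm (b n t x - b n' s x') \<le>
      L * (2 * norm (x - x') + norm (Y n t - Y n' s) + (LINT \<omega>|P. norm (X n t \<omega> - X n' s \<omega>)))"
    if "t \<in> {0..T}" "s \<in> {0..T}" for n n' t s x x'
    unfolding b_def by (rule follower_drift_lipschitz[OF int[OF that(1)] int[OF that(2)]])
  have b0: "norm (b n t 0) \<le> B" if t: "t \<in> {0..T}" for n t
  proof -
    have "norm (b n t 0 - follower_drift H1 K1 (law P (\<lambda>_. 0)) (0 :: (real^'d)^'m) 0) \<le>
        L * (norm (Y n t) + (LINT \<omega>|P. norm (X n t \<omega>)))"
      using follower_drift_lipschitz[OF int[OF t], of "\<lambda>_. 0" n "Y n t" 0 0 0] by (simp add: b_def)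
    also have "\<dots> \<le> L * (norm Y0 + mean_spread + (free_bound + mean_spread))"
      by (intro mult_left_mono add_mono Yle[OF t] controlled_mean[OF ctl int[OF t] spread t] L)
    finally show ?thesis
      using follower_drift_zero norm_triangle_ineq2[of "b n t 0" "follower_drift H1 K1 (law P (\<lambda>_. 0)) (0 :: (real^'d)^'m) 0"]
      unfolding B_def by linarith
  qed
  let ?f = "\<lambda>n p. (b n (fst p) (snd p), Y n (fst p))"
  obtain r G where r: "strict_mono (r :: nat \<Rightarrow> nat)"
    and lim: "\<And>p. p \<in> {0..T} \<times> UNIV \<Longrightarrow> (\<lambda>n. ?f (r n) p) \<longlonglongrightarrow> G p"
  proof (rule equicontinuous_convergent_subsequence[of "{0..T} \<times> (UNIV :: (real^'d) set)" ?f])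
    fix n and p :: "real \<times> (real^'d)" assume "p \<in> {0..T} \<times> UNIV"
    then have t: "fst p \<in> {0..T}" by auto
    have "norm (b n (fst p) (snd p) - b n (fst p) 0) \<le> L * (2 * norm (snd p))"
      using b_lip[OF t t, of n "snd p" n 0] by simp
    then have "norm (b n (fst p) (snd p)) \<le> B + L * (2 * norm (snd p))"
      using b0[OF t, of n] norm_triangle_ineq2[of "b n (fst p) (snd p)" "b n (fst p) 0"] by linarith
    then show "norm (?f n p) \<le> B + L * (2 * norm (snd p)) + (norm Y0 + mean_spread)"
      using norm_Pair_le[of "b n (fst p) (snd p)" "Y n (fst p)"] Yle[OF t, of n] by linarith
  next
    fix p :: "real \<times> (real^'d)" and e :: real assume "p \<in> {0..T} \<times> UNIV" and e: "0 < e"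
    then have t: "fst p \<in> {0..T}" by auto
    \<comment> \<open>The fields differ by at most L * (2 * e' + e' + e') and the leaders by e'; the
      2 in place of 1 makes the final inequality strict and the denominator positive for L =
      0.\<close>
    define e' where "e' = e / (4 * L + 2)"
    have e': "0 < e'" unfolding e'_def using e L by (intro divide_pos_pos) auto
    obtain d where d: "0 < d" "\<And>s. s \<in> {0..T} \<Longrightarrow> \<bar>s - fst p\<bar> < d \<Longrightarrow> modulus (fst p) s < e'"
      using modulus_tendsto[OF t e'] by blast
    have "dist (?f n p) (?f n q) < e" if q: "q \<in> {0..T} \<times> UNIV" "dist p q < min d e'" for n q
    proof -
      have s: "fst q \<in> {0..T}" using q by auto
      have "dist (fst p) (fst q) < d" "dist (snd p) (snd q) < e'"
        using q(2) dist_fst_le[of p q] dist_snd_le[of p q] by linarith+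
      then have m: "modulus (fst p) (fst q) < e'" and x: "norm (snd q - snd p) < e'"
        using d(2)[OF s] by (auto simp: dist_real_def abs_minus_commute dist_norm norm_minus_commute)
      have c: "(LINT \<omega>|P. norm (X n (fst q) \<omega> - X n (fst p) \<omega>)) \<le> modulus (fst p) (fst q)"
        "norm (Y n (fst q) - Y n (fst p)) \<le> modulus (fst p) (fst q)"
        using ctl[of n] s t by (simp_all add: controlled_def)
      have "norm (b n (fst q) (snd q) - b n (fst p) (snd p)) \<le>
          L * (2 * norm (snd q - snd p) + norm (Y n (fst q) - Y n (fst p)) + (LINT \<omega>|P. norm (X n (fst q) \<omega> - X n (fst p) \<omega>)))"
        by (rule b_lip[OF s t])
      also have "\<dots> \<le> L * (2 * e' + e' + e')"
        using c m x by (intro mult_left_mono add_mono L) auto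
      finally have "norm (b n (fst q) (snd q) - b n (fst p) (snd p)) \<le> 4 * L * e'" by (simp add: algebra_simps)
      moreover have "norm (?f n q - ?f n p) \<le> norm (b n (fst q) (snd q) - b n (fst p) (snd p)) + norm (Y n (fst q) - Y n (fst p))"
        using norm_Pair_le by simp
      ultimately have "norm (?f n q - ?f n p) \<le> 4 * L * e' + e'" using c m by linarith
      also have "\<dots> < (4 * L + 2) * e'" using e' by (simp add: algebra_simps)
      also have "\<dots> = e" unfolding e'_def using L by simp
      finally show ?thesis by (subst dist_commute) (simp add: dist_norm)
    qed
    then show "\<exists>d>0. \<forall>n q. q \<in> {0..T} \<times> UNIV \<and> dist p q < d \<longrightarrow> dist (?f n p) (?f n q) < e"
      using d(1) e' by (intro exI[of _ "min d e'"]) auto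
  qed blast
  have "(\<forall>x. (\<lambda>n. b (r n) t x) \<longlonglongrightarrow> fst (G (t, x))) \<and> (\<lambda>n. Y (r n) t) \<longlonglongrightarrow> snd (G (t, 0)) \<and>
      (\<forall>n. norm (b n t 0) \<le> B)" if t: "t \<in> {0..T}" for t
  proof (intro conjI allI)
    show "(\<lambda>n. b (r n) t x) \<longlonglongrightarrow> fst (G (t, x))" for x
      using tendsto_fst[OF lim[of "(t, x)"]] t by simp
    show "(\<lambda>n. Y (r n) t) \<longlonglongrightarrow> snd (G (t, 0))"
      using tendsto_snd[OF lim[of "(t, 0)"]] t by simp
    show "norm (b n t 0) \<le> B" for n
      by (rule b0[OF t])
  qed
  then show ?thesis
    unfolding b_def using r
    by (intro exI[of _ r] exI[of _ "\<lambda>t x. fst (G (t, x))"] exI[of _ "\<lambda>t. snd (G (t, 0))"] exI[of _ B]) blast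
qed

text \<open>The limit follower is defined as the solution for the limit field b and compared with X
  n by Gronwall on each path. The majorants turn pathwise convergence into convergence in L^1(P),
  and this in turn shows that b is the drift generated by the limit itself.\<close>

lemma states_convergent_subsequence:
  fixes X :: "nat \<Rightarrow> real \<Rightarrow> 'w \<Rightarrow> real^'d" and Y :: "nat \<Rightarrow> real \<Rightarrow> (real^'d)^'m"
  assumes ctl: "\<And>n. controlled (X n) (Y n)" and int: "\<And>n t. t \<in> {0..T} \<Longrightarrow> integrable P (X n t)"
    and cont: "\<And>n \<omega>. \<omega> \<in> space P \<Longrightarrow> continuous_on {0..T} (\<lambda>t. X n t \<omega>)"
    and spread: "integrable P spread"
  obtains r XX YY where "strict_mono (r :: nat \<Rightarrow> nat)"
    "\<And>t. t \<in> {0..T} \<Longrightarrow> (\<lambda>n. LINT \<omega>|P. norm (X (r n) t \<omega> - XX t \<omega>)) \<longlonglongrightarrow> 0"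
    "\<And>t. t \<in> {0..T} \<Longrightarrow> (\<lambda>n. Y (r n) t) \<longlonglongrightarrow> YY t"
    "continuous_on {0..T} YY" "L1_continuous P T XX"
    "\<And>t. t \<in> {0..T} \<Longrightarrow> XX t \<in> borel_measurable (Fl t)"
    "\<And>\<omega>. \<omega> \<in> space P \<Longrightarrow> continuous_on {0..T} (\<lambda>t. XX t \<omega>)"
    "\<And>t \<omega>. t \<in> {0..T} \<Longrightarrow> \<omega> \<in> space P \<Longrightarrow>
      set_integrable lborel {0..t} (\<lambda>s. follower_drift H1 K1 (law P (XX s)) (YY s) (XX s \<omega>)) \<and>
      XX t \<omega> = free t \<omega> + (LINT s:{0..t}|lborel. follower_drift H1 K1 (law P (XX s)) (YY s) (XX s \<omega>))"
proof -
  have ints: "\<forall>n. \<forall>t\<in>{0..T}. integrable P (X n t)" using int by blast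
  obtain r b YY B where r: "strict_mono (r :: nat \<Rightarrow> nat)"
    and *: "\<forall>t\<in>{0..T}. (\<forall>x. (\<lambda>n. follower_drift H1 K1 (law P (X (r n) t)) (Y (r n) t) x) \<longlonglongrightarrow> b t x) \<and>
      (\<lambda>n. Y (r n) t) \<longlonglongrightarrow> YY t \<and>
      (\<forall>n. norm (follower_drift H1 K1 (law P (X n t)) (Y n t) 0) \<le> B)"
    using drift_fields_convergent_subsequence[of X Y, OF ctl ints spread] by (elim exE conjE)
  have b_lim: "(\<lambda>n. follower_drift H1 K1 (law P (X (r n) t)) (Y (r n) t) x) \<longlonglongrightarrow> b t x"
    and Y_lim: "(\<lambda>n. Y (r n) t) \<longlonglongrightarrow> YY t"
    and bn0: "norm (follower_drift H1 K1 (law P (X n t)) (Y n t) 0) \<le> B" if "t \<in> {0..T}" for n t x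
    using * that by blast+
  define bn where "bn n t x = follower_drift H1 K1 (law P (X (r n) t)) (Y (r n) t) x" for n t x
  have lim: "(\<lambda>n. bn n t x) \<longlonglongrightarrow> b t x" if "t \<in> {0..T}" for t x
    using b_lim[OF that] by (simp add: bn_def)
  have bn_diff: "norm (bn n t x - bn n s x') \<le> L * (2 * norm (x - x') + 2 * modulus s t)"
    if "s \<in> {0..T}" "t \<in> {0..T}" for n s t x x'
  proof -
    have "norm (bn n t x - bn n s x') \<le> L * (2 * norm (x - x') + norm (Y (r n) t - Y (r n) s) +
        (LINT \<omega>|P. norm (X (r n) t \<omega> - X (r n) s \<omega>)))"
      unfolding bn_def by (rule follower_drift_lipschitz[OF int[OF that(2)] int[OF that(1)]])
    also have "\<dots> \<le> L * (2 * norm (x - x') + modulus s t + modulus s t)"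
      using ctl[of "r n"] that by (intro mult_left_mono add_mono L) (auto simp: controlled_def)
    finally show ?thesis by (simp only: mult_2 add.assoc)
  qed
  have b_diff: "norm (b t x - b s x') \<le> L * (2 * norm (x - x') + 2 * modulus s t)"
    if "s \<in> {0..T}" "t \<in> {0..T}" for s t x x'
  proof (rule LIMSEQ_le_const2)
    show "(\<lambda>n. norm (bn n t x - bn n s x')) \<longlonglongrightarrow> norm (b t x - b s x')"
      using that by (intro tendsto_intros lim)
  qed (use bn_diff that in blast)
  have modulus_refl: "modulus t t = 0" for t by (simp add: modulus_def)
  have b_lip: "norm (b t x - b t x') \<le> 2 * L * norm (x - x')" if "t \<in> {0..T}" for t x x'
    using b_diff[OF that that, of x x'] by (simp add: modulus_refl)
  have bn_lip: "norm (bn n t x - bn n t x') \<le> 2 * L * norm (x - x')" if "t \<in> {0..T}" for n t x x'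
    using bn_diff[OF that that, of n x x'] by (simp add: modulus_refl)
  have mod_lim: "((\<lambda>s. modulus t s) \<longlongrightarrow> 0) (at t within {0..T})" if t: "t \<in> {0..T}" for t
  proof (rule tendstoI)
    fix e :: real assume "e > 0"
    then obtain d where d: "0 < d" "\<And>s. s \<in> {0..T} \<Longrightarrow> \<bar>s - t\<bar> < d \<Longrightarrow> modulus t s < e"
      using modulus_tendsto[OF t] by blast
    \<comment> \<open>The sign is read off from one trajectory, whose increments
      \<open>modulus\<close> dominates.\<close>
    have "0 \<le> modulus t s" if "s \<in> {0..T}" for s
      using ctl[of 0] t that norm_ge_zero order_trans unfolding controlled_def by blast
    then show "\<forall>\<^sub>F s in at t within {0..T}. dist (modulus t s) 0 < e"
      unfolding eventually_at using d by (intro exI[of _ d]) (auto simp: dist_real_def)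
  qed
  have Y_mod: "norm (YY t - YY s) \<le> modulus s t" if "s \<in> {0..T}" "t \<in> {0..T}" for s t
  proof (rule LIMSEQ_le_const2)
    show "(\<lambda>n. norm (Y (r n) t - Y (r n) s)) \<longlonglongrightarrow> norm (YY t - YY s)"
      using that by (intro tendsto_intros Y_lim)
  qed (use ctl that in \<open>auto simp: controlled_def\<close>)
  have YY: "continuous_on {0..T} YY"
    unfolding continuous_on_def
  proof
    fix t assume t: "t \<in> {0..T}"
    have "((\<lambda>s. YY s - YY t) \<longlongrightarrow> 0) (at t within {0..T})"
      by (rule Lim_null_comparison[OF _ mod_lim[OF t]])
        (use Y_mod[OF t] in \<open>auto simp: eventually_at_filter intro!: always_eventually\<close>)
    then show "(YY \<longlongrightarrow> YY t) (at t within {0..T})" by (rule LIM_zero_cancel)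
  qed
  have b_cont: "continuous_on {0..T} (\<lambda>t. b t x)" for x
    unfolding continuous_on_def
  proof
    fix t assume t: "t \<in> {0..T}"
    have l: "((\<lambda>s. L * (2 * norm (x - x) + 2 * modulus t s)) \<longlongrightarrow> L * (2 * norm (x - x) + 2 * 0)) (at t within {0..T})"
      by (intro tendsto_intros mod_lim[OF t])
    have "((\<lambda>s. b s x - b t x) \<longlongrightarrow> 0) (at t within {0..T})"
    proof (rule Lim_null_comparison)
      show "\<forall>\<^sub>F s in at t within {0..T}. norm (b s x - b t x) \<le> L * (2 * norm (x - x) + 2 * modulus t s)"
        using b_diff[OF t] by (auto simp only: eventually_at_filter intro!: always_eventually)
    qed (use l in simp)
    then show "((\<lambda>s. b s x) \<longlongrightarrow> b t x) (at t within {0..T})" by (rule LIM_zero_cancel)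
  qed
  have b0: "norm (b t 0) \<le> B" if "t \<in> {0..T}" for t
    by (rule LIMSEQ_le_const2[OF tendsto_norm[OF lim[OF that]]]) (use bn0[OF that] in \<open>auto simp: bn_def\<close>)
  have B: "0 \<le> B" using order_trans[OF norm_ge_zero b0[of 0]] T by simp
  interpret M: mckean_vlasov P Fl T free "\<lambda>t \<xi>. b t" "2 * L" B free_bound
    by (rule decoupled[OF b_lip b0 b_cont]) (use L B in auto)
  obtain XX where dom: "M.dominated M.solution_bound XX"
    and XX: "\<And>t \<omega>. t \<in> {0..T} \<Longrightarrow> \<omega> \<in> space P \<Longrightarrow> XX t \<omega> = free t \<omega> + M.drift_integral XX t \<omega>"
    using M.solution_exists by blast
  note XXc = M.dominated_cont[OF dom]
  have XX_L1: "L1_continuous P T XX" by (rule M.dominated_L1_continuous[OF dom])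
  have X_L1: "L1_continuous P T (X n)" for n
    using free_L1 int cont free_cont spread
    by (rule L1_continuous_dominated) (use ctl[of n] in \<open>auto simp only: controlled_def intro!: AE_I2\<close>)
  have Y_cont: "continuous_on {0..T} (Y n)" for n
    unfolding continuous_on_def
  proof
    fix t assume t: "t \<in> {0..T}"
    have "((\<lambda>s. Y n s - Y n t) \<longlongrightarrow> 0) (at t within {0..T})"
      by (rule Lim_null_comparison[OF _ mod_lim[OF t]])
        (use ctl[of n] t in \<open>auto simp: controlled_def eventually_at_filter intro!: always_eventually\<close>)
    then show "(Y n \<longlongrightarrow> Y n t) (at t within {0..T})" by (rule LIM_zero_cancel)
  qed
  have bn_cont: "continuous_on {0..T} (\<lambda>t. bn n t x)" for n x
    unfolding bn_def by (rule follower_drift_continuous[OF X_L1 Y_cont])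
  have path: "(\<lambda>n. X (r n) t \<omega>) \<longlonglongrightarrow> XX t \<omega>" if w: "\<omega> \<in> space P" and t: "t \<in> {0..T}" for \<omega> t
  proof -
    let ?u = "\<lambda>n s. norm (X (r n) s \<omega> - XX s \<omega>)"
    let ?e = "\<lambda>n s. norm (bn n s (XX s \<omega>) - b s (XX s \<omega>))"
    \<comment> \<open>The two fields are compared along the limit path, which does not move with n;
      so pointwise convergence of the fields and domination are enough.\<close>
    define \<delta> where "\<delta> n = (LINT s:{0..T}|lborel. ?e n s)" for n
    have e_cont: "continuous_on {0..T} (?e n)" for n
      by (intro continuous_intros continuous_on_lipschitz_compose[OF bn_cont XXc[OF w] bn_lip]
          continuous_on_lipschitz_compose[OF b_cont XXc[OF w] b_lip]) auto
    have u_cont: "continuous_on {0..T} (?u n)" for n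
      by (intro continuous_intros cont XXc w)
    obtain K where K: "0 \<le> K" "\<And>s. s \<in> {0..T} \<Longrightarrow> norm (XX s \<omega>) \<le> K"
      using continuous_on_bounded_interval[OF XXc[OF w]] by blast
    have "\<delta> \<longlonglongrightarrow> (LINT s|(lborel::real measure). 0)"
      unfolding \<delta>_def set_lebesgue_integral_def
    proof (rule integral_dominated_convergence[where w = "\<lambda>s. indicator {0..T} s *\<^sub>R (2 * (B + 2 * L * K))"])
      show "integrable lborel (\<lambda>s. indicator {0..T} s *\<^sub>R (2 * (B + 2 * L * K)))"
        using set_integrable_continuous_interval[of 0 T "\<lambda>_. 2 * (B + 2 * L * K)"] by (simp add: set_integrable_def)
      show "(\<lambda>s. indicator {0..T} s *\<^sub>R ?e n s) \<in> borel_measurable lborel" for n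
        using set_integrable_continuous_interval[OF e_cont] by (auto simp: set_integrable_def)
      show "AE s in lborel. (\<lambda>n. indicator {0..T} s *\<^sub>R ?e n s) \<longlonglongrightarrow> 0"
      proof (rule AE_I2)
        fix s :: real
        have "(\<lambda>n. ?e n s) \<longlonglongrightarrow> norm (b s (XX s \<omega>) - b s (XX s \<omega>))" if "s \<in> {0..T}"
          by (intro tendsto_intros lim[OF that])
        then show "(\<lambda>n. indicator {0..T} s *\<^sub>R ?e n s) \<longlonglongrightarrow> 0"
          by (cases "s \<in> {0..T}") auto
      qed
      show "AE s in lborel. norm (indicator {0..T} s *\<^sub>R ?e n s) \<le> indicator {0..T} s *\<^sub>R (2 * (B + 2 * L * K))" for n
      proof (rule AE_I2)
        fix s :: real
        have "?e n s \<le> 2 * (B + 2 * L * K)" if s: "s \<in> {0..T}"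
        proof -
          have LK: "2 * L * norm (XX s \<omega>) \<le> 2 * L * K" using L K(2)[OF s] by (intro mult_left_mono) auto
          have "norm (bn n s (XX s \<omega>)) \<le> B + 2 * L * K"
            using bn_lip[OF s, of n "XX s \<omega>" 0] bn0[OF s, of "r n"] LK
              norm_triangle_ineq2[of "bn n s (XX s \<omega>)" "bn n s 0"] by (simp add: bn_def)
          moreover have "norm (b s (XX s \<omega>)) \<le> B + 2 * L * K"
            using b_lip[OF s, of "XX s \<omega>" 0] b0[OF s] LK
              norm_triangle_ineq2[of "b s (XX s \<omega>)" "b s 0"] by simp
          ultimately show ?thesis
            using norm_triangle_ineq4[of "bn n s (XX s \<omega>)" "b s (XX s \<omega>)"] by argo
        qed
        then show "norm (indicator {0..T} s *\<^sub>R ?e n s) \<le> indicator {0..T} s *\<^sub>R (2 * (B + 2 * L * K))"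
          by (cases "s \<in> {0..T}") auto
      qed
    qed simp
    then have \<delta>: "\<delta> \<longlonglongrightarrow> 0" by simp
    have "?u n t \<le> \<delta> n * exp (2 * L * t)" for n
    proof (rule Gronwall_integral[OF u_cont _ _ t])
      fix t assume t: "t \<in> {0..T}"
      have sub: "{0..t} \<subseteq> {0..T}" using t by auto
      have ei: "set_integrable lborel {0..t} (?e n)"
        by (rule set_integrable_continuous_interval[OF continuous_on_subset[OF e_cont sub]])
      have ui: "set_integrable lborel {0..t} (?u n)"
        by (rule set_integrable_continuous_interval[OF continuous_on_subset[OF u_cont sub]])
      have Xi: "set_integrable lborel {0..t} (\<lambda>s. bn n s (X (r n) s \<omega>))"
        and Xe: "X (r n) t \<omega> = free t \<omega> + (LINT s:{0..t}|lborel. bn n s (X (r n) s \<omega>))"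
        using ctl[of "r n"] t w unfolding controlled_def bn_def by blast+
      note XXi = M.drift_set_integrable[OF dom w t]
      have "?u n t = norm (LINT s:{0..t}|lborel. bn n s (X (r n) s \<omega>) - b s (XX s \<omega>))"
        using Xe XX[OF t w] set_integral_diff(2)[OF Xi XXi] by (simp add: M.drift_integral_def)
      also have "\<dots> \<le> (LINT s:{0..t}|lborel. 2 * L * ?u n s + ?e n s)"
      proof (rule set_integral_norm_le[OF set_integral_diff(1)[OF Xi XXi] set_integral_add(1)[OF set_integrable_mult_right ei]])
        show "set_integrable lborel {0..t} (?u n)" by (rule ui)
        fix s assume "s \<in> {0..t}"
        then have s: "s \<in> {0..T}" using t by auto
        show "norm (bn n s (X (r n) s \<omega>) - b s (XX s \<omega>)) \<le> 2 * L * ?u n s + ?e n s"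
          using bn_lip[OF s, of n "X (r n) s \<omega>" "XX s \<omega>"]
            norm_triangle_ineq[of "bn n s (X (r n) s \<omega>) - bn n s (XX s \<omega>)" "bn n s (XX s \<omega>) - b s (XX s \<omega>)"] by simp
      qed
      also have "\<dots> = 2 * L * integral {0..t} (?u n) + (LINT s:{0..t}|lborel. ?e n s)"
        using set_integral_add(2)[OF set_integrable_mult_right[OF ui, of "2 * L"] ei]
          set_borel_integral_eq_integral(2)[OF ui] by simp
      also have "(LINT s:{0..t}|lborel. ?e n s) \<le> \<delta> n"
        unfolding \<delta>_def set_lebesgue_integral_def
      proof (rule integral_mono)
        show "integrable lborel (\<lambda>s. indicator {0..t} s *\<^sub>R ?e n s)"
          and "integrable lborel (\<lambda>s. indicator {0..T} s *\<^sub>R ?e n s)"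
          using ei set_integrable_continuous_interval[OF e_cont] by (auto simp: set_integrable_def)
      qed (use t in \<open>auto simp: indicator_def\<close>)
      finally show "?u n t \<le> \<delta> n + 2 * L * integral {0..t} (?u n)" by simp
    qed (use L in auto)
    then have le: "\<forall>\<^sub>F n in sequentially. norm (X (r n) t \<omega> - XX t \<omega>) \<le> \<delta> n * exp (2 * L * t)"
      by simp
    have "(\<lambda>n. X (r n) t \<omega> - XX t \<omega>) \<longlonglongrightarrow> 0"
      by (rule Lim_null_comparison[OF le tendsto_mult_left_zero[OF \<delta>]])
    then show ?thesis by (rule LIM_zero_cancel)
  qed
  have L1: "(\<lambda>n. LINT \<omega>|P. norm (X (r n) t \<omega> - XX t \<omega>)) \<longlonglongrightarrow> 0" if t: "t \<in> {0..T}" for t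
  proof -
    have "(\<lambda>n. LINT \<omega>|P. norm (X (r n) t \<omega> - XX t \<omega>)) \<longlonglongrightarrow> (LINT \<omega>|P. 0)"
    proof (rule integral_dominated_convergence[where w = "\<lambda>\<omega>. spread \<omega> + M.solution_bound \<omega>"])
      show "integrable P (\<lambda>\<omega>. spread \<omega> + M.solution_bound \<omega>)"
        using spread M.dominated_Q[OF dom] by auto
      show "AE \<omega> in P. norm (norm (X (r n) t \<omega> - XX t \<omega>)) \<le> spread \<omega> + M.solution_bound \<omega>" for n
      proof (rule AE_I2)
        fix \<omega> assume w: "\<omega> \<in> space P"
        have "norm (X (r n) t \<omega> - free t \<omega>) \<le> spread \<omega>"
          using ctl[of "r n"] t w unfolding controlled_def by blast
        then show "norm (norm (X (r n) t \<omega> - XX t \<omega>)) \<le> spread \<omega> + M.solution_bound \<omega>"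
          using M.dominated_le[OF dom t w] norm_triangle_ineq4[of "X (r n) t \<omega> - free t \<omega>" "XX t \<omega> - free t \<omega>"] by simp
      qed
      show "AE \<omega> in P. (\<lambda>n. norm (X (r n) t \<omega> - XX t \<omega>)) \<longlonglongrightarrow> 0"
        by (intro AE_I2 tendsto_norm_zero LIM_zero path t)
      show "(\<lambda>\<omega>. norm (X (r n) t \<omega> - XX t \<omega>)) \<in> borel_measurable P" for n
        using int[OF t] M.dominated_meas[OF dom t] by auto
    qed simp
    then show ?thesis by simp
  qed
  have b_eq: "b t x = follower_drift H1 K1 (law P (XX t)) (YY t) x" if t: "t \<in> {0..T}" for t x
  proof -
    have XXi: "integrable P (XX t)" by (rule M.dominated_integrable[OF dom t])
    have "(\<lambda>n. L * (2 * norm (x - x) + norm (Y (r n) t - YY t) + (LINT \<omega>|P. norm (X (r n) t \<omega> - XX t \<omega>)))) \<longlonglongrightarrow>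
        L * (2 * norm (x - x) + norm (YY t - YY t) + 0)"
      by (intro tendsto_intros Y_lim[OF t] L1[OF t])
    then have l: "(\<lambda>n. L * (2 * norm (x - x) + norm (Y (r n) t - YY t) + (LINT \<omega>|P. norm (X (r n) t \<omega> - XX t \<omega>)))) \<longlonglongrightarrow> 0"
      by simp
    have "(\<lambda>n. bn n t x - follower_drift H1 K1 (law P (XX t)) (YY t) x) \<longlonglongrightarrow> 0"
      by (rule Lim_null_comparison[OF _ l])
        (unfold bn_def, intro always_eventually allI follower_drift_lipschitz[OF int[OF t] XXi])
    then have "(\<lambda>n. bn n t x) \<longlonglongrightarrow> follower_drift H1 K1 (law P (XX t)) (YY t) x"
      by (rule LIM_zero_cancel)
    then show ?thesis using lim[OF t] LIMSEQ_unique by blast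
  qed
  show thesis
  proof (rule that[OF r L1 Y_lim YY XX_L1 M.dominated_adapted[OF dom] XXc])
    fix t \<omega> assume t: "t \<in> {0..T}" and w: "\<omega> \<in> space P"
    have eq: "b s (XX s \<omega>) = follower_drift H1 K1 (law P (XX s)) (YY s) (XX s \<omega>)" if "s \<in> {0..t}" for s
      using b_eq[of s] that t by auto
    have "set_integrable lborel {0..t} (\<lambda>s. follower_drift H1 K1 (law P (XX s)) (YY s) (XX s \<omega>))"
      using M.drift_set_integrable[OF dom w t]
      by (rule set_integrable_cong[THEN iffD1, rotated -1]) (use eq in auto)
    moreover have "M.drift_integral XX t \<omega> = (LINT s:{0..t}|lborel. follower_drift H1 K1 (law P (XX s)) (YY s) (XX s \<omega>))"
      unfolding M.drift_integral_def by (rule set_lebesgue_integral_cong) (use eq in auto)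
    ultimately show "set_integrable lborel {0..t} (\<lambda>s. follower_drift H1 K1 (law P (XX s)) (YY s) (XX s \<omega>)) \<and>
      XX t \<omega> = free t \<omega> + (LINT s:{0..t}|lborel. follower_drift H1 K1 (law P (XX s)) (YY s) (XX s \<omega>))"
      using XX[OF t w] by simp
  qed auto
qed

end

section \<open>Weak limits of controls\<close>

text \<open>Lower semicontinuity for all convex integrands at once. The limit hs is chosen before
  \<Phi>, so the same control serves the leaders' equations at all times and the cost. A convex
  \<Phi> keeps midpoint combinations of a tail below any bound for the integrals over that tail; the
  combinations converge almost everywhere, and domination on K finishes the argument.\<close>

lemma weak_limit_controls:
  fixes H :: "nat \<Rightarrow> real \<Rightarrow> 'e::euclidean_space"
  assumes K: "compact K" "convex K" and H: "\<And>n. H n \<in> borel_measurable borel" "\<And>n s. H n s \<in> K"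
  shows "\<exists>hs. hs \<in> borel_measurable borel \<and> (\<forall>s. hs s \<in> K) \<and>
    (\<forall>\<Phi> c M. (\<forall>v. (\<lambda>s. indicator {0..T} s *\<^sub>R \<Phi> s v) \<in> borel_measurable borel) \<longrightarrow>
      (\<forall>s\<in>{0..T}. continuous_on UNIV (\<Phi> s) \<and> convex_on UNIV (\<Phi> s) \<and> (\<forall>v\<in>K. \<bar>\<Phi> s v\<bar> \<le> M)) \<longrightarrow>
      (\<lambda>n. LINT s:{0..T}|lborel. \<Phi> s (H n s)) \<longlonglongrightarrow> c \<longrightarrow>
      (LINT s:{0..T}|lborel. \<Phi> s (hs s)) \<le> (c::real))"
proof -
  let ?M = "restrict_space lborel {0..T}"
  have "emeasure lborel {0..T} < \<infinity>" by (simp add: emeasure_lborel_Icc_eq)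
  then have fin: "finite_measure ?M"
    by (intro finite_measureI) (simp add: emeasure_restrict_space space_restrict_space)
  have Hm: "H n \<in> borel_measurable ?M" for n
    using H(1)[of n] by (intro measurable_restrict_space1) simp
  obtain k h0 where k: "\<And>n. k n \<in> midpoint_hull (H ` {n..})" and h0: "h0 \<in> borel_measurable ?M"
    and lim: "AE s in ?M. (\<lambda>n. k n s) \<longlonglongrightarrow> h0 s"
    using midpoint_hull_AE_convergent[of ?M H K, OF fin Hm K H(2)] by blast
  define u0 where "u0 = H 0 0"
  define f where "f s = indicator {0..T} s *\<^sub>R h0 s" for s
  have f: "f \<in> borel_measurable borel"
  proof -
    have "(\<lambda>s. indicator {0..T} s *\<^sub>R h0 s) \<in> borel_measurable lborel"
      using h0 by (subst (asm) borel_measurable_restrict_space_iff) auto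
    then show ?thesis by (simp add: f_def[abs_def])
  qed
  \<comment> \<open>Redefined off {0..T} and wherever the limit leaves K, which inside {0..T}
    happens only on a null set. The default u0 is a value of H and hence in K.\<close>
  define hs where "hs s = (if s \<in> {0..T} \<and> f s \<in> K then f s else u0)" for s
  have "K \<in> sets borel" using compact_imp_closed[OF K(1)] by (rule borel_closed)
  then have hs: "hs \<in> borel_measurable borel"
    unfolding hs_def[abs_def] using f by measurable
  have hsK: "hs s \<in> K" for s using H(2) by (simp add: hs_def u0_def)
  have klim: "AE s in lborel. s \<in> {0..T} \<longrightarrow> (\<lambda>n. k n s) \<longlonglongrightarrow> hs s"
  proof -
    have kK: "k n s \<in> K" for n s
      using midpoint_hull_mem[OF K(2) _ k, of n UNIV s] H(2) by blast
    have "AE s in lborel. s \<in> {0..T} \<longrightarrow> (\<lambda>n. k n s) \<longlonglongrightarrow> h0 s"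
      using lim by (subst (asm) AE_restrict_space_iff) auto
    then show ?thesis
    proof eventually_elim
      case (elim s)
      show ?case
      proof
        assume s: "s \<in> {0..T}"
        then have l: "(\<lambda>n. k n s) \<longlonglongrightarrow> h0 s" using elim by blast
        then have "h0 s \<in> K"
          by (intro closed_sequentially[OF compact_imp_closed[OF K(1)] _ l]) (use kK in auto)
        then show "(\<lambda>n. k n s) \<longlonglongrightarrow> hs s" using l s by (simp add: hs_def f_def)
      qed
    qed
  qed
  have "(LINT s:{0..T}|lborel. \<Phi> s (hs s)) \<le> c"
    if meas: "\<forall>v. (\<lambda>s. indicator {0..T} s *\<^sub>R \<Phi> s v) \<in> borel_measurable borel"
      and \<Phi>: "\<forall>s\<in>{0..T}. continuous_on UNIV (\<Phi> s) \<and> convex_on UNIV (\<Phi> s) \<and> (\<forall>v\<in>K. \<bar>\<Phi> s v\<bar> \<le> M)"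
      and c: "(\<lambda>n. LINT s:{0..T}|lborel. \<Phi> s (H n s)) \<longlonglongrightarrow> c"
    for \<Phi> :: "real \<Rightarrow> 'e \<Rightarrow> real" and c M :: real
  proof -
    have cont: "continuous_on UNIV (\<Phi> s)" and conv: "convex_on UNIV (\<Phi> s)" if "s \<in> {0..T}" for s
      using \<Phi> that by auto
    have bound: "\<bar>\<Phi> s v\<bar> \<le> M" if "s \<in> {0..T}" "v \<in> K" for s v
      using \<Phi> that by auto
    have Phi_meas: "(\<lambda>s. indicator {0..T} s *\<^sub>R \<Phi> s (f s)) \<in> borel_measurable lborel" if f: "f \<in> borel_measurable borel" for f
    proof -
      have "(\<lambda>s. (\<lambda>s v. indicator {0..T} s *\<^sub>R \<Phi> s v) s (f s)) \<in> borel_measurable borel"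
      proof (rule borel_measurable_Caratheodory[OF f meas[rule_format]])
        show "continuous_on UNIV (\<lambda>v. indicator {0..T} s *\<^sub>R \<Phi> s v)" for s
          by (cases "s \<in> {0..T}") (auto intro!: continuous_intros cont)
      qed
      then show ?thesis by simp
    qed
    have Phi_int: "set_integrable lborel {0..T} (\<lambda>s. \<Phi> s (f s))" if f: "f \<in> borel_measurable borel" "\<And>s. f s \<in> K" for f
      using Phi_meas[OF f(1)] bound f(2)
      by (intro set_integrable_bounded_interval[where K = M]) (auto simp: set_borel_measurable_def)
    \<comment> \<open>Measurability and values in K are part of the induction because the convexity
      step needs integrability of both halves.\<close>
    have hull: "f \<in> borel_measurable borel \<and> (\<forall>s. f s \<in> K) \<and> (LINT s:{0..T}|lborel. \<Phi> s (f s)) \<le> a"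
      if "f \<in> midpoint_hull (H ` {N..})" "\<And>n. n \<ge> N \<Longrightarrow> (LINT s:{0..T}|lborel. \<Phi> s (H n s)) \<le> a" for f N a
      using that(1)
    proof induction
      case (base f)
      then show ?case using H that(2) by auto
    next
      case (midpoint f g)
      then have f: "f \<in> borel_measurable borel" "\<And>s. f s \<in> K" and g: "g \<in> borel_measurable borel" "\<And>s. g s \<in> K"
        by auto
      let ?m = "\<lambda>s. (1/2) *\<^sub>R (f s + g s)"
      have m: "?m \<in> borel_measurable borel" "\<And>s. ?m s \<in> K"
        using f g convex_midpoint[OF K(2)] by auto
      have i: "set_integrable lborel {0..T} (\<lambda>s. (1/2) * \<Phi> s (f s))" "set_integrable lborel {0..T} (\<lambda>s. (1/2) * \<Phi> s (g s))"
        using Phi_int[OF f] Phi_int[OF g] by (intro set_integrable_mult_right; simp)+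
      have "(LINT s:{0..T}|lborel. \<Phi> s (?m s)) \<le> (LINT s:{0..T}|lborel. (1/2) * \<Phi> s (f s) + (1/2) * \<Phi> s (g s))"
      proof (rule set_integral_mono[OF Phi_int[OF m] set_integral_add(1)[OF i]])
        fix s assume "s \<in> {0..T}"
        then show "\<Phi> s (?m s) \<le> (1/2) * \<Phi> s (f s) + (1/2) * \<Phi> s (g s)"
          using convex_onD[OF conv, of s "1/2" "f s" "g s"] by (simp add: scaleR_add_right)
      qed
      also have "\<dots> = (1/2) * (LINT s:{0..T}|lborel. \<Phi> s (f s)) + (1/2) * (LINT s:{0..T}|lborel. \<Phi> s (g s))"
        unfolding set_integral_add(2)[OF i] by simp
      also have "\<dots> \<le> a" using midpoint.IH by simp
      finally show ?case using m by blast
    qed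
    have km: "k n \<in> borel_measurable borel" "\<And>s. k n s \<in> K" for n
      using midpoint_hull_measurable[OF _ k[of n], of borel] midpoint_hull_mem[OF K(2) _ k[of n], of UNIV] H by auto
    have kc: "(\<lambda>n. LINT s:{0..T}|lborel. \<Phi> s (k n s)) \<longlonglongrightarrow> (LINT s:{0..T}|lborel. \<Phi> s (hs s))"
      unfolding set_lebesgue_integral_def
    proof (rule integral_dominated_convergence[where w = "\<lambda>s. indicator {0..T} s *\<^sub>R M"])
      show "integrable lborel (\<lambda>s. indicator {0..T} s *\<^sub>R M)"
        using set_integrable_continuous_interval[of 0 T "\<lambda>_. M"] by (simp add: set_integrable_def)
      show "AE s in lborel. (\<lambda>n. indicator {0..T} s *\<^sub>R \<Phi> s (k n s)) \<longlonglongrightarrow> indicator {0..T} s *\<^sub>R \<Phi> s (hs s)"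
        using klim
      proof eventually_elim
        case (elim s)
        show ?case
        proof (cases "s \<in> {0..T}")
          case True
          then have "isCont (\<Phi> s) (hs s)" using cont by (simp add: continuous_on_eq_continuous_at)
          from isCont_tendsto_compose[OF this] show ?thesis using elim True by simp
        qed simp
      qed
      show "AE s in lborel. norm (indicator {0..T} s *\<^sub>R \<Phi> s (k n s)) \<le> indicator {0..T} s *\<^sub>R M" for n
        using bound km(2) by (intro AE_I2) (auto simp: indicator_def)
    qed (use Phi_meas hs km in auto)
    show "(LINT s:{0..T}|lborel. \<Phi> s (hs s)) \<le> c"
    proof (rule field_le_epsilon)
      fix e :: real assume "0 < e"
      then have "\<forall>\<^sub>F n in sequentially. (LINT s:{0..T}|lborel. \<Phi> s (H n s)) < c + e"
        using order_tendstoD(2)[OF c, of "c + e"] by simp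
      then obtain N where N: "\<And>n. n \<ge> N \<Longrightarrow> (LINT s:{0..T}|lborel. \<Phi> s (H n s)) \<le> c + e"
        unfolding eventually_sequentially by (meson less_imp_le)
      have "(LINT s:{0..T}|lborel. \<Phi> s (k n s)) \<le> c + e" if "n \<ge> N" for n
        using hull[OF _ N, of "k n"] k[of n] midpoint_hull_mono[of "H ` {n..}" "H ` {N..}"] that by fastforce
      then show "(LINT s:{0..T}|lborel. \<Phi> s (hs s)) \<le> c + e"
        by (intro LIMSEQ_le_const2[OF kc]) blast
    qed
  qed
  then show ?thesis using hs hsK by blast
qed

section \<open>Cost and value of a control\<close>

locale optimal_control = control_problem P Fl W T \<sigma> Mb Lb L KU H1 H2 K1 K2 X0 Y0 U
  for P :: "'w measure" and Fl :: "real \<Rightarrow> 'w measure" and W :: "real \<Rightarrow> 'w \<Rightarrow> real^'d"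
    and T \<sigma> Mb Lb L KU :: real
    and H1 H2 K1 K2 :: "real^'d \<Rightarrow> real^'d"
    and X0 :: "'w \<Rightarrow> real^'d" and Y0 :: "(real^'d)^'m" and U :: "(real^'l^'d) set" +
  fixes Lc :: "real \<Rightarrow> (real^'d)^'m \<Rightarrow> (real^'d) measure \<Rightarrow> real"
    and \<Psi> :: "(real^'l^'d)^'m \<Rightarrow> (real^'l)^'m \<Rightarrow> real"
  assumes U: "compact U" "convex U" "U \<noteq> {}"
    and Lc: "continuous_map
           (prod_topology (top_of_set {0..T}) (prod_topology euclidean (wasserstein_topology 1)))
           euclidean (\<lambda>(t, y, \<mu>). Lc t y \<mu>)"
    and Psi_cont: "continuous_on UNIV (\<lambda>(a, b). \<Psi> a b)"
    and Psi_convex: "\<And>b. convex_on UNIV (\<lambda>a. \<Psi> a b)"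
begin

abbreviation cost where
  "cost h g X Y \<equiv> trajectory_cost T Lc \<Psi> h g (\<lambda>t. law P (X t)) Y"

abbreviation optimal_value where
  "optimal_value h g \<equiv> cost_functional P Fl W T \<sigma> H1 H2 K1 K2 X0 Y0 Lc \<Psi> h g"

text \<open>Stated for an arbitrary filter because it is used twice: for times tending to t on one
  trajectory, and for a sequence of trajectories evaluated at moving times.\<close>

lemma running_cost_tendsto:
  assumes a: "(a \<longlongrightarrow> t) G" "\<forall>\<^sub>F x in G. a x \<in> {0..T}" "t \<in> {0..T}" and y: "(y \<longlongrightarrow> yy) G"
    and \<xi>: "((\<lambda>x. LINT \<omega>|P. norm (\<xi> x \<omega> - \<zeta> \<omega>)) \<longlongrightarrow> 0) G"
    and int: "\<forall>\<^sub>F x in G. integrable P (\<xi> x)" "integrable P \<zeta>"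
  shows "((\<lambda>x. Lc (a x) (y x) (law P (\<xi> x))) \<longlongrightarrow> Lc t yy (law P \<zeta>)) G"
proof -
  have "limitin (wasserstein_topology 1) (\<lambda>x. law P (\<xi> x)) (law P \<zeta>) G"
  proof (rule limitin_wasserstein_topology[OF _ _ \<xi>])
    show "\<forall>\<^sub>F x in G. law P (\<xi> x) \<in> wasserstein_space 1"
      using int(1) by eventually_elim (rule law_in_wasserstein_space)
    show "\<forall>\<^sub>F x in G. wasserstein_dist 1 (law P \<zeta>) (law P (\<xi> x)) \<le> (LINT \<omega>|P. norm (\<xi> x \<omega> - \<zeta> \<omega>))"
      using int(1)
    proof eventually_elim
      case (elim x)
      then show ?case using wasserstein_dist_law_le[OF int(2) elim] by (simp add: norm_minus_commute)
    qed
  qed (rule law_in_wasserstein_space[OF int(2)])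
  then have "limitin (prod_topology (top_of_set {0..T}) (prod_topology euclidean (wasserstein_topology 1)))
      (\<lambda>x. (a x, y x, law P (\<xi> x))) (t, yy, law P \<zeta>) G"
    using a y by (simp add: limitin_pairwise o_def limitin_subtopology)
  from continuous_map_limit[OF Lc this] show ?thesis by (simp add: o_def)
qed

lemma running_cost_continuous:
  assumes "L1_continuous P T X" "continuous_on {0..T} Y"
  shows "continuous_on {0..T} (\<lambda>t. Lc t (Y t) (law P (X t)))"
  unfolding continuous_on_def
proof
  fix t assume t: "t \<in> {0..T}"
  show "((\<lambda>s. Lc s (Y s) (law P (X s))) \<longlongrightarrow> Lc t (Y t) (law P (X t))) (at t within {0..T})"
    by (rule running_cost_tendsto)
      (use assms t in \<open>auto simp: L1_continuous_def continuous_on_def eventually_at_filter intro!: always_eventually\<close>)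
qed

lemma Psi_measurable:
  assumes "a \<in> borel_measurable M" "b \<in> borel_measurable M"
  shows "(\<lambda>s. \<Psi> (a s) (b s)) \<in> borel_measurable M"
  using assms by (rule borel_measurable_continuous_Pair) (use Psi_cont in \<open>simp add: case_prod_beta'\<close>)

lemma control_cost_measurable:
  assumes h: "\<And>i. (\<lambda>s. indicator {0..T} s *\<^sub>R h i s) \<in> borel_measurable borel"
    and c: "\<And>i. continuous_on {0..T} (c i)"
  shows "(\<lambda>s. indicator {0..T} s *\<^sub>R \<Psi> (\<chi> i. h i s) (\<chi> i. c i s)) \<in> borel_measurable lborel"
proof -
  have "(\<lambda>s. indicator {0..T} s *\<^sub>R \<Psi> (\<chi> i. h i s) (\<chi> i. c i s)) =
      (\<lambda>s. indicator {0..T} s *\<^sub>R \<Psi> (\<chi> i. indicator {0..T} s *\<^sub>R h i s) (\<chi> i. indicator {0..T} s *\<^sub>R c i s))"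
    by (auto simp: fun_eq_iff indicator_def)
  also have "\<dots> \<in> borel_measurable borel"
    by (intro borel_measurable_scaleR borel_measurable_indicator Psi_measurable borel_measurable_vec_lambda h
        borel_measurable_continuous_on_indicator c) auto
  finally show ?thesis by simp
qed

text \<open>\<open>SOME\<close> picks an unknown solution for h. The given solution for h' also
  solves the system for h, so the choice is a genuine solution; carried back to h' it is covered by
  uniqueness.\<close>

lemma optimal_value_eq:
  assumes h': "regular h'" and h: "\<And>i. (\<lambda>s. indicator {0..T} s *\<^sub>R h i s) \<in> borel_measurable borel"
    and eq: "\<And>i. AE s in lborel. s \<in> {0..T} \<longrightarrow> h i s = h' i s"
    and g: "\<And>i. g i \<in> feedback_maps Mb Lb" and mv: "mv h' g X Y"
  shows "optimal_value h g = cost h' g X Y"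
proof -
  have h'm: "(\<lambda>s. indicator {0..T} s *\<^sub>R h' i s) \<in> borel_measurable borel" for i
    using h' by (intro borel_measurable_scaleR) auto
  have eq': "AE s in lborel. s \<in> {0..T} \<longrightarrow> h' i s = h i s" for i
    using eq[of i] by eventually_elim simp
  obtain X' Y' where XY: "(SOME (X, Y). mv h g X Y) = (X', Y')" by fastforce
  have "case (X, Y) of (X, Y) \<Rightarrow> mv h g X Y"
    using mv_cong[OF mv g h'm h eq'] by simp
  from someI[of "\<lambda>(X, Y). mv h g X Y", OF this] have "mv h g X' Y'" by (simp add: XY)
  then have mv': "mv h' g X' Y'" using mv_cong[of h g X' Y' h', OF _ g h h'm eq] by blast
  have u: "law P (X' t) = law P (X t)" "Y' t = Y t" if "t \<in> {0..T}" for t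
    using mv_unique[OF h' g mv' mv that] by auto
  have "optimal_value h g = cost h g X' Y'"
    unfolding cost_functional_def XY by simp
  also have "\<dots> = cost h' g X Y"
    unfolding trajectory_cost_def
  proof (intro arg_cong2[where f = "(+)"])
    show "(LINT t:{0..T}|lborel. Lc t (Y' t) (law P (X' t))) = (LINT t:{0..T}|lborel. Lc t (Y t) (law P (X t)))"
      by (rule set_lebesgue_integral_cong) (use u in auto)
    have "(LINT t:{0..T}|lborel. \<Psi> (\<chi> i. h i t) (\<chi> i. g i (law P (X' t)))) =
        (LINT t:{0..T}|lborel. \<Psi> (\<chi> i. h i t) (\<chi> i. g i (law P (X t))))"
      by (rule set_lebesgue_integral_cong) (use u in auto)
    also have "\<dots> = (LINT t:{0..T}|lborel. \<Psi> (\<chi> i. h' i t) (\<chi> i. g i (law P (X t))))"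
      unfolding set_lebesgue_integral_def
    proof (rule integral_cong_AE)
      note c = feedback_continuous[OF g mv_L1_continuous[OF mv]]
      show "(\<lambda>s. indicator {0..T} s *\<^sub>R \<Psi> (\<chi> i. h i s) (\<chi> i. g i (law P (X s)))) \<in> borel_measurable lborel"
        by (rule control_cost_measurable[OF h c])
      show "(\<lambda>s. indicator {0..T} s *\<^sub>R \<Psi> (\<chi> i. h' i s) (\<chi> i. g i (law P (X s)))) \<in> borel_measurable lborel"
        by (rule control_cost_measurable[OF h'm c])
      have "AE s in lborel. \<forall>i. s \<in> {0..T} \<longrightarrow> h i s = h' i s"
        unfolding AE_all_countable using eq by blast
      then show "AE s in lborel. indicator {0..T} s *\<^sub>R \<Psi> (\<chi> i. h i s) (\<chi> i. g i (law P (X s))) =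
          indicator {0..T} s *\<^sub>R \<Psi> (\<chi> i. h' i s) (\<chi> i. g i (law P (X s)))"
        by eventually_elim (auto simp: indicator_def)
    qed
    finally show "(LINT t:{0..T}|lborel. \<Psi> (\<chi> i. h i t) (\<chi> i. g i (law P (X' t)))) =
        (LINT t:{0..T}|lborel. \<Psi> (\<chi> i. h' i t) (\<chi> i. g i (law P (X t))))" .
  qed
  finally show ?thesis .
qed

text \<open>An admissible control is known only on {0..T} and lies in U only almost everywhere
  there. Cutting it off by the indicator gives a Borel function, and values outside U are reset to a
  point of U.\<close>

lemma regular_representative:
  assumes "(h, g) \<in> admissible T U Mb Lb"
  obtains h' where "regular h'" "\<And>i. (\<lambda>s. indicator {0..T} s *\<^sub>R h i s) \<in> borel_measurable borel"
    "\<And>i. AE s in lborel. s \<in> {0..T} \<longrightarrow> h i s = h' i s"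
proof -
  obtain u0 where u0: "u0 \<in> U" using U(3) by blast
  define f where "f i s = indicator {0..T} s *\<^sub>R h i s" for i s
  have f: "f i \<in> borel_measurable borel" for i
  proof -
    have "integrable lborel (f i)"
      using assms unfolding admissible_def L1_controls_def set_integrable_def f_def by auto
    from borel_measurable_integrable[OF this] show ?thesis by simp
  qed
  have AE: "AE s in lborel. s \<in> {0..T} \<longrightarrow> h i s \<in> U" for i
    using assms unfolding admissible_def L1_controls_def by auto
  define h' where "h' i s = (if f i s \<in> U then f i s else u0)" for i s
  have [measurable]: "U \<in> sets borel" using compact_imp_closed[OF U(1)] by (rule borel_closed)
  show thesis
  proof (rule that[of h'])
    show "regular h'"
    proof (intro allI conjI)
      fix i
      note [measurable] = f[of i]
      show "h' i \<in> borel_measurable borel" unfolding h'_def[abs_def] by measurable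
      show "h' i s \<in> U" for s using u0 by (simp add: h'_def)
    qed
    show "(\<lambda>s. indicator {0..T} s *\<^sub>R h i s) \<in> borel_measurable borel" for i
      using f[of i] by (simp add: f_def[abs_def])
    show "AE s in lborel. s \<in> {0..T} \<longrightarrow> h i s = h' i s" for i
      using AE[of i] by eventually_elim (simp add: h'_def f_def)
  qed
qed

lemma regular_admissible:
  assumes h: "regular h" and g: "\<And>i. g i \<in> feedback_maps Mb Lb"
  shows "(h, g) \<in> admissible T U Mb Lb"
proof -
  obtain B where B: "\<And>u. u \<in> U \<Longrightarrow> norm u \<le> B"
    using compact_imp_bounded[OF U(1)] by (auto simp: bounded_iff)
  have "set_integrable lborel {0..T} (h i)" for i
  proof (rule set_integrable_bounded_interval)
    show "set_borel_measurable lborel {0..T} (h i)"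
      unfolding set_borel_measurable_def using h by (intro borel_measurable_scaleR) auto
  qed (use h B in auto)
  then show ?thesis
    using h g by (auto simp: admissible_def L1_controls_def)
qed

end

section \<open>Existence of an optimal control\<close>

lemma linear_imp_convex_on:
  fixes f :: "'a::euclidean_space \<Rightarrow> real"
  assumes "linear f" "convex S" shows "convex_on S f"
  using assms(2) by (intro convex_onI) (simp_all add: linear_add[OF assms(1)] linear_scale[OF assms(1)])

context control_problem
begin

lemma modulus_LIMSEQ:
  assumes "\<And>n. \<tau> n \<in> {0..T}" "\<tau> \<longlonglongrightarrow> t" and t: "t \<in> {0..T}" and nn: "\<And>s. s \<in> {0..T} \<Longrightarrow> 0 \<le> modulus t s"
  shows "(\<lambda>n. modulus t (\<tau> n)) \<longlonglongrightarrow> 0"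
proof (rule tendstoI)
  fix e :: real assume "e > 0"
  then obtain d where d: "0 < d" "\<And>s. s \<in> {0..T} \<Longrightarrow> \<bar>s - t\<bar> < d \<Longrightarrow> modulus t s < e"
    using modulus_tendsto[OF t] by blast
  have "\<forall>\<^sub>F n in sequentially. dist (\<tau> n) t < d" using tendstoD[OF assms(2) d(1)] .
  then show "\<forall>\<^sub>F n in sequentially. dist (modulus t (\<tau> n)) 0 < e"
    by eventually_elim (use d(2) nn assms(1) in \<open>auto simp: dist_real_def\<close>)
qed

end

context optimal_control
begin

lemma control_set:
  "compact {v :: (real^'l^'d)^'m. \<forall>i. v $ i \<in> U}" "convex {v :: (real^'l^'d)^'m. \<forall>i. v $ i \<in> U}"
proof -
  obtain B where B: "\<And>u. u \<in> U \<Longrightarrow> norm u \<le> B"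
    using compact_imp_bounded[OF U(1)] by (auto simp: bounded_iff)
  have "norm v \<le> real CARD('m) * B" if "\<forall>i. v $ i \<in> U" for v :: "(real^'l^'d)^'m"
  proof -
    have "norm v \<le> (\<Sum>i\<in>(UNIV::'m set). B)"
      by (rule order_trans[OF norm_vec_le_sum], rule sum_mono) (use that B in auto)
    then show ?thesis by simp
  qed
  then have "bounded {v :: (real^'l^'d)^'m. \<forall>i. v $ i \<in> U}"
    unfolding bounded_iff by blast
  moreover have "closed {v :: (real^'l^'d)^'m. \<forall>i. v $ i \<in> U}"
  proof -
    have "{v :: (real^'l^'d)^'m. \<forall>i. v $ i \<in> U} = (\<Inter>i. (\<lambda>v. v $ i) -` U)" by auto
    also have "closed \<dots>"
      using compact_imp_closed[OF U(1)] by (intro closed_INT ballI closed_vimage continuous_intros) auto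
    finally show ?thesis .
  qed
  ultimately show "compact {v :: (real^'l^'d)^'m. \<forall>i. v $ i \<in> U}"
    by (simp add: compact_eq_bounded_closed)
  show "convex {v :: (real^'l^'d)^'m. \<forall>i. v $ i \<in> U}"
    using U(2) by (auto simp: convex_def)
qed

lemma law_feedback_bound:
  assumes "f \<in> feedback_maps Mb Lb" "integrable P \<xi>" shows "norm (f (law P \<xi>)) \<le> Mb"
  using assms law_in_wasserstein_space by (auto simp: feedback_maps_def)

lemma feedback_vec_bound:
  assumes "\<And>i. f i \<in> feedback_maps Mb Lb" "integrable P \<xi>"
  shows "norm (\<chi> i. f i (law P \<xi>) :: (real^'l)^'m) \<le> real CARD('m) * Mb"
proof -
  have "norm (\<chi> i. f i (law P \<xi>) :: (real^'l)^'m) \<le> (\<Sum>i\<in>(UNIV::'m set). Mb)"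
    by (rule order_trans[OF norm_vec_le_sum], rule sum_mono) (use law_feedback_bound[OF assms] in auto)
  then show ?thesis by simp
qed

lemma regular_indicator_measurable:
  assumes "regular k" shows "(\<lambda>s. indicator {0..T} s *\<^sub>R k i s) \<in> borel_measurable borel"
  using assms by (intro borel_measurable_scaleR) auto

lemma Psi_bounded:
  obtains M where "\<And>a b. (\<forall>i. a $ i \<in> U) \<Longrightarrow> norm b \<le> real CARD('m) * Mb \<Longrightarrow> \<bar>\<Psi> a b\<bar> \<le> M"
proof -
  have "compact ((\<lambda>(a, b). \<Psi> a b) ` ({v. \<forall>i. v $ i \<in> U} \<times> cball 0 (real CARD('m) * Mb)))"
    by (intro compact_continuous_image continuous_on_subset[OF Psi_cont] compact_Times control_set) auto
  from compact_imp_bounded[OF this, unfolded bounded_iff]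
  obtain M where M: "\<forall>x\<in>(\<lambda>(a, b). \<Psi> a b) ` ({v. \<forall>i. v $ i \<in> U} \<times> cball 0 (real CARD('m) * Mb)). norm x \<le> M"
    by (elim exE)
  show thesis
  proof (rule that[of M])
    fix a :: "(real^'l^'d)^'m" and b :: "(real^'l)^'m"
    assume "\<forall>i. a $ i \<in> U" "norm b \<le> real CARD('m) * Mb"
    then have "(a, b) \<in> {v. \<forall>i. v $ i \<in> U} \<times> cball 0 (real CARD('m) * Mb)" by simp
    from bspec[OF M imageI[OF this]] show "\<bar>\<Psi> a b\<bar> \<le> M" by simp
  qed
qed

section \<open>Passage to the limit along convergent states\<close>

text \<open>The situation after subsequences have been extracted: states converge, and so do the
  feedback maps along the limit flow. Nothing is assumed about convergence of the controls
  h.\<close>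

context
  fixes h :: "nat \<Rightarrow> 'm \<Rightarrow> real \<Rightarrow> real^'l^'d" and g :: "nat \<Rightarrow> 'm \<Rightarrow> (real^'d) measure \<Rightarrow> real^'l"
    and gs :: "'m \<Rightarrow> (real^'d) measure \<Rightarrow> real^'l"
    and X :: "nat \<Rightarrow> real \<Rightarrow> 'w \<Rightarrow> real^'d" and Y :: "nat \<Rightarrow> real \<Rightarrow> (real^'d)^'m"
    and XX :: "real \<Rightarrow> 'w \<Rightarrow> real^'d" and YY :: "real \<Rightarrow> (real^'d)^'m"
  assumes h: "\<And>n. regular (h n)" and g: "\<And>n i. g n i \<in> feedback_maps Mb Lb" and gs: "\<And>i. gs i \<in> feedback_maps Mb Lb"
    and mv: "\<And>n. mv (h n) (g n) (X n) (Y n)" and ctl: "\<And>n. controlled (X n) (Y n)" and spread: "integrable P spread"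
    and X_lim: "\<And>t. t \<in> {0..T} \<Longrightarrow> (\<lambda>n. LINT \<omega>|P. norm (X n t \<omega> - XX t \<omega>)) \<longlonglongrightarrow> 0"
    and Y_lim: "\<And>t. t \<in> {0..T} \<Longrightarrow> (\<lambda>n. Y n t) \<longlonglongrightarrow> YY t"
    and YY: "continuous_on {0..T} YY" and XX_L1: "L1_continuous P T XX"
    and g_lim: "\<And>t i. t \<in> {0..T} \<Longrightarrow> (\<lambda>n. g n i (law P (XX t))) \<longlonglongrightarrow> gs i (law P (XX t))"
begin

lemma XX_int: "t \<in> {0..T} \<Longrightarrow> integrable P (XX t)"
  using XX_L1 by (simp add: L1_continuous_def)

lemma modulus_nonneg: "s \<in> {0..T} \<Longrightarrow> t \<in> {0..T} \<Longrightarrow> 0 \<le> modulus s t"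
  using ctl[of 0] norm_ge_zero order_trans unfolding controlled_def by blast

text \<open>Map and argument vary together. The common Lipschitz constant \<open>Lb\<close> reduces
  this to convergence of the maps at the limit law.\<close>

lemma feedback_tendsto:
  assumes t: "t \<in> {0..T}"
  shows "(\<lambda>n. g n i (law P (X n t))) \<longlonglongrightarrow> gs i (law P (XX t))"
proof -
  have "(\<lambda>n. g n i (law P (X n t)) - g n i (law P (XX t))) \<longlonglongrightarrow> 0"
  proof (rule Lim_null_comparison)
    show "\<forall>\<^sub>F n in sequentially. norm (g n i (law P (X n t)) - g n i (law P (XX t))) \<le> Lb * (LINT \<omega>|P. norm (X n t \<omega> - XX t \<omega>))"
      using feedback_law_lipschitz[OF g mv_integrable[OF mv t] XX_int[OF t] Lb] by simp
    show "(\<lambda>n. Lb * (LINT \<omega>|P. norm (X n t \<omega> - XX t \<omega>))) \<longlonglongrightarrow> 0"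
      using X_lim[OF t] by (rule tendsto_mult_right_zero)
  qed
  from tendsto_add[OF this g_lim[OF t, of i]] show ?thesis by simp
qed

text \<open>Lc is merely continuous, so no integrable majorant is given. Convergence is shown to be
  uniform in t instead: times at which it fails would accumulate at some t, and the common modulus
  makes the costs at these moving times converge to the limit cost at t.\<close>

lemma running_cost_integral_tendsto:
  "(\<lambda>n. LINT t:{0..T}|lborel. Lc t (Y n t) (law P (X n t))) \<longlonglongrightarrow> (LINT t:{0..T}|lborel. Lc t (YY t) (law P (XX t)))"
proof -
  define A where "A n t = Lc t (Y n t) (law P (X n t))" for n t
  define A' where "A' t = Lc t (YY t) (law P (XX t))" for t
  have A: "continuous_on {0..T} (A n)" for n
    unfolding A_def by (rule running_cost_continuous[OF mv_L1_continuous[OF mv] mv_leaders_continuous[OF mv]])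
  have A': "continuous_on {0..T} A'"
    unfolding A'_def by (rule running_cost_continuous[OF XX_L1 YY])
  have unif: "\<forall>\<^sub>F n in sequentially. \<forall>t\<in>{0..T}. \<bar>A n t - A' t\<bar> < e" if e: "e > 0" for e
  proof (rule ccontr)
    assume "\<not> ?thesis"
    then obtain q where q: "strict_mono (q :: nat \<Rightarrow> nat)" "\<And>n. \<not> (\<forall>t\<in>{0..T}. \<bar>A (q n) t - A' t\<bar> < e)"
      using not_eventually_sequentiallyD by blast
    have "\<exists>t. t \<in> {0..T} \<and> e \<le> \<bar>A (q n) t - A' t\<bar>" for n
      using q(2)[of n] by (auto simp: not_less)
    then obtain \<tau> where \<tau>: "\<And>n. \<tau> n \<in> {0..T}" "\<And>n. e \<le> \<bar>A (q n) (\<tau> n) - A' (\<tau> n)\<bar>" by metis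
    obtain t p where t: "t \<in> {0..T}" and p: "strict_mono (p :: nat \<Rightarrow> nat)" "(\<tau> \<circ> p) \<longlonglongrightarrow> t"
      using compact_Icc[of 0 T] \<tau>(1) unfolding compact_def by blast
    define m where "m n = q (p n)" for n
    have m: "strict_mono m" unfolding m_def using q(1) p(1) by (simp add: strict_mono_def)
    define a where "a n = \<tau> (p n)" for n
    have a: "\<And>n. a n \<in> {0..T}" "a \<longlonglongrightarrow> t" using \<tau>(1) p(2) by (auto simp: a_def[abs_def] o_def)
    have mod: "(\<lambda>n. modulus t (a n)) \<longlonglongrightarrow> 0"
      by (rule modulus_LIMSEQ[OF a t]) (rule modulus_nonneg[OF t])
    have sub: "(\<lambda>n. f (m n)) \<longlonglongrightarrow> l" if "f \<longlonglongrightarrow> l" for f :: "nat \<Rightarrow> 'z::topological_space" and l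
      using LIMSEQ_subseq_LIMSEQ[OF that m] by (simp add: o_def)
    have "(\<lambda>n. A (m n) (a n)) \<longlonglongrightarrow> A' t"
      unfolding A_def A'_def
    proof (rule running_cost_tendsto[OF a(2) _ t])
      have "(\<lambda>n. Y (m n) (a n) - Y (m n) t) \<longlonglongrightarrow> 0"
        by (rule Lim_null_comparison[OF _ mod]) (use ctl t a(1) in \<open>auto simp: controlled_def\<close>)
      from tendsto_add[OF this sub[OF Y_lim[OF t]]] show "(\<lambda>n. Y (m n) (a n)) \<longlonglongrightarrow> YY t" by simp
      show "(\<lambda>n. LINT \<omega>|P. norm (X (m n) (a n) \<omega> - XX t \<omega>)) \<longlonglongrightarrow> 0"
      proof (rule Lim_null_comparison)
        have "norm (LINT \<omega>|P. norm (X (m n) (a n) \<omega> - XX t \<omega>)) \<le> modulus t (a n) + (LINT \<omega>|P. norm (X (m n) t \<omega> - XX t \<omega>))" for n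
        proof -
          note i = mv_integrable[OF mv a(1), of "m n" n] mv_integrable[OF mv t, of "m n"] XX_int[OF t]
          have "(LINT \<omega>|P. norm (X (m n) (a n) \<omega> - XX t \<omega>)) \<le>
              (LINT \<omega>|P. norm (X (m n) (a n) \<omega> - X (m n) t \<omega>) + norm (X (m n) t \<omega> - XX t \<omega>))"
          proof (rule integral_mono)
            show "norm (X (m n) (a n) \<omega> - XX t \<omega>) \<le> norm (X (m n) (a n) \<omega> - X (m n) t \<omega>) + norm (X (m n) t \<omega> - XX t \<omega>)" for \<omega>
              using norm_triangle_ineq[of "X (m n) (a n) \<omega> - X (m n) t \<omega>" "X (m n) t \<omega> - XX t \<omega>"] by simp
          qed (use i in auto)
          also have "\<dots> = (LINT \<omega>|P. norm (X (m n) (a n) \<omega> - X (m n) t \<omega>)) + (LINT \<omega>|P. norm (X (m n) t \<omega> - XX t \<omega>))"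
            using i by simp
          also have "(LINT \<omega>|P. norm (X (m n) (a n) \<omega> - X (m n) t \<omega>)) \<le> modulus t (a n)"
            using ctl[of "m n"] t a(1)[of n] unfolding controlled_def by blast
          finally show ?thesis by simp
        qed
        then show "\<forall>\<^sub>F n in sequentially. norm (LINT \<omega>|P. norm (X (m n) (a n) \<omega> - XX t \<omega>)) \<le>
            modulus t (a n) + (LINT \<omega>|P. norm (X (m n) t \<omega> - XX t \<omega>))" by simp
        show "(\<lambda>n. modulus t (a n) + (LINT \<omega>|P. norm (X (m n) t \<omega> - XX t \<omega>))) \<longlonglongrightarrow> 0"
          using tendsto_add[OF mod sub[OF X_lim[OF t]]] by simp
      qed
    qed (use a(1) mv_integrable[OF mv] XX_int[OF t] in auto)
    moreover have "(\<lambda>n. A' (a n)) \<longlonglongrightarrow> A' t"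
      using A' a t by (intro continuous_on_tendsto_compose[where f = A']) auto
    ultimately have "(\<lambda>n. \<bar>A (m n) (a n) - A' (a n)\<bar>) \<longlonglongrightarrow> \<bar>A' t - A' t\<bar>"
      by (intro tendsto_intros)
    then have "e \<le> \<bar>A' t - A' t\<bar>"
      by (rule LIMSEQ_le_const) (use \<tau>(2) in \<open>auto simp: m_def a_def\<close>)
    then show False using e by simp
  qed
  show ?thesis
  proof (rule tendstoI)
    fix e :: real assume e: "e > 0"
    \<comment> \<open>T + 1 in place of T makes the estimate T * d < e strict.\<close>
    define d where "d = e / (T + 1)"
    have d: "d > 0" "T * d < e" using e T by (auto simp: d_def field_simps)
    show "\<forall>\<^sub>F n in sequentially. dist (LINT t:{0..T}|lborel. Lc t (Y n t) (law P (X n t))) (LINT t:{0..T}|lborel. Lc t (YY t) (law P (XX t))) < e"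
      using unif[OF d(1)]
    proof eventually_elim
      case (elim n)
      note i = set_integrable_continuous_interval[OF A[of n]] set_integrable_continuous_interval[OF A']
      have "norm (LINT t:{0..T}|lborel. A n t - A' t) \<le> (LINT t:{0..T}|lborel. d)"
        using elim by (intro set_integral_norm_le[OF set_integral_diff(1)[OF i]] set_integrable_continuous_interval) (auto intro: less_imp_le)
      also have "\<dots> = T * d" using T by (simp add: set_lebesgue_integral_def)
      finally show ?case
        using d(2) set_integral_diff(2)[OF i] by (simp add: dist_real_def A_def A'_def)
    qed
  qed
qed

text \<open>\<Psi> is uniformly continuous on the compact set of control and feedback values. So
  moving the second argument to its limit changes the integrand by an amount that is small uniformly
  in the control, whether or not the controls converge.\<close>

lemma control_cost_diff_tendsto:
  "(\<lambda>n. (LINT s:{0..T}|lborel. \<Psi> (\<chi> i. h n i s) (\<chi> i. g n i (law P (X n s)))) -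
    (LINT s:{0..T}|lborel. \<Psi> (\<chi> i. h n i s) (\<chi> i. gs i (law P (XX s))))) \<longlonglongrightarrow> 0"
proof -
  obtain M where M: "\<And>a b. (\<forall>i. a $ i \<in> U) \<Longrightarrow> norm b \<le> real CARD('m) * Mb \<Longrightarrow> \<bar>\<Psi> a b\<bar> \<le> M"
    using Psi_bounded by blast
  define p where "p n s = \<Psi> (\<chi> i. h n i s) (\<chi> i. g n i (law P (X n s)))" for n s
  define p' where "p' n s = \<Psi> (\<chi> i. h n i s) (\<chi> i. gs i (law P (XX s)))" for n s
  have pM: "\<bar>p n s\<bar> \<le> M" "\<bar>p' n s\<bar> \<le> M" if "s \<in> {0..T}" for n s
    unfolding p_def p'_def
    using h[of n] feedback_vec_bound[OF g mv_integrable[OF mv that]] feedback_vec_bound[OF gs XX_int[OF that]]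
    by (intro M; simp)+
  have pm: "(\<lambda>s. indicator {0..T} s *\<^sub>R p n s) \<in> borel_measurable lborel" for n
    unfolding p_def by (rule control_cost_measurable[OF regular_indicator_measurable[OF h] feedback_continuous[OF g mv_L1_continuous[OF mv]]])
  have p'm: "(\<lambda>s. indicator {0..T} s *\<^sub>R p' n s) \<in> borel_measurable lborel" for n
    unfolding p'_def by (rule control_cost_measurable[OF regular_indicator_measurable[OF h] feedback_continuous[OF gs XX_L1]])
  have pi: "set_integrable lborel {0..T} (p n)" "set_integrable lborel {0..T} (p' n)" for n
    using pM pm p'm by (intro set_integrable_bounded_interval[where K = M]; simp add: set_borel_measurable_def)+
  have lim: "(\<lambda>n. p n s - p' n s) \<longlonglongrightarrow> 0" if s: "s \<in> {0..T}" for s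
  proof (rule tendstoI)
    fix e :: real assume e: "e > 0"
    let ?S = "{v :: (real^'l^'d)^'m. \<forall>i. v $ i \<in> U} \<times> cball (0 :: (real^'l)^'m) (real CARD('m) * Mb)"
    have uc: "uniformly_continuous_on ?S (\<lambda>(a, b). \<Psi> a b)"
      by (intro compact_uniformly_continuous continuous_on_subset[OF Psi_cont] compact_Times control_set) auto
    have "\<exists>d>0. \<forall>x\<in>?S. \<forall>x'\<in>?S. dist x' x < d \<longrightarrow> dist ((\<lambda>(a, b). \<Psi> a b) x') ((\<lambda>(a, b). \<Psi> a b) x) < e"
      using uc[unfolded uniformly_continuous_on_def, THEN spec, of e] e by (rule mp)
    then obtain d where d: "d > 0" "\<forall>x\<in>?S. \<forall>x'\<in>?S. dist x' x < d \<longrightarrow> dist ((\<lambda>(a, b). \<Psi> a b) x') ((\<lambda>(a, b). \<Psi> a b) x) < e"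
      by (elim exE conjE)
    have "(\<lambda>n. (\<chi> i. g n i (law P (X n s))) :: (real^'l)^'m) \<longlonglongrightarrow> (\<chi> i. gs i (law P (XX s)))"
      by (rule vec_tendstoI) (simp add: feedback_tendsto[OF s])
    then have "\<forall>\<^sub>F n in sequentially. dist (\<chi> i. g n i (law P (X n s)) :: (real^'l)^'m) (\<chi> i. gs i (law P (XX s))) < d"
      using d(1) by (rule tendstoD)
    then show "\<forall>\<^sub>F n in sequentially. dist (p n s - p' n s) 0 < e"
    proof eventually_elim
      case (elim n)
      have "(\<chi> i. h n i s, \<chi> i. gs i (law P (XX s))) \<in> ?S" "(\<chi> i. h n i s, \<chi> i. g n i (law P (X n s))) \<in> ?S"
        using h[of n] feedback_vec_bound[OF g mv_integrable[OF mv s]] feedback_vec_bound[OF gs XX_int[OF s]] by auto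
      from bspec[OF bspec[OF d(2) this(1)] this(2)] show ?case
        using elim by (simp add: p_def p'_def dist_Pair_Pair dist_real_def)
    qed
  qed
  have "(\<lambda>n. LINT s|lborel. indicator {0..T} s *\<^sub>R (p n s - p' n s)) \<longlonglongrightarrow> (LINT s|(lborel::real measure). 0)"
  proof (rule integral_dominated_convergence[where w = "\<lambda>s. indicator {0..T} s *\<^sub>R (2 * M)"])
    show "integrable lborel (\<lambda>s. indicator {0..T} s *\<^sub>R (2 * M))"
      using set_integrable_continuous_interval[of 0 T "\<lambda>_. 2 * M"] by (simp add: set_integrable_def)
    show "AE s in lborel. (\<lambda>n. indicator {0..T} s *\<^sub>R (p n s - p' n s)) \<longlonglongrightarrow> 0"
    proof (rule AE_I2)
      fix s :: real
      show "(\<lambda>n. indicator {0..T} s *\<^sub>R (p n s - p' n s)) \<longlonglongrightarrow> 0"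
        using lim[of s] by (cases "s \<in> {0..T}") auto
    qed
    show "AE s in lborel. norm (indicator {0..T} s *\<^sub>R (p n s - p' n s)) \<le> indicator {0..T} s *\<^sub>R (2 * M)" for n
    proof (rule AE_I2)
      fix s :: real
      show "norm (indicator {0..T} s *\<^sub>R (p n s - p' n s)) \<le> indicator {0..T} s *\<^sub>R (2 * M)"
        using pM[of s n] by (cases "s \<in> {0..T}") (auto simp: abs_le_iff)
    qed
    show "(\<lambda>s. indicator {0..T} s *\<^sub>R (p n s - p' n s)) \<in> borel_measurable lborel" for n
      using borel_measurable_diff[OF pm[of n] p'm[of n]] by (simp add: scaleR_diff_right algebra_simps)
  qed simp
  then have "(\<lambda>n. LINT s:{0..T}|lborel. p n s - p' n s) \<longlonglongrightarrow> 0"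
    by (simp add: set_lebesgue_integral_def)
  then show ?thesis
    unfolding set_integral_diff(2)[OF pi] by (simp add: p_def[abs_def] p'_def[abs_def])
qed

lemma control_feedback_integrable:
  assumes k: "regular k" and t: "t \<in> {0..T}"
  shows "set_integrable lborel {0..t} (\<lambda>s. k i s *v gs i (law P (XX s)))"
proof -
  have "(\<lambda>s. k i s *v (indicator {0..T} s *\<^sub>R gs i (law P (XX s)))) \<in> borel_measurable borel"
    using k feedback_continuous[OF gs XX_L1]
    by (intro borel_measurable_matrix_vector_mult borel_measurable_continuous_on_indicator) auto
  then have "(\<lambda>s. indicator {0..t} s *\<^sub>R (k i s *v (indicator {0..T} s *\<^sub>R gs i (law P (XX s))))) \<in> borel_measurable borel"
    by (intro borel_measurable_scaleR) auto
  also have "(\<lambda>s. indicator {0..t} s *\<^sub>R (k i s *v (indicator {0..T} s *\<^sub>R gs i (law P (XX s))))) =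
      (\<lambda>s. indicator {0..t} s *\<^sub>R (k i s *v gs i (law P (XX s))))"
    using t by (auto simp: fun_eq_iff indicator_def)
  finally have m: "set_borel_measurable lborel {0..t} (\<lambda>s. k i s *v gs i (law P (XX s)))"
    by (simp add: set_borel_measurable_def)
  show ?thesis
  proof (rule set_integrable_bounded_interval[OF m])
    fix s assume "s \<in> {0..t}"
    then have "s \<in> {0..T}" using t by auto
    then have "norm (gs i (law P (XX s))) \<le> Mb" by (intro law_feedback_bound gs XX_int)
    then show "norm (k i s *v gs i (law P (XX s))) \<le> KU * Mb"
      using k by (intro order_trans[OF KU_bound] mult_left_mono KU) auto
  qed
qed

text \<open>The leaders' equation itself fixes the limit of the control integrals, although the
  controls need not converge: all other terms converge, and freezing the feedback at its limit
  leaves only the remainder R, which is dominated and tends to 0.\<close>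

lemma leader_integral_tendsto:
  assumes t: "t \<in> {0..T}"
  shows "(\<lambda>n. LINT s:{0..t}|lborel. h n i s *v gs i (law P (XX s))) \<longlonglongrightarrow>
    YY t $ i - Y0 $ i - (LINT s:{0..t}|lborel. leader_drift H2 K2 (law P (XX s)) (YY s) i)"
proof -
  define f where "f n s = leader_drift H2 K2 (law P (X n s)) (Y n s) i + h n i s *v g n i (law P (X n s))" for n s
  define l where "l s = leader_drift H2 K2 (law P (XX s)) (YY s) i" for s
  define k where "k n s = h n i s *v gs i (law P (XX s))" for n s
  define R where "R n s = f n s - l s - k n s" for n s
  have sub: "{0..t} \<subseteq> {0..T}" using t by auto
  have fi: "set_integrable lborel {0..t} (f n)" and fe: "Y n t $ i = Y0 $ i + (LINT s:{0..t}|lborel. f n s)" for n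
    using mv[of n] t unfolding mv_solution_def f_def by blast+
  have li: "set_integrable lborel {0..t} l"
    unfolding l_def by (intro set_integrable_continuous_interval continuous_on_subset[OF _ sub] leader_drift_continuous[OF XX_L1 YY])
  have ki: "set_integrable lborel {0..t} (k n)" for n
    unfolding k_def by (rule control_feedback_integrable[OF h t])
  note fli = set_integral_diff(1)[OF fi li] and fle = set_integral_diff(2)[OF fi li]
  have Ri: "set_integrable lborel {0..t} (R n)" for n
    unfolding R_def by (rule set_integral_diff(1)[OF fli ki])
  have Re: "(LINT s:{0..t}|lborel. k n s) = Y n t $ i - Y0 $ i - (LINT s:{0..t}|lborel. l s) - (LINT s:{0..t}|lborel. R n s)" for n
    unfolding R_def set_integral_diff(2)[OF fli ki] fle using fe[of n] by simp
  define \<rho> where "\<rho> n s = L * (3 * norm (Y n s - YY s) + (LINT \<omega>|P. norm (X n s \<omega> - XX s \<omega>))) +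
      KU * norm (g n i (law P (X n s)) - gs i (law P (XX s)))" for n s
  have R_le: "norm (R n s) \<le> \<rho> n s" if s: "s \<in> {0..T}" for n s
  proof -
    have eq: "R n s = (leader_drift H2 K2 (law P (X n s)) (Y n s) i - l s) +
        h n i s *v (g n i (law P (X n s)) - gs i (law P (XX s)))"
      by (simp add: R_def f_def k_def matrix_vector_mult_diff_distrib)
    show ?thesis
      unfolding eq \<rho>_def
    proof (rule order_trans[OF norm_triangle_ineq], rule add_mono)
      show "norm (leader_drift H2 K2 (law P (X n s)) (Y n s) i - l s) \<le>
          L * (3 * norm (Y n s - YY s) + (LINT \<omega>|P. norm (X n s \<omega> - XX s \<omega>)))"
        unfolding l_def by (rule leader_drift_lipschitz[OF mv_integrable[OF mv s] XX_int[OF s]])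
      show "norm (h n i s *v (g n i (law P (X n s)) - gs i (law P (XX s)))) \<le>
          KU * norm (g n i (law P (X n s)) - gs i (law P (XX s)))"
        using h by (intro KU_bound) auto
    qed
  qed
  have \<rho>_lim: "(\<lambda>n. \<rho> n s) \<longlonglongrightarrow> 0" if s: "s \<in> {0..T}" for s
  proof -
    have "(\<lambda>n. \<rho> n s) \<longlonglongrightarrow> L * (3 * norm (YY s - YY s) + 0) + KU * norm (gs i (law P (XX s)) - gs i (law P (XX s)))"
      unfolding \<rho>_def by (intro tendsto_intros Y_lim[OF s] X_lim[OF s] feedback_tendsto[OF s])
    then show ?thesis by simp
  qed
  \<comment> \<open>The limits XX and YY carry no \<open>controlled\<close> bounds; theirs come from
    continuity on the compact interval.\<close>
  obtain KY where KY: "\<And>s. s \<in> {0..T} \<Longrightarrow> norm (YY s) \<le> KY"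
    using continuous_on_bounded_interval[OF YY] by blast
  have "continuous_on {0..T} (\<lambda>s. LINT \<omega>|P. norm (XX s \<omega>))"
    using XX_L1
  proof (rule L1_continuous_imp_continuous_on)
    fix s t assume s: "s \<in> {0..T}" and t: "t \<in> {0..T}"
    have "norm (LINT \<omega>|P. norm (XX s \<omega>) - norm (XX t \<omega>)) \<le> (LINT \<omega>|P. norm (XX s \<omega> - XX t \<omega>))"
      using XX_int[OF s] XX_int[OF t]
      by (intro order_trans[OF integral_norm_bound] integral_mono) (auto simp: norm_triangle_ineq3)
    then show "norm ((LINT \<omega>|P. norm (XX s \<omega>)) - (LINT \<omega>|P. norm (XX t \<omega>))) \<le> 1 * (LINT \<omega>|P. norm (XX s \<omega> - XX t \<omega>))"
      using XX_int[OF s] XX_int[OF t] by simp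
  qed
  then obtain KX where KX: "\<And>s. s \<in> {0..T} \<Longrightarrow> norm (LINT \<omega>|P. norm (XX s \<omega>)) \<le> KX"
    using continuous_on_bounded_interval by blast
  define D where "D = L * (3 * (norm Y0 + mean_spread + KY) + (free_bound + mean_spread + KX)) + KU * (Mb + Mb)"
  have \<rho>_le: "\<rho> n s \<le> D" if s: "s \<in> {0..T}" for n s
    unfolding \<rho>_def D_def
  proof (intro add_mono mult_left_mono L KU)
    have "norm (Y n s - Y0) \<le> mean_spread" using ctl[of n] s unfolding controlled_def by blast
    then show "norm (Y n s - YY s) \<le> norm Y0 + mean_spread + KY"
      using KY[OF s] norm_triangle_ineq4[of "Y n s" "YY s"] norm_triangle_ineq2[of "Y n s" Y0] by linarith
    have "(LINT \<omega>|P. norm (X n s \<omega> - XX s \<omega>)) \<le> (LINT \<omega>|P. norm (X n s \<omega>) + norm (XX s \<omega>))"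
      using mv_integrable[OF mv s] XX_int[OF s] by (intro integral_mono) (auto simp: norm_triangle_ineq4)
    also have "\<dots> = (LINT \<omega>|P. norm (X n s \<omega>)) + (LINT \<omega>|P. norm (XX s \<omega>))"
      using mv_integrable[OF mv s] XX_int[OF s] by simp
    also have "\<dots> \<le> free_bound + mean_spread + KX"
      using KX[OF s] by (intro add_mono controlled_mean[OF ctl mv_integrable[OF mv s] spread s]) simp
    finally show "(LINT \<omega>|P. norm (X n s \<omega> - XX s \<omega>)) \<le> free_bound + mean_spread + KX" .
    show "norm (g n i (law P (X n s)) - gs i (law P (XX s))) \<le> Mb + Mb"
      by (intro order_trans[OF norm_triangle_ineq4] add_mono law_feedback_bound g gs mv_integrable[OF mv s] XX_int[OF s])
  qed simp
  have "(\<lambda>n. LINT s|lborel. indicator {0..t} s *\<^sub>R R n s) \<longlonglongrightarrow> (LINT s|(lborel::real measure). 0)"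
  proof (rule integral_dominated_convergence[where w = "\<lambda>s. indicator {0..t} s *\<^sub>R D"])
    show "integrable lborel (\<lambda>s. indicator {0..t} s *\<^sub>R D)"
      using set_integrable_continuous_interval[of 0 t "\<lambda>_. D"] by (simp add: set_integrable_def)
    show "AE s in lborel. (\<lambda>n. indicator {0..t} s *\<^sub>R R n s) \<longlonglongrightarrow> 0"
    proof (rule AE_I2)
      fix s :: real
      show "(\<lambda>n. indicator {0..t} s *\<^sub>R R n s) \<longlonglongrightarrow> 0"
      proof (cases "s \<in> {0..t}")
        case True
        then have s: "s \<in> {0..T}" using t by auto
        have "(\<lambda>n. R n s) \<longlonglongrightarrow> 0"
          by (rule Lim_null_comparison[OF _ \<rho>_lim[OF s]]) (simp add: R_le[OF s])
        then show ?thesis using True by simp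
      qed simp
    qed
    show "AE s in lborel. norm (indicator {0..t} s *\<^sub>R R n s) \<le> indicator {0..t} s *\<^sub>R D" for n
    proof (rule AE_I2)
      fix s :: real
      show "norm (indicator {0..t} s *\<^sub>R R n s) \<le> indicator {0..t} s *\<^sub>R D"
        using order_trans[OF R_le[of s n] \<rho>_le[of s n]] t by (cases "s \<in> {0..t}") auto
    qed
    show "(\<lambda>s. indicator {0..t} s *\<^sub>R R n s) \<in> borel_measurable lborel" for n
      using Ri[of n] unfolding set_integrable_def by (rule borel_measurable_integrable)
  qed simp
  then have "(\<lambda>n. LINT s:{0..t}|lborel. R n s) \<longlonglongrightarrow> 0"
    by (simp add: set_lebesgue_integral_def)
  then have "(\<lambda>n. Y n t $ i - Y0 $ i - (LINT s:{0..t}|lborel. l s) - (LINT s:{0..t}|lborel. R n s)) \<longlonglongrightarrow>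
      YY t $ i - Y0 $ i - (LINT s:{0..t}|lborel. l s) - 0"
    by (intro tendsto_intros Y_lim[OF t])
  then show ?thesis
    unfolding Re[symmetric] by (simp add: l_def[abs_def] k_def[abs_def])
qed

text \<open>The limit states are already fixed; only a control that produces them is missing. The
  weak limit of the controls does so because the control acts linearly once the feedback is frozen,
  and by convexity its cost does not exceed c.\<close>

lemma limit_solution_exists:
  assumes XX_ad: "\<And>t. t \<in> {0..T} \<Longrightarrow> XX t \<in> borel_measurable (Fl t)"
    and XX_cont: "\<And>\<omega>. \<omega> \<in> space P \<Longrightarrow> continuous_on {0..T} (\<lambda>t. XX t \<omega>)"
    and XX_eq: "\<And>t \<omega>. t \<in> {0..T} \<Longrightarrow> \<omega> \<in> space P \<Longrightarrow>
      set_integrable lborel {0..t} (\<lambda>s. follower_drift H1 K1 (law P (XX s)) (YY s) (XX s \<omega>)) \<and>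
      XX t \<omega> = free t \<omega> + (LINT s:{0..t}|lborel. follower_drift H1 K1 (law P (XX s)) (YY s) (XX s \<omega>))"
    and c: "(\<lambda>n. LINT s:{0..T}|lborel. \<Psi> (\<chi> i. h n i s) (\<chi> i. gs i (law P (XX s)))) \<longlonglongrightarrow> c"
  shows "\<exists>hs. regular hs \<and> mv hs gs XX YY \<and>
    cost hs gs XX YY \<le> (LINT t:{0..T}|lborel. Lc t (YY t) (law P (XX t))) + c"
proof -
  let ?K = "{v :: (real^'l^'d)^'m. \<forall>i. v $ i \<in> U}"
  define \<gamma> where "\<gamma> i s = gs i (law P (XX s))" for i s
  \<comment> \<open>The m controls are bundled into one vector, so that a single sequence of convex
    combinations serves all leaders and the joint convexity of \<Psi> can be used.\<close>
  define H where "H n s = (\<chi> i. h n i s)" for n s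
  have \<gamma>: "continuous_on {0..T} (\<gamma> i)" for i
    unfolding \<gamma>_def by (rule feedback_continuous[OF gs XX_L1])
  have \<gamma>_le: "norm (\<gamma> i s) \<le> Mb" if "s \<in> {0..T}" for i s
    unfolding \<gamma>_def by (intro law_feedback_bound gs XX_int that)
  have H: "H n \<in> borel_measurable borel" "H n s \<in> ?K" for n s
    using h by (auto simp: H_def[abs_def] intro!: borel_measurable_vec_lambda)
  obtain hv where hv: "hv \<in> borel_measurable borel" "\<forall>s. hv s \<in> ?K"
    and weak_limit: "\<forall>\<Phi> c M. (\<forall>v. (\<lambda>s. indicator {0..T} s *\<^sub>R \<Phi> s v) \<in> borel_measurable borel) \<longrightarrow>
      (\<forall>s\<in>{0..T}. continuous_on UNIV (\<Phi> s) \<and> convex_on UNIV (\<Phi> s) \<and> (\<forall>v\<in>?K. \<bar>\<Phi> s v\<bar> \<le> M)) \<longrightarrow>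
      (\<lambda>n. LINT s:{0..T}|lborel. \<Phi> s (H n s)) \<longlonglongrightarrow> c \<longrightarrow>
      (LINT s:{0..T}|lborel. \<Phi> s (hv s)) \<le> (c::real)"
    using weak_limit_controls[where H = H and T = T, OF control_set H] by (elim exE conjE)
  have weak: "(LINT s:{0..T}|lborel. \<Phi> s (hv s)) \<le> c"
    if "\<And>v. (\<lambda>s. indicator {0..T} s *\<^sub>R \<Phi> s v) \<in> borel_measurable borel"
      "\<And>s. s \<in> {0..T} \<Longrightarrow> continuous_on UNIV (\<Phi> s)" "\<And>s. s \<in> {0..T} \<Longrightarrow> convex_on UNIV (\<Phi> s)"
      "\<And>s v. s \<in> {0..T} \<Longrightarrow> v \<in> ?K \<Longrightarrow> \<bar>\<Phi> s v\<bar> \<le> M"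
      "(\<lambda>n. LINT s:{0..T}|lborel. \<Phi> s (H n s)) \<longlonglongrightarrow> c" for \<Phi> c M
    by (rule weak_limit[THEN spec[of _ \<Phi>], THEN spec[of _ c], THEN spec[of _ M], THEN mp, THEN mp, THEN mp])
      (intro allI ballI conjI that; assumption?)+
  define hs where "hs i s = hv s $ i" for i s
  have hs: "regular hs"
  proof (intro allI conjI)
    show "hs i \<in> borel_measurable borel" for i
      unfolding hs_def[abs_def] using hv(1)
      by (rule measurable_compose) (intro borel_measurable_continuous_onI continuous_intros)
    show "hs i s \<in> U" for i s using hv(2) by (simp add: hs_def)
  qed
  have hsv: "(\<chi> i. hs i s) = hv s" for s by (simp add: hs_def vec_eq_iff)
  have leader: "(LINT s:{0..t}|lborel. hs i s *v \<gamma> i s) =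
      YY t $ i - Y0 $ i - (LINT s:{0..t}|lborel. leader_drift H2 K2 (law P (XX s)) (YY s) i)" (is "?I = ?z")
    if t: "t \<in> {0..T}" for t i
  proof (rule euclidean_eqI)
    fix b :: "real^'d" assume b: "b \<in> Basis"
    \<comment> \<open>Linear integrands are convex, so the weak limit gives an inequality for x = 1
      and for x = -1, that is, equality in the coordinate b.\<close>
    have le: "x * ((LINT s:{0..t}|lborel. hs i s *v \<gamma> i s) \<bullet> b) \<le> x * (?z \<bullet> b)" if x: "\<bar>x\<bar> = 1" for x :: real
    proof -
      \<comment> \<open>The indicator moves the end time t into the integrand, because the weak
        limit is formulated on the whole interval {0..T}.\<close>
      define \<Phi> where "\<Phi> s v = x * (indicator {0..t} s * ((v $ i *v \<gamma> i s) \<bullet> b))" for s and v :: "(real^'l^'d)^'m"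
      have lin: "linear (\<Phi> s)" for s
        by (rule linearI) (simp_all add: \<Phi>_def matrix_vector_mult_add_rdistrib scaleR_matrix_vector_assoc[symmetric] inner_add_left algebra_simps)
      have int: "(LINT s:{0..T}|lborel. \<Phi> s (\<chi> j. k j s)) = x * ((LINT s:{0..t}|lborel. k i s *v \<gamma> i s) \<bullet> b)"
        if k: "regular k" for k
      proof -
        have ki: "integrable lborel (\<lambda>s. indicator {0..t} s *\<^sub>R (k i s *v \<gamma> i s))"
          using control_feedback_integrable[OF k t] by (simp add: set_integrable_def \<gamma>_def)
        have "(LINT s:{0..T}|lborel. \<Phi> s (\<chi> j. k j s)) =
            (LINT s|lborel. x * ((indicator {0..t} s *\<^sub>R (k i s *v \<gamma> i s)) \<bullet> b))"
          unfolding set_lebesgue_integral_def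
          using t by (intro Bochner_Integration.integral_cong) (auto simp: \<Phi>_def indicator_def)
        also have "\<dots> = x * (LINT s|lborel. (indicator {0..t} s *\<^sub>R (k i s *v \<gamma> i s)) \<bullet> b)" by simp
        also have "(LINT s|lborel. (indicator {0..t} s *\<^sub>R (k i s *v \<gamma> i s)) \<bullet> b) = (LINT s:{0..t}|lborel. k i s *v \<gamma> i s) \<bullet> b"
          unfolding set_lebesgue_integral_def by (rule integral_bounded_linear[OF bounded_linear_inner_left ki])
        finally show ?thesis .
      qed
      have "(LINT s:{0..T}|lborel. \<Phi> s (hv s)) \<le> x * (?z \<bullet> b)"
      proof (rule weak)
        fix v :: "(real^'l^'d)^'m"
        have "(\<lambda>s. x * (indicator {0..t} s * (((v $ i) *v (indicator {0..T} s *\<^sub>R \<gamma> i s)) \<bullet> b))) \<in> borel_measurable borel"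
          using \<gamma>[of i] by (intro borel_measurable_times borel_measurable_inner borel_measurable_matrix_vector_mult
              borel_measurable_continuous_on_indicator) auto
        also have "(\<lambda>s. x * (indicator {0..t} s * (((v $ i) *v (indicator {0..T} s *\<^sub>R \<gamma> i s)) \<bullet> b))) =
            (\<lambda>s. indicator {0..T} s *\<^sub>R \<Phi> s v)"
          using t by (auto simp: fun_eq_iff \<Phi>_def indicator_def)
        finally show "(\<lambda>s. indicator {0..T} s *\<^sub>R \<Phi> s v) \<in> borel_measurable borel" .
      next
        fix s
        show "continuous_on UNIV (\<Phi> s)" "convex_on UNIV (\<Phi> s)"
          using lin by (auto intro: linear_continuous_on linear_imp_convex_on simp: linear_conv_bounded_linear)
      next
        fix s and v :: "(real^'l^'d)^'m" assume s: "s \<in> {0..T}" and v: "v \<in> ?K"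
        have "\<bar>(v $ i *v \<gamma> i s) \<bullet> b\<bar> \<le> norm (v $ i *v \<gamma> i s)"
          using Basis_le_norm[OF b] .
        also have "\<dots> \<le> KU * Mb"
          using v \<gamma>_le[OF s] by (intro order_trans[OF KU_bound] mult_left_mono KU) auto
        finally have "\<bar>(v $ i *v \<gamma> i s) \<bullet> b\<bar> \<le> KU * Mb" .
        moreover have "0 \<le> KU * Mb" using KU Mb by simp
        ultimately show "\<bar>\<Phi> s v\<bar> \<le> KU * Mb"
          using x by (simp add: \<Phi>_def abs_mult indicator_def)
      next
        have "(\<lambda>n. x * ((LINT s:{0..t}|lborel. h n i s *v \<gamma> i s) \<bullet> b)) \<longlonglongrightarrow> x * (?z \<bullet> b)"
          unfolding \<gamma>_def by (intro tendsto_intros leader_integral_tendsto[OF t])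
        then show "(\<lambda>n. LINT s:{0..T}|lborel. \<Phi> s (H n s)) \<longlonglongrightarrow> x * (?z \<bullet> b)"
          unfolding H_def int[OF h] .
      qed
      then show ?thesis using int[OF hs] by (simp add: hsv)
    qed
    show "?I \<bullet> b = ?z \<bullet> b"
      using le[of 1] le[of "-1"] by simp
  qed
  have li: "set_integrable lborel {0..t} (\<lambda>s. leader_drift H2 K2 (law P (XX s)) (YY s) i)" if "t \<in> {0..T}" for t i
    by (intro set_integrable_continuous_interval continuous_on_subset[OF leader_drift_continuous[OF XX_L1 YY]]) (use that in auto)
  have "mv hs gs XX YY"
    unfolding mv_solution_def
  proof (intro conjI ballI allI AE_I2)
    show "XX t \<omega> = X0 \<omega> + (LINT s:{0..t}|lborel. follower_drift H1 K1 (law P (XX s)) (YY s) (XX s \<omega>)) +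
        sqrt (2 * \<sigma>) *\<^sub>R (W t \<omega> - W 0 \<omega>)" if "\<omega> \<in> space P" "t \<in> {0..T}" for \<omega> t
      using XX_eq[OF that(2,1)] by (simp add: free_def)
    fix i t assume t: "t \<in> {0..T}"
    note ii = li[OF t, of i] control_feedback_integrable[OF hs t, of i]
    show "set_integrable lborel {0..t} (\<lambda>s. leader_drift H2 K2 (law P (XX s)) (YY s) i + hs i s *v gs i (law P (XX s)))"
      by (rule set_integral_add(1)[OF ii])
    show "YY t $ i = Y0 $ i + (LINT s:{0..t}|lborel. leader_drift H2 K2 (law P (XX s)) (YY s) i + hs i s *v gs i (law P (XX s)))"
      unfolding set_integral_add(2)[OF ii] using leader[OF t, of i] by (simp add: \<gamma>_def)
  qed (use XX_ad XX_cont XX_eq law_in_wasserstein_space[OF XX_int] in blast)+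
  moreover have "(LINT s:{0..T}|lborel. \<Psi> (hv s) (\<chi> i. \<gamma> i s)) \<le> c"
  proof -
    obtain M where M: "\<And>a b. (\<forall>i. a $ i \<in> U) \<Longrightarrow> norm b \<le> real CARD('m) * Mb \<Longrightarrow> \<bar>\<Psi> a b\<bar> \<le> M"
      using Psi_bounded by blast
    show ?thesis
    proof (rule weak[of "\<lambda>s v. \<Psi> v (\<chi> i. \<gamma> i s)"])
      fix v :: "(real^'l^'d)^'m"
      show "(\<lambda>s. indicator {0..T} s *\<^sub>R \<Psi> v (\<chi> i. \<gamma> i s)) \<in> borel_measurable borel"
        using control_cost_measurable[of "\<lambda>i s. v $ i" \<gamma>, OF _ \<gamma>] by simp
      show "continuous_on UNIV (\<lambda>v. \<Psi> v (\<chi> i. \<gamma> i s))" for s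
        using continuous_on_compose2[OF Psi_cont, of UNIV "\<lambda>v. (v, \<chi> i. \<gamma> i s)"] by (simp add: continuous_intros)
      show "convex_on UNIV (\<lambda>v. \<Psi> v (\<chi> i. \<gamma> i s))" for s by (rule Psi_convex)
      show "\<bar>\<Psi> v (\<chi> i. \<gamma> i s)\<bar> \<le> M" if "s \<in> {0..T}" "v \<in> ?K" for s v
        using that feedback_vec_bound[OF gs XX_int[OF that(1)]] by (intro M) (auto simp: \<gamma>_def)
      show "(\<lambda>n. LINT s:{0..T}|lborel. \<Psi> (H n s) (\<chi> i. \<gamma> i s)) \<longlonglongrightarrow> c"
        using c by (simp add: H_def \<gamma>_def)
    qed
  qed
  ultimately show ?thesis
    using hs by (intro exI[of _ hs]) (simp add: trajectory_cost_def hsv \<gamma>_def)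
qed

end

section \<open>Minimizing sequences and the minimum\<close>

text \<open>The feedback maps are examined only along the limit flow, a curve indexed by {0..T},
  where the Arzela-Ascoli argument applies. The control costs with frozen feedback are bounded by T
  * M, so after a further extraction they converge, and with them the total costs.\<close>

lemma minimizing_sequence_limit:
  fixes h :: "nat \<Rightarrow> 'm \<Rightarrow> real \<Rightarrow> real^'l^'d" and g :: "nat \<Rightarrow> 'm \<Rightarrow> (real^'d) measure \<Rightarrow> real^'l"
  assumes h: "\<And>n. regular (h n)" and g: "\<And>n i. g n i \<in> feedback_maps Mb Lb"
    and mv: "\<And>n. mv (h n) (g n) (X n) (Y n)" and ctl: "\<And>n. controlled (X n) (Y n)" and spread: "integrable P spread"
  shows "\<exists>r hs gs XX YY c. strict_mono (r :: nat \<Rightarrow> nat) \<and> regular hs \<and> (\<forall>i. gs i \<in> feedback_maps Mb Lb) \<and>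
    mv hs gs XX YY \<and> (\<lambda>n. cost (h (r n)) (g (r n)) (X (r n)) (Y (r n))) \<longlonglongrightarrow> c \<and> cost hs gs XX YY \<le> c"
proof -
  obtain r1 XX YY where r1: "strict_mono (r1 :: nat \<Rightarrow> nat)"
    and X_lim: "\<And>t. t \<in> {0..T} \<Longrightarrow> (\<lambda>n. LINT \<omega>|P. norm (X (r1 n) t \<omega> - XX t \<omega>)) \<longlonglongrightarrow> 0"
    and Y_lim: "\<And>t. t \<in> {0..T} \<Longrightarrow> (\<lambda>n. Y (r1 n) t) \<longlonglongrightarrow> YY t"
    and YY: "continuous_on {0..T} YY" and XX_L1: "L1_continuous P T XX"
    and XX_ad: "\<And>t. t \<in> {0..T} \<Longrightarrow> XX t \<in> borel_measurable (Fl t)"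
    and XX_cont: "\<And>\<omega>. \<omega> \<in> space P \<Longrightarrow> continuous_on {0..T} (\<lambda>t. XX t \<omega>)"
    and XX_eq: "\<And>t \<omega>. t \<in> {0..T} \<Longrightarrow> \<omega> \<in> space P \<Longrightarrow>
      set_integrable lborel {0..t} (\<lambda>s. follower_drift H1 K1 (law P (XX s)) (YY s) (XX s \<omega>)) \<and>
      XX t \<omega> = free t \<omega> + (LINT s:{0..t}|lborel. follower_drift H1 K1 (law P (XX s)) (YY s) (XX s \<omega>))"
  proof (rule states_convergent_subsequence[of X Y])
    show "controlled (X n) (Y n)" for n by (rule ctl)
    show "integrable P (X n t)" if "t \<in> {0..T}" for n t by (rule mv_integrable[OF mv that])
    show "continuous_on {0..T} (\<lambda>t. X n t \<omega>)" if "\<omega> \<in> space P" for n \<omega> by (rule mv_cont[OF mv that])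
  qed (rule spread, rule that)
  define f where "f n t = (\<chi> i. g (r1 n) i (law P (XX t)))" for n t
  have XX_int: "integrable P (XX t)" if "t \<in> {0..T}" for t
    using XX_L1 that by (simp add: L1_continuous_def)
  obtain r2 G where r2: "strict_mono (r2 :: nat \<Rightarrow> nat)"
    and G: "\<And>t. t \<in> {0..T} \<Longrightarrow> (\<lambda>n. f (r2 n) t) \<longlonglongrightarrow> G t"
  proof (rule equicontinuous_convergent_subsequence[of "{0..T}" f])
    show "norm (f n t) \<le> real CARD('m) * Mb" if t: "t \<in> {0..T}" for n t
    proof -
      have "norm (g (r1 n) i (law P (XX t))) \<le> Mb" for i
        using g law_in_wasserstein_space[OF XX_int[OF t]] by (auto simp: feedback_maps_def)
      then have "norm (f n t) \<le> (\<Sum>i\<in>(UNIV::'m set). Mb)"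
        by (intro order_trans[OF norm_vec_le_sum[of "f n t"]] sum_mono) (simp add: f_def)
      then show ?thesis by simp
    qed
  next
    fix t e :: real assume t: "t \<in> {0..T}" and e: "0 < e"
    let ?C = "real CARD('m) * Lb"
    have "((\<lambda>s. ?C * (LINT \<omega>|P. norm (XX s \<omega> - XX t \<omega>))) \<longlongrightarrow> 0) (at t within {0..T})"
      using XX_L1 t by (intro tendsto_mult_right_zero) (simp add: L1_continuous_def)
    from order_tendstoD(2)[OF this e] obtain d where d: "d > 0"
      "\<And>s. s \<in> {0..T} \<Longrightarrow> s \<noteq> t \<Longrightarrow> dist s t < d \<Longrightarrow> ?C * (LINT \<omega>|P. norm (XX s \<omega> - XX t \<omega>)) < e"
      unfolding eventually_at by blast
    have "dist (f n t) (f n s) < e" if s: "s \<in> {0..T}" "dist t s < d" for n s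
    proof (cases "s = t")
      case False
      have "norm (f n s - f n t) \<le> (\<Sum>i\<in>(UNIV::'m set). Lb * (LINT \<omega>|P. norm (XX s \<omega> - XX t \<omega>)))"
        using feedback_law_lipschitz[OF g XX_int[OF s(1)] XX_int[OF t] Lb]
        by (intro order_trans[OF norm_vec_le_sum[of "f n s - f n t"]] sum_mono) (simp add: f_def)
      also have "\<dots> = ?C * (LINT \<omega>|P. norm (XX s \<omega> - XX t \<omega>))" by simp
      also have "\<dots> < e" using d(2)[OF s(1) False] s(2) by (simp add: dist_commute)
      finally show ?thesis by (simp add: dist_norm norm_minus_commute)
    qed (use e in simp)
    then show "\<exists>d>0. \<forall>n s. s \<in> {0..T} \<and> dist t s < d \<longrightarrow> dist (f n t) (f n s) < e"
      using d(1) by blast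
  qed blast
  \<comment> \<open>A cluster point of the maps need not be the limit of any subsequence on the
    whole space. It takes the limit value at every law where the maps converge, and these include
    all laws of the limit flow.\<close>
  have "\<exists>k. k \<in> feedback_maps Mb Lb \<and> (\<forall>t\<in>{0..T}. (\<lambda>n. g (r1 (r2 n)) i (law P (XX t))) \<longlonglongrightarrow> k (law P (XX t)))" for i
  proof -
    obtain k where k: "k \<in> feedback_maps Mb Lb"
      "\<And>\<mu> l. \<mu> \<in> wasserstein_space 1 \<Longrightarrow> (\<lambda>n. g (r1 (r2 n)) i \<mu>) \<longlonglongrightarrow> l \<Longrightarrow> k \<mu> = l"
      using feedback_maps_cluster_point[of "\<lambda>n. g (r1 (r2 n)) i", OF g Mb] by blast
    have "(\<lambda>n. g (r1 (r2 n)) i (law P (XX t))) \<longlonglongrightarrow> k (law P (XX t))" if t: "t \<in> {0..T}" for t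
    proof -
      have l: "(\<lambda>n. g (r1 (r2 n)) i (law P (XX t))) \<longlonglongrightarrow> G t $ i"
        using tendsto_vec_nth[OF G[OF t], of i] by (simp add: f_def)
      then show ?thesis using k(2)[OF law_in_wasserstein_space[OF XX_int[OF t]] l] by simp
    qed
    then show ?thesis using k(1) by blast
  qed
  then obtain gs where gs: "\<And>i. gs i \<in> feedback_maps Mb Lb"
    and g_lim: "\<And>i t. t \<in> {0..T} \<Longrightarrow> (\<lambda>n. g (r1 (r2 n)) i (law P (XX t))) \<longlonglongrightarrow> gs i (law P (XX t))"
    by metis
  define c' where "c' n = (LINT s:{0..T}|lborel. \<Psi> (\<chi> i. h (r1 (r2 n)) i s) (\<chi> i. gs i (law P (XX s))))" for n
  obtain M where M: "\<And>a b. (\<forall>i. a $ i \<in> U) \<Longrightarrow> norm b \<le> real CARD('m) * Mb \<Longrightarrow> \<bar>\<Psi> a b\<bar> \<le> M"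
    using Psi_bounded by blast
  have "\<bar>c' n\<bar> \<le> T * M" for n
  proof -
    let ?p = "\<lambda>s. \<Psi> (\<chi> i. h (r1 (r2 n)) i s) (\<chi> i. gs i (law P (XX s)))"
    have p: "norm (?p s) \<le> M" if "s \<in> {0..T}" for s
      using h feedback_vec_bound[OF gs XX_int[OF that]] by (simp add: M)
    have "set_integrable lborel {0..T} ?p"
      using control_cost_measurable[OF regular_indicator_measurable[OF h] feedback_continuous[OF gs XX_L1]] p
      by (intro set_integrable_bounded_interval[where K = M]) (auto simp: set_borel_measurable_def)
    from set_integral_norm_le[OF this set_integrable_continuous_interval[OF continuous_on_const] p]
    have "norm (c' n) \<le> (LINT s:{0..T}|lborel. M)" unfolding c'_def by simp
    also have "\<dots> = T * M" using T by (simp add: set_lebesgue_integral_def)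
    finally show ?thesis by simp
  qed
  then have "bounded (range c')" by (auto simp: bounded_iff)
  then obtain l r3 where r3: "strict_mono (r3 :: nat \<Rightarrow> nat)" and c: "(c' \<circ> r3) \<longlonglongrightarrow> l"
    using bounded_imp_convergent_subsequence by blast
  define r where "r n = r1 (r2 (r3 n))" for n
  have r: "strict_mono r" unfolding r_def using r1 r2 r3 by (simp add: strict_mono_def)
  have r23: "strict_mono (\<lambda>n. r2 (r3 n))" using r2 r3 by (simp add: strict_mono_def)
  have X_lim': "(\<lambda>n. LINT \<omega>|P. norm (X (r n) t \<omega> - XX t \<omega>)) \<longlonglongrightarrow> 0" if "t \<in> {0..T}" for t
    using LIMSEQ_subseq_LIMSEQ[OF X_lim[OF that] r23] by (simp add: o_def r_def)
  have Y_lim': "(\<lambda>n. Y (r n) t) \<longlonglongrightarrow> YY t" if "t \<in> {0..T}" for t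
    using LIMSEQ_subseq_LIMSEQ[OF Y_lim[OF that] r23] by (simp add: o_def r_def)
  have g_lim': "(\<lambda>n. g (r n) i (law P (XX t))) \<longlonglongrightarrow> gs i (law P (XX t))" if "t \<in> {0..T}" for t i
    using LIMSEQ_subseq_LIMSEQ[OF g_lim[OF that, of i] r3] by (simp add: o_def r_def)
  note limits = h g gs mv ctl spread X_lim' Y_lim' YY XX_L1 g_lim'
  have c: "(\<lambda>n. LINT s:{0..T}|lborel. \<Psi> (\<chi> i. h (r n) i s) (\<chi> i. gs i (law P (XX s)))) \<longlonglongrightarrow> l"
    using c by (simp add: o_def c'_def r_def)
  obtain hs where hs: "regular hs" "mv hs gs XX YY"
    "cost hs gs XX YY \<le> (LINT t:{0..T}|lborel. Lc t (YY t) (law P (XX t))) + l"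
    using limit_solution_exists[of "\<lambda>n. h (r n)" "\<lambda>n. g (r n)" gs "\<lambda>n. X (r n)" "\<lambda>n. Y (r n)" XX YY,
        OF limits XX_ad XX_cont XX_eq c] by blast
  have "(\<lambda>n. cost (h (r n)) (g (r n)) (X (r n)) (Y (r n))) \<longlonglongrightarrow> (LINT t:{0..T}|lborel. Lc t (YY t) (law P (XX t))) + l"
    unfolding trajectory_cost_def
    using tendsto_add[OF running_cost_integral_tendsto[of "\<lambda>n. h (r n)" "\<lambda>n. g (r n)" gs "\<lambda>n. X (r n)" "\<lambda>n. Y (r n)" XX YY, OF limits]
      tendsto_add[OF control_cost_diff_tendsto[of "\<lambda>n. h (r n)" "\<lambda>n. g (r n)" gs "\<lambda>n. X (r n)" "\<lambda>n. Y (r n)" XX YY, OF limits] c]]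
    by simp
  then show ?thesis using r hs gs by blast
qed

theorem optimal_control_exists:
  "\<exists>(hs, gs) \<in> admissible T U Mb Lb. \<forall>(h, g) \<in> admissible T U Mb Lb. optimal_value hs gs \<le> optimal_value h g"
proof -
  let ?A = "admissible T U Mb Lb :: (('m \<Rightarrow> real \<Rightarrow> real^'l^'d) \<times> ('m \<Rightarrow> (real^'d) measure \<Rightarrow> real^'l)) set"
  define V where "V = (\<lambda>(h, g). optimal_value h g) ` ?A"
  obtain u0 where u0: "u0 \<in> U" using U(3) by blast
  have "(\<lambda>_. 0 :: real^'l) \<in> (feedback_maps Mb Lb :: ((real^'d) measure \<Rightarrow> real^'l) set)"
  proof -
    have "0 \<le> Lb * wasserstein_dist 1 \<mu> \<nu>" for \<mu> \<nu> :: "(real^'d) measure"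
      using Lb by (simp add: wasserstein_dist_def)
    then show ?thesis using Mb by (simp add: feedback_maps_def)
  qed
  then have "(\<lambda>_ _. u0, \<lambda>_ _. 0) \<in> ?A" using u0 by (intro regular_admissible) auto
  then have V: "V \<noteq> {}" unfolding V_def by blast
  \<comment> \<open>It is not known in advance that the values are bounded below. The property
    required of v makes sense in both cases; since the costs converge to a real number c along a
    subsequence, c then lies below every value.\<close>
  have "\<exists>v. (\<forall>n. v n \<in> V) \<and> (\<forall>z\<in>V. \<forall>e>0. \<forall>\<^sub>F n in sequentially. v n \<le> z + e)"
  proof (cases "bdd_below V")
    case True
    have "\<exists>x\<in>V. x < Inf V + 1 / real (Suc n)" for n
      using cInf_less_iff[OF V True, of "Inf V + 1 / real (Suc n)"] by simp
    then obtain v where v: "\<And>n. v n \<in> V" "\<And>n. v n < Inf V + 1 / real (Suc n)" by metis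
    have "\<forall>\<^sub>F n in sequentially. v n \<le> z + e" if "z \<in> V" "e > 0" for z e
    proof -
      have "\<forall>\<^sub>F n in sequentially. 1 / real (Suc n) < e"
        using order_tendstoD(2)[OF LIMSEQ_inverse_real_of_nat that(2)] by (simp add: inverse_eq_divide)
      then show ?thesis
      proof eventually_elim
        case (elim n)
        then show ?case using v(2)[of n] cInf_lower[OF that(1) True] by linarith
      qed
    qed
    then show ?thesis using v(1) by blast
  next
    case False
    have "\<exists>x\<in>V. x < - real n" for n
      using False unfolding bdd_below_def by (meson not_le)
    then obtain v where v: "\<And>n. v n \<in> V" "\<And>n. v n < - real n" by metis
    have "\<forall>\<^sub>F n in sequentially. v n \<le> z + e" if "z \<in> V" "e > 0" for z e
    proof -
      obtain N :: nat where N: "- z < real N" using reals_Archimedean2 by blast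
      have "v n \<le> z + e" if "n \<ge> N" for n
      proof -
        have "real N \<le> real n" using that by simp
        then show ?thesis using N v(2)[of n] \<open>e > 0\<close> by linarith
      qed
      then show ?thesis unfolding eventually_sequentially by blast
    qed
    then show ?thesis using v(1) by blast
  qed
  then obtain v where v: "\<And>n. v n \<in> V" and v_min: "\<And>z e. z \<in> V \<Longrightarrow> e > 0 \<Longrightarrow> \<forall>\<^sub>F n in sequentially. v n \<le> z + e"
    by blast
  have "\<exists>h g X Y. regular h \<and> (\<forall>i. g i \<in> feedback_maps Mb Lb) \<and> mv h g X Y \<and> controlled X Y \<and>
      integrable P spread \<and> v n = cost h g X Y" for n
  proof -
    obtain h g where hg: "(h, g) \<in> ?A" "v n = optimal_value h g"
      using v[of n] unfolding V_def by auto
    obtain h' where h': "regular h'" "\<And>i. (\<lambda>s. indicator {0..T} s *\<^sub>R h i s) \<in> borel_measurable borel"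
      "\<And>i. AE s in lborel. s \<in> {0..T} \<longrightarrow> h i s = h' i s"
      using regular_representative[OF hg(1)] by blast
    have g: "g i \<in> feedback_maps Mb Lb" for i using hg(1) by (auto simp: admissible_def)
    obtain X Y where XY: "mv h' g X Y" "controlled X Y" "integrable P spread"
      using controlled_solution_exists[of h' g, OF h'(1) g] by blast
    have "v n = cost h' g X Y"
      unfolding hg(2) by (rule optimal_value_eq[OF h' g XY(1)])
    then show ?thesis using h'(1) g XY by blast
  qed
  then obtain h g X Y where S: "\<And>n. regular (h n)" "\<And>n i. g n i \<in> feedback_maps Mb Lb"
    "\<And>n. mv (h n) (g n) (X n) (Y n)" "\<And>n. controlled (X n) (Y n)" "integrable P spread"
    and v_eq: "\<And>n. v n = cost (h n) (g n) (X n) (Y n)"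
    by metis
  obtain r hs gs XX YY c where r: "strict_mono (r :: nat \<Rightarrow> nat)" and hs: "regular hs"
    and gs: "\<forall>i. gs i \<in> feedback_maps Mb Lb" and mv: "mv hs gs XX YY"
    and c: "(\<lambda>n. cost (h (r n)) (g (r n)) (X (r n)) (Y (r n))) \<longlonglongrightarrow> c" "cost hs gs XX YY \<le> c"
    using minimizing_sequence_limit[of h g X Y, OF S] by (elim exE conjE)
  have gs': "gs i \<in> feedback_maps Mb Lb" for i using gs by blast
  have "optimal_value hs gs = cost hs gs XX YY"
    by (rule optimal_value_eq[OF hs regular_indicator_measurable[OF hs] _ gs' mv]) simp
  also have "\<dots> \<le> z" if "z \<in> V" for z
  proof -
    have "c \<le> z"
    proof (rule field_le_epsilon)
      fix e :: real assume "e > 0"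
      from v_min[OF that this] obtain N where N: "\<And>n. n \<ge> N \<Longrightarrow> v n \<le> z + e"
        unfolding eventually_sequentially by blast
      have "cost (h (r n)) (g (r n)) (X (r n)) (Y (r n)) \<le> z + e" if "n \<ge> N" for n
        using N[of "r n"] seq_suble[OF r, of n] that v_eq[of "r n"] by simp
      then show "c \<le> z + e" by (intro LIMSEQ_le_const2[OF c(1)]) blast
    qed
    then show ?thesis using c(2) by simp
  qed
  finally have "\<forall>(h, g)\<in>?A. optimal_value hs gs \<le> optimal_value h g"
    unfolding V_def by auto
  moreover have "(hs, gs) \<in> ?A" by (rule regular_admissible[OF hs gs'])
  ultimately show ?thesis by (intro bexI[of _ "(hs, gs)"]) simp_all
qed

end

section \<open>Constants for the locale from the hypotheses\<close>

lemma matrix_vector_mult_bounded: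
  assumes "bounded (U :: (real^'n^'m) set)"
  obtains K where "0 \<le> K" "\<And>A x. A \<in> U \<Longrightarrow> norm (A *v x) \<le> K * norm x"
proof -
  obtain B where B: "\<And>A. A \<in> U \<Longrightarrow> norm A \<le> B" using assms by (auto simp: bounded_iff)
  obtain c where c: "0 < c" "\<And>(A :: real^'n^'m) x. norm (A *v x) \<le> norm A * norm x * c"
    using bounded_bilinear.pos_bounded[OF bounded_bilinear_matrix_vector_mult] by blast
  show thesis
  proof (rule that[of "\<bar>B\<bar> * c"])
    fix A :: "real^'n^'m" and x :: "real^'n" assume "A \<in> U"
    then have "norm A \<le> \<bar>B\<bar>" using B by fastforce
    then have "norm A * norm x * c \<le> \<bar>B\<bar> * norm x * c"
      using c(1) by (intro mult_right_mono) auto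
    then show "norm (A *v x) \<le> \<bar>B\<bar> * c * norm x"
      using c(2)[of A x] by (simp add: ac_simps)
  qed (use c(1) in simp)
qed

lemma globally_lipschitz_bound:
  assumes "globally_lipschitz (f :: 'a::real_normed_vector \<Rightarrow> 'b::real_normed_vector)"
  obtains C where "0 \<le> C" "\<And>x y. norm (f x - f y) \<le> C * norm (x - y)"
  using assms unfolding globally_lipschitz_def lipschitz_on_def dist_norm by blast

theorem theorem4p3:
  fixes P :: "'w measure" and \<F> :: "real \<Rightarrow> 'w measure"
    and W :: "real \<Rightarrow> 'w \<Rightarrow> real^'d"
    and T \<sigma> Mb Lb p :: real
    and H1 H2 K1 K2 :: "real^'d \<Rightarrow> real^'d"
    and \<mu>0 :: "(real^'d) measure" and X0 :: "'w \<Rightarrow> real^'d" and Y0 :: "(real^'d)^'m"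
    and U :: "(real^'l^'d) set"
    and \<L> :: "real \<Rightarrow> (real^'d)^'m \<Rightarrow> (real^'d) measure \<Rightarrow> real"
    and \<Psi> :: "(real^'l^'d)^'m \<Rightarrow> (real^'l)^'m \<Rightarrow> real"
  assumes "T > 0" and "\<sigma> > 0" and "Mb > 0" and "Lb > 0"
    and "filtered_prob_space P \<F>"
    and "brownian_motion P \<F> T W"
    and "globally_lipschitz H1" and "globally_lipschitz H2"
    and "globally_lipschitz K1" and "globally_lipschitz K2"
    and "p > 1" and "\<mu>0 \<in> wasserstein_space p"
    and "X0 \<in> borel_measurable (\<F> 0)" and "law P X0 = \<mu>0"
    and "compact U" and "convex U" and "U \<noteq> {}"
    and "continuous_map
           (prod_topology (top_of_set {0..T}) (prod_topology euclidean (wasserstein_topology 1)))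
           euclidean (\<lambda>(t, y, \<mu>). \<L> t y \<mu>)"
    and "continuous_on UNIV (\<lambda>(a, b). \<Psi> a b)"
    and "\<And>b. convex_on UNIV (\<lambda>a. \<Psi> a b)"
  shows "\<exists>(hs, gs) \<in> admissible T U Mb Lb. \<forall>(h, g) \<in> admissible T U Mb Lb.
           cost_functional P \<F> W T \<sigma> H1 H2 K1 K2 X0 Y0 \<L> \<Psi> hs gs
             \<le> cost_functional P \<F> W T \<sigma> H1 H2 K1 K2 X0 Y0 \<L> \<Psi> h g"
proof -
  obtain C1 where C1: "0 \<le> C1" "\<And>x y. norm (H1 x - H1 y) \<le> C1 * norm (x - y)"
    using globally_lipschitz_bound[OF assms(7)] by blast
  obtain C2 where C2: "0 \<le> C2" "\<And>x y. norm (H2 x - H2 y) \<le> C2 * norm (x - y)"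
    using globally_lipschitz_bound[OF assms(8)] by blast
  obtain C3 where C3: "0 \<le> C3" "\<And>x y. norm (K1 x - K1 y) \<le> C3 * norm (x - y)"
    using globally_lipschitz_bound[OF assms(9)] by blast
  obtain C4 where C4: "0 \<le> C4" "\<And>x y. norm (K2 x - K2 y) \<le> C4 * norm (x - y)"
    using globally_lipschitz_bound[OF assms(10)] by blast
  define L where "L = max (max C1 C2) (max C3 C4)"
  have L: "0 \<le> L" using C1(1) by (simp add: L_def le_max_iff_disj)
  have weaken: "norm (f x - f y) \<le> L * norm (x - y)"
    if "\<And>x y. norm (f x - f y) \<le> C * norm (x - y)" "C \<le> L" for f :: "real^'d \<Rightarrow> real^'d" and C x y
    using that(1)[of x y] mult_right_mono[OF that(2) norm_ge_zero[of "x - y"]] by linarith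
  obtain KU where KU: "0 \<le> KU" "\<And>A x. A \<in> U \<Longrightarrow> norm (A *v x) \<le> KU * norm x"
    using matrix_vector_mult_bounded[OF compact_imp_bounded[OF \<open>compact U\<close>]] by blast
  interpret prob_space P using assms(5) by (simp add: filtered_prob_space_def)
  have "X0 \<in> borel_measurable P"
    using assms(5) \<open>X0 \<in> borel_measurable (\<F> 0)\<close> by (rule filtered_measurable)
  then have X0: "integrable P X0"
    using assms by (intro integrable_if_law_in_wasserstein_space[of X0 p]) auto
  interpret optimal_control P \<F> W T \<sigma> Mb Lb L KU H1 H2 K1 K2 X0 Y0 U \<L> \<Psi>
  proof unfold_locales
    show "norm (H1 x - H1 y) \<le> L * norm (x - y)" for x y
      by (rule weaken[OF C1(2)]) (simp add: L_def)
    show "norm (H2 x - H2 y) \<le> L * norm (x - y)" for x y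
      by (rule weaken[OF C2(2)]) (simp add: L_def)
    show "norm (K1 x - K1 y) \<le> L * norm (x - y)" for x y
      by (rule weaken[OF C3(2)]) (simp add: L_def)
    show "norm (K2 x - K2 y) \<le> L * norm (x - y)" for x y
      by (rule weaken[OF C4(2)]) (simp add: L_def)
  qed (use assms L KU X0 in auto)
  show ?thesis by (rule optimal_control_exists)
qed

end
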